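(* Let $x(t)\in\mathbb{R}^2$ be a solution of the planar Kepler problem $\ddot x=-x/|x|^3$ with negative energy, nonzero angular momentum $\mathbb{L}=x_1\dot x_2-\dot x_1x_2$ and positive eccentricity, so that its orbit is a non-circular ellipse with one focus at the origin. Let $a$ and $b$ be the semimajor and semiminor axes of this orbit. Then the numerical precession rate of the implicit midpoint rule with step size $h$ is, as $h\to0$, $$\operatorname{sgn}(\mathbb{L})\,\frac{\pi}{12}\left(15\,\frac{a^3}{b^6}-3\,\frac{a}{b^4}\right)h^2+\mathcal{O}(h^4).$$
   Context: $|\cdot|$ is the Euclidean norm and $\langle\cdot,\cdot\rangle$ the standard scalar product on $\mathbb{R}^2$. The Kepler problem has Lagrangian $\frac12|\dot x|^2+\frac1{|x|}$, i.e. potential $U(x)=-1/|x|$ and equation of motion $\ddot x=f(x)$ with $f(x)=-x/|x|^3$. An orbit with semimajor axis $a$ has period $T=2\pi a^{3/2}$. Implicit midpoint rule (second order formulation) with step size $h$: $$\frac{x_{k+1}-2x_k+x_{k-1}}{h^2}=\frac12 f\left(\frac{x_k+x_{k+1}}2\right)+\frac12 f\left(\frac{x_{k-1}+x_k}2\right).$$ Modified equation: the modified equation of the method is the second order differential equation (a formal power series in $h$ perturbing $\ddot x=f(x)$) whose solutions interpolate the discrete solutions, $x_k=x(kh)$. It is truncated after the first nontrivial term (order $h^2$). For the implicit midpoint rule applied to the Kepler problem, the modified equation agrees, up to a defect of order $\mathcal{O}(h^4)$, with the Euler–Lagrange equation of the modified Lagrangian $$\mathcal{L}_{\mathrm{mod},2}(x,\dot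 x)=\frac12|\dot x|^2+\frac1{|x|}+\frac{h^2}{24}\left(\frac1{|x|^4}+\frac{|\dot x|^2}{|x|^3}-3\frac{\langle x,\dot x\rangle^2}{|x|^5}\right).$$ Laplace–Runge–Lenz (LRL) vector: the vector $(A,B)$ with $$A(x,\dot x)=|\dot x|^2x_1-\langle x,\dot x\rangle\dot x_1-\frac{x_1}{|x|},\qquad B(x,\dot x)=|\dot x|^2x_2-\langle x,\dot x\rangle\dot x_2-\frac{x_2}{|x|}.$$ It is constant along exact Kepler solutions and its magnitude is the eccentricity $e=\sqrt{1-b^2/a^2}$. Let $\omega$ be the (continuously chosen) angle of $(A,B)$ with the first coordinate axis, $\omega=\arctan(B/A)$. Numerical precession rate: the change of $\omega$ along the solution of the modified equation (truncated after the first nontrivial term, of order $h^2$, i.e. the Euler–Lagrange equation of $\mathcal{L}_{\mathrm{mod},2}$, up to a defect $\mathcal{O}(h^4)$), started from the same initial position and velocity as the exact solution, over a time interval of length $T$, where $T$ is the period of the exact solution. The exact solution (its initial data) is fixed as $h\to0$. *)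

theory Defs
  imports "HOL-Analysis.Analysis"
begin

section \<open>The planar Kepler problem\<close>

definition kepler_force :: "real^2 \<Rightarrow> real^2" where
  "kepler_force q = - (1 / norm q ^ 3) *\<^sub>R q"

definition energy :: "real^2 \<Rightarrow> real^2 \<Rightarrow> real" where
  "energy q p = norm p ^ 2 / 2 - 1 / norm q"

definition ang_mom :: "real^2 \<Rightarrow> real^2 \<Rightarrow> real" where
  "ang_mom q p = q $ 1 * p $ 2 - p $ 1 * q $ 2"

text \<open>The Laplace--Runge--Lenz vector \<open>(A, B)\<close>; its norm is the eccentricity.\<close>

definition lrl :: "real^2 \<Rightarrow> real^2 \<Rightarrow> real^2" where
  "lrl q p = (norm p ^ 2) *\<^sub>R q - (q \<bullet> p) *\<^sub>R p - (1 / norm q) *\<^sub>R q"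

text \<open>
  \<open>y\<close> is a collision-free curve on \<open>S\<close> with velocity \<open>w\<close> that satisfies the second order
  equation \<open>y'' = F(y, y')\<close> up to a defect of norm at most \<open>\<epsilon>\<close>; \<open>\<epsilon> = 0\<close> means an exact solution.
\<close>

definition solves_within ::
  "real \<Rightarrow> (real^2 \<Rightarrow> real^2 \<Rightarrow> real^2) \<Rightarrow> real set \<Rightarrow> (real \<Rightarrow> real^2) \<Rightarrow> (real \<Rightarrow> real^2) \<Rightarrow> bool" where
  "solves_within \<epsilon> F S y w \<longleftrightarrow>
     (\<forall>t\<in>S. y t \<noteq> 0 \<and> (y has_vector_derivative w t) (at t within S) \<and>
        (\<exists>acc. (w has_vector_derivative acc) (at t within S) \<and> norm (acc - F (y t) (w t)) \<le> \<epsilon>))"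

abbreviation solves ::
  "(real^2 \<Rightarrow> real^2 \<Rightarrow> real^2) \<Rightarrow> real set \<Rightarrow> (real \<Rightarrow> real^2) \<Rightarrow> (real \<Rightarrow> real^2) \<Rightarrow> bool" where
  "solves \<equiv> solves_within 0"

definition kepler_solution :: "(real \<Rightarrow> real^2) \<Rightarrow> (real \<Rightarrow> real^2) \<Rightarrow> bool" where
  "kepler_solution x v \<longleftrightarrow> solves (\<lambda>q p. kepler_force q) UNIV x v"

text \<open>
  \<open>S\<close> is an ellipse with semimajor axis \<open>a\<close>, semiminor axis \<open>b\<close> and one focus at the origin.
  The unit vectors \<open>u\<close> and \<open>n\<close> span the major and the minor axis. The centre is at distance
  \<open>sqrt (a\<^sup>2 - b\<^sup>2)\<close> from the focus.
\<close>

definition ellipse_focus_origin :: "real \<Rightarrow> real \<Rightarrow> (real^2) set \<Rightarrow> bool" where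
  "ellipse_focus_origin a b S \<longleftrightarrow> 0 < b \<and> b \<le> a \<and>
     (\<exists>u n. norm u = 1 \<and> norm n = 1 \<and> u \<bullet> n = 0 \<and>
        S = range (\<lambda>s. (a * cos s - sqrt (a\<^sup>2 - b\<^sup>2)) *\<^sub>R u + (b * sin s) *\<^sub>R n))"

definition minimal_period :: "(real \<Rightarrow> 'a) \<Rightarrow> real \<Rightarrow> bool" where
  "minimal_period x T \<longleftrightarrow> 0 < T \<and> (\<forall>t. x (t + T) = x t) \<and>
     (\<forall>s. 0 < s \<and> s < T \<longrightarrow> (\<exists>t. x (t + s) \<noteq> x t))"


section \<open>The implicit midpoint rule and its modified equation\<close>

definition midpoint_residual :: "real \<Rightarrow> (real \<Rightarrow> real^2) \<Rightarrow> real \<Rightarrow> real^2" where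
  "midpoint_residual h y t =
     (1 / h\<^sup>2) *\<^sub>R (y (t + h) - 2 *\<^sub>R y t + y (t - h))
     - ((1/2) *\<^sub>R kepler_force ((1/2) *\<^sub>R (y t + y (t + h)))
        + (1/2) *\<^sub>R kepler_force ((1/2) *\<^sub>R (y (t - h) + y t)))"

definition truncated_rhs ::
  "(real^2 \<Rightarrow> real^2 \<Rightarrow> real^2) \<Rightarrow> real \<Rightarrow> real^2 \<Rightarrow> real^2 \<Rightarrow> real^2" where
  "truncated_rhs g h q p = kepler_force q + h\<^sup>2 *\<^sub>R g q p"

text \<open>
  \<open>y'' = f(y) + h\<^sup>2 g(y, y')\<close> is the modified equation truncated after order \<open>h\<^sup>2\<close>: its solutions
  interpolate the discrete solutions up to the truncation order, that is, they satisfy the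
  difference equation up to \<open>O(h\<^sup>3)\<close>, locally uniformly in phase space. This determines \<open>g\<close> on
  the collision-free phase space (and the residual is then in fact \<open>O(h\<^sup>4)\<close>, since the scheme is
  symmetric in \<open>h\<close>). Some regularity of \<open>g\<close> has to be required, because otherwise the condition
  could hold for lack of solutions.
\<close>

definition midpoint_modified_term :: "(real^2 \<Rightarrow> real^2 \<Rightarrow> real^2) \<Rightarrow> bool" where
  "midpoint_modified_term g \<longleftrightarrow>
     (\<exists>g' :: (real^2) \<times> (real^2) \<Rightarrow> ((real^2) \<times> (real^2)) \<Rightarrow>\<^sub>L (real^2).
        (\<forall>z. fst z \<noteq> 0 \<longrightarrow> ((\<lambda>(q, p). g q p) has_derivative blinfun_apply (g' z)) (at z)) \<and>
        continuous_on {z. fst z \<noteq> 0} g') \<and>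
     (\<forall>Q. compact Q \<and> Q \<subseteq> {z. fst z \<noteq> 0} \<longrightarrow>
        (\<exists>C. \<forall>\<^sub>F h in at_right 0. \<forall>y w t.
           solves (truncated_rhs g h) {t - h..t + h} y w \<and> (\<forall>s\<in>{t - h..t + h}. (y s, w s) \<in> Q)
           \<longrightarrow> norm (midpoint_residual h y t) \<le> C * h ^ 3))"


section \<open>Precession\<close>

text \<open>\<open>\<rho>\<close> is the change over \<open>[0, T]\<close> of a continuous choice \<open>\<omega>\<close> of the angle of the
  Laplace--Runge--Lenz vector along \<open>(y, w)\<close>; it does not depend on the choice of \<open>\<omega>\<close>.\<close>

definition lrl_angle_change ::
  "real \<Rightarrow> (real \<Rightarrow> real^2) \<Rightarrow> (real \<Rightarrow> real^2) \<Rightarrow> real \<Rightarrow> bool" where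
  "lrl_angle_change T y w \<rho> \<longleftrightarrow>
     (\<exists>\<omega>. continuous_on {0..T} \<omega> \<and>
        (\<forall>t\<in>{0..T}. lrl (y t) (w t) \<noteq> 0 \<and>
           lrl (y t) (w t) $ 1 = norm (lrl (y t) (w t)) * cos (\<omega> t) \<and>
           lrl (y t) (w t) $ 2 = norm (lrl (y t) (w t)) * sin (\<omega> t)) \<and>
        \<rho> = \<omega> T - \<omega> 0)"

text \<open>
  The rate is only defined up to the truncation error of the modified equation. Hence it is a
  relation: \<open>K * h ^ 4\<close> bounds the admitted defect in the truncated modified equation, and \<open>K = 0\<close>
  gives the solution of the truncated equation itself.
\<close>

definition midpoint_precession_rate ::
  "real^2 \<Rightarrow> real^2 \<Rightarrow> real \<Rightarrow> real \<Rightarrow> real \<Rightarrow> real \<Rightarrow> bool" where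
  "midpoint_precession_rate q\<^sub>0 p\<^sub>0 T K h \<rho> \<longleftrightarrow>
     (\<exists>g y w. midpoint_modified_term g \<and>
        solves_within (K * h ^ 4) (truncated_rhs g h) {0..T} y w \<and>
        y 0 = q\<^sub>0 \<and> w 0 = p\<^sub>0 \<and> lrl_angle_change T y w \<rho>)"

end

theory Submission
  imports Defs
begin

text \<open>Write \<open>f\<close> for the Kepler force. Inserting a Taylor expansion into the midpoint rule shows that the
\<open>h\<^sup>2\<close> term of its modified equation is
\<open>g = f'(q) f(q) / 6 + f''(q)(p, p) / 24\<close> (\<open>midpoint_term\<close>), and that no other continuously
differentiable \<open>g\<close> is possible away from collisions: for any candidate \<open>g\<close> the residual of the scheme along solutions of
\<open>y'' = f(y) + h\<^sup>2 g(y, y')\<close> is \<open>h\<^sup>2\<close> times the discrepancy of \<open>g\<close>, up to \<open>O(h\<^sup>3)\<close>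
(\<open>midpoint_consistency\<close>). As solutions exist through every point, a residual of order \<open>h\<^sup>3\<close> forces
the discrepancy to vanish (\<open>midpoint_modified_term_unique\<close>).

The Laplace--Runge--Lenz vector \<open>E\<close> is conserved by \<open>f\<close>, so along a solution of the truncated equation
only the perturbation moves it: its derivative is \<open>h\<^sup>2\<close> times the image of \<open>g\<close> under the velocity
derivative of \<open>lrl\<close> (\<open>lrl_kick\<close>), up to the admitted defect. By a Gronwall argument the perturbed
solution stays within \<open>O(h\<^sup>2)\<close> of the Kepler orbit on \<open>[0, T]\<close>, hence the kick may be evaluated
on the unperturbed orbit at the cost of \<open>O(h\<^sup>4)\<close> (\<open>lrl_drift\<close>). The vector therefore stays near \<open>E\<close>,
and every continuous choice of its angle changes by the arctangent of the quotient of the components of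
\<open>lrl\<close> across and along \<open>E\<close> (\<open>lrl_angle_change_iff\<close>). To leading order this is
\<open>h\<^sup>2 / e\<^sup>2\<close> times the integral over one period of the cross product of \<open>E\<close> with the kick.

That integral is elementary in the true anomaly \<open>u\<close> as variable of integration, for which \<open>u' = L / \<bar>x\<bar>\<^sup>2\<close> and
\<open>L\<^sup>2 / \<bar>x\<bar> = 1 + e cos u\<close>: the integrand becomes a polynomial in \<open>cos u\<close> of degree five
(\<open>drift_in_true_anomaly\<close>) with mean \<open>(e\<^sup>2/2 + e\<^sup>4/8) / L\<^sup>6\<close>. Over the minimal period, \<open>u\<close> advances
by exactly one turn in the direction of the motion (\<open>true_anomaly_period\<close>), which gives
\<open>sgn L * \<pi> * (1 + e\<^sup>2/4) / L\<^sup>6 * h\<^sup>2\<close>. The axes of the ellipse enter through \<open>L\<^sup>2 = b\<^sup>2/a\<close> and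
\<open>e\<^sup>2 = 1 - b\<^sup>2/a\<^sup>2\<close> (\<open>ellipse_lrl\<close>).\<close>

section \<open>Differential inequalities and differential equations\<close>

text \<open>The mean value inequality, in the form in which one-sided derivatives at the end points are given.\<close>

lemma norm_increment_le:
  fixes f :: "real \<Rightarrow> 'a::real_normed_vector"
  assumes "a \<le> b"
    and f: "\<And>t. t \<in> {a..b} \<Longrightarrow> (f has_vector_derivative f' t) (at t within {a..b})"
    and \<phi>: "\<And>t. t \<in> {a..b} \<Longrightarrow> (\<phi> has_real_derivative \<phi>' t) (at t within {a..b})"
    and le: "\<And>t. a < t \<Longrightarrow> t < b \<Longrightarrow> norm (f' t) \<le> \<phi>' t"
  shows "norm (f b - f a) \<le> \<phi> b - \<phi> a"
proof (cases "a < b")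
  case True
  show ?thesis
  proof (rule differentiable_bound_general[OF True])
    show "continuous_on {a..b} f"
      using f by (meson continuous_on_eq_continuous_within has_vector_derivative_continuous)
    show "continuous_on {a..b} \<phi>"
      using \<phi> by (meson DERIV_continuous_on)
    fix t assume t: "a < t" "t < b"
    then have at: "at t within {a..b} = at t" by (simp add: at_within_Icc_at)
    show "(f has_vector_derivative f' t) (at t)" using f[of t] t by (simp add: at)
    show "(\<phi> has_vector_derivative \<phi>' t) (at t)"
      using \<phi>[of t] t by (simp add: at has_real_derivative_iff_has_vector_derivative)
    show "norm (f' t) \<le> \<phi>' t" using le t .
  qed
qed (use assms(1) in auto)

lemma norm_increment_le_const:
  fixes f :: "real \<Rightarrow> 'a::real_normed_vector"
  assumes "a \<le> b"
    and "\<And>t. t \<in> {a..b} \<Longrightarrow> (f has_vector_derivative f' t) (at t within {a..b})"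
    and "\<And>t. t \<in> {a..b} \<Longrightarrow> norm (f' t) \<le> c"
  shows "norm (f b - f a) \<le> c * (b - a)"
proof -
  have "norm (f b - f a) \<le> c * b - c * a"
    by (rule norm_increment_le[OF assms(1,2), where \<phi>' = "\<lambda>_. c"])
      (use assms(3) in \<open>auto intro!: derivative_eq_intros\<close>)
  then show ?thesis by (simp add: algebra_simps)
qed

lemma norm_increment_initial_le:
  fixes f :: "real \<Rightarrow> 'a::real_normed_vector"
  assumes f: "\<And>t. t \<in> {0..h} \<Longrightarrow> (f has_vector_derivative f' t) (at t within {0..h})"
    and le: "\<And>t. t \<in> {0..h} \<Longrightarrow> norm (f' t) \<le> c" and s: "s \<in> {0..h}"
  shows "norm (f s - f 0) \<le> c * s"
proof -
  have "norm (f s - f 0) \<le> c * (s - 0)"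
  proof (rule norm_increment_le_const)
    fix t assume t: "t \<in> {0..s}"
    then show "(f has_vector_derivative f' t) (at t within {0..s})"
      using s by (intro has_vector_derivative_within_subset[OF f]) auto
    show "norm (f' t) \<le> c" using le[of t] t s by auto
  qed (use s in auto)
  then show ?thesis by simp
qed

lemma zero_derivative_imp_eq_initial:
  fixes f :: "real \<Rightarrow> real"
  assumes "\<And>t. t \<in> {0..h} \<Longrightarrow> (f has_real_derivative 0) (at t within {0..h})" "s \<in> {0..h}"
  shows "f s = f 0"
  using norm_increment_initial_le[of h f "\<lambda>_. 0" 0 s] assms
  by (simp add: has_real_derivative_iff_has_vector_derivative)

lemma taylor_second_order_bound:
  fixes f :: "real \<Rightarrow> 'a::real_normed_vector"
  assumes f: "\<And>s. s \<in> {0..h} \<Longrightarrow> (f has_vector_derivative f1 s) (at s within {0..h})"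
    and f1: "\<And>s. s \<in> {0..h} \<Longrightarrow> (f1 has_vector_derivative f2 s) (at s within {0..h})"
    and le: "\<And>s. s \<in> {0..h} \<Longrightarrow> norm (f2 s - c) \<le> \<epsilon>"
    and s: "s \<in> {0..h}"
  shows "norm (f s - f 0 - s *\<^sub>R f1 0 - (s\<^sup>2/2) *\<^sub>R c) \<le> \<epsilon> * h\<^sup>2"
proof -
  have \<epsilon>: "0 \<le> \<epsilon>" using le[OF s] norm_ge_zero order_trans by blast
  have 1: "norm (f1 r - f1 0 - r *\<^sub>R c) \<le> \<epsilon> * h" if r: "r \<in> {0..h}" for r
  proof -
    have "norm ((f1 r - r *\<^sub>R c) - (f1 0 - 0 *\<^sub>R c)) \<le> \<epsilon> * r"
      by (rule norm_increment_initial_le[where f' = "\<lambda>t. f2 t - c", OF _ le r])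
        (auto intro!: derivative_eq_intros f1)
    also have "\<dots> \<le> \<epsilon> * h" using r \<epsilon> by (simp add: mult_left_mono)
    finally show ?thesis by (simp add: algebra_simps)
  qed
  have "norm ((f s - s *\<^sub>R f1 0 - (s\<^sup>2/2) *\<^sub>R c) - (f 0 - 0 *\<^sub>R f1 0 - (0\<^sup>2/2) *\<^sub>R c)) \<le> (\<epsilon> * h) * s"
    by (rule norm_increment_initial_le[where f' = "\<lambda>t. f1 t - f1 0 - t *\<^sub>R c", OF _ 1 s])
      (auto intro!: derivative_eq_intros f)
  also have "\<dots> \<le> \<epsilon> * h * h" using s \<epsilon> by (intro mult_left_mono) auto
  finally show ?thesis by (simp add: algebra_simps power2_eq_square)
qed

text \<open>A Gronwall estimate whose differential inequality is needed only inside the tube \<open>norm (d t) \<le> \<delta>\<close>.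
The curve \<open>\<beta> t = 2 * \<epsilon> / M * exp (2 * M * t)\<close> stays below \<open>\<delta>\<close> and grows strictly faster than the
inequality permits \<open>norm (d t)\<close> to grow, so \<open>d\<close> has no first time at which it catches up with \<open>\<beta>\<close> and
never leaves the tube. The rate \<open>2 * M\<close> and the factor \<open>2\<close> are wasteful, but make the comparison strict.\<close>

lemma gronwall_tube:
  fixes d :: "real \<Rightarrow> 'a::real_normed_vector"
  assumes d: "\<And>t. t \<in> {0..T} \<Longrightarrow> (d has_vector_derivative d' t) (at t within {0..T})"
    and d0: "d 0 = 0"
    and le: "\<And>t. t \<in> {0..T} \<Longrightarrow> norm (d t) \<le> \<delta> \<Longrightarrow> norm (d' t) \<le> M * norm (d t) + \<epsilon>"
    and pos: "0 < M" "0 < \<epsilon>"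
    and small: "2 * \<epsilon> / M * exp (2 * M * T) \<le> \<delta>"
    and t: "t \<in> {0..T}"
  shows "norm (d t) \<le> 2 * \<epsilon> / M * exp (2 * M * T)"
proof -
  define \<beta> where "\<beta> t = 2 * \<epsilon> / M * exp (2 * M * t)" for t
  have \<beta>_mono: "\<beta> r \<le> \<beta> s" if "r \<le> s" for r s using that pos by (auto simp: \<beta>_def intro!: divide_right_mono)
  have \<beta>0: "\<beta> 0 > 0" using pos by (simp add: \<beta>_def)
  have \<beta>\<delta>: "\<beta> r \<le> \<delta>" if "r \<in> {0..T}" for r
    using \<beta>_mono[of r T] small that by (auto simp: \<beta>_def)
  have dc: "continuous_on {0..T} d"
    using d by (meson continuous_on_eq_continuous_within has_vector_derivative_continuous)
  have \<beta>c: "continuous_on {0..T} \<beta>" unfolding \<beta>_def by (intro continuous_intros)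
  have "norm (d r) < \<beta> r" if r: "r \<in> {0..T}" for r
  proof (rule ccontr)
    assume "\<not> norm (d r) < \<beta> r"
    \<comment> \<open>The infimum of \<open>S\<close> is the first time at which \<open>d\<close> reaches \<open>\<beta>\<close>.\<close>
    define S where "S = {t \<in> {0..T}. 0 \<le> norm (d t) - \<beta> t}"
    have "S = {0..T} \<inter> (\<lambda>t. norm (d t) - \<beta> t) -` {0..}" by (auto simp: S_def)
    moreover have "continuous_on {0..T} (\<lambda>t. norm (d t) - \<beta> t)"
      by (intro continuous_intros dc \<beta>c)
    ultimately have "closed S" using continuous_closed_preimage by (metis closed_atLeastAtMost closed_atLeast)
    moreover have "r \<in> S" using r \<open>\<not> _\<close> by (auto simp: S_def)
    moreover have "bdd_below S" by (rule bdd_belowI[of _ 0]) (auto simp: S_def)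
    ultimately have s: "Inf S \<in> S" and low: "\<And>t. t \<in> S \<Longrightarrow> Inf S \<le> t"
      by (auto intro!: closed_contains_Inf cInf_lower)
    define s where "s = Inf S"
    have sT: "s \<in> {0..T}" and ds: "\<beta> s \<le> norm (d s)" using s by (auto simp: s_def S_def)
    have before: "norm (d t) < \<beta> t" if "0 \<le> t" "t < s" for t
      using low[of t] that sT by (force simp: s_def S_def)
    have "norm (d s - d 0) \<le> \<beta> s - \<beta> 0"
    proof (rule norm_increment_le)
      fix t assume t: "t \<in> {0..s}"
      show "(d has_vector_derivative d' t) (at t within {0..s})"
        using d[of t] t sT by (auto intro: has_vector_derivative_within_subset)
      show "(\<beta> has_real_derivative 2 * M * \<beta> t) (at t within {0..s})"
        unfolding \<beta>_def by (auto intro!: derivative_eq_intros)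
    next
      fix t assume t: "0 < t" "t < s"
      have tT: "t \<in> {0..T}" using t sT by auto
      have "norm (d' t) \<le> M * norm (d t) + \<epsilon>"
        using le[OF tT] before[of t] \<beta>\<delta>[OF tT] t by auto
      also have "\<dots> \<le> M * \<beta> t + M * \<beta> t"
      proof (rule add_mono)
        show "M * norm (d t) \<le> M * \<beta> t" using before[of t] t pos by simp
        have "1 \<le> exp (2 * M * t)" using pos t by simp
        then have "\<epsilon> * 1 \<le> (2 * \<epsilon>) * exp (2 * M * t)" using pos by (intro mult_mono) auto
        then show "\<epsilon> \<le> M * \<beta> t" using pos by (simp add: \<beta>_def)
      qed
      finally show "norm (d' t) \<le> 2 * M * \<beta> t" by simp
    qed (use sT in auto)
    then show False using ds \<beta>0 d0 by simp
  qed
  from this[OF t] \<beta>_mono[of t T] t show ?thesis by (auto simp: \<beta>_def)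
qed

text \<open>Global existence for a globally Lipschitz right-hand side. With the weight \<open>exp (- 2 * L * t)\<close> the
Picard operator contracts the supremum norm by the factor \<open>1/2\<close> on an interval of any length, so
one application of Banach's fixed point theorem suffices and no pieces have to be glued together.\<close>

lemma picard_lindelof:
  fixes F :: "'a::banach \<Rightarrow> 'a"
  assumes Lip: "\<And>x y. norm (F x - F y) \<le> L * norm (x - y)" and L: "0 < L" and b: "0 \<le> b"
  shows "\<exists>z. z 0 = z\<^sub>0 \<and> (\<forall>t\<in>{0..b}. (z has_vector_derivative F (z t)) (at t within {0..b}))"
proof -
  have F_cont: "continuous_on UNIV F"
    using Lip L by (intro lipschitz_on_continuous_on[of L] lipschitz_onI) (auto simp: dist_norm)
  \<comment> \<open>The unknown is \<open>u t = exp (- 2 L t) z t\<close>.\<close>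
  define G where "G u s = F (exp (2 * L * s) *\<^sub>R u s)" for u :: "real \<Rightarrow>\<^sub>C 'a" and s
  define I where "I u t = z\<^sub>0 + integral {0..t} (G u)" for u t
  have Gc: "continuous_on {0..b} (G u)" for u unfolding G_def
    by (rule continuous_on_compose2[OF F_cont]) (auto intro!: continuous_intros)
  have I_deriv: "(I u has_vector_derivative G u t) (at t within {0..b})" if "t \<in> {0..b}" for u t
    unfolding I_def using integral_has_vector_derivative[OF Gc that]
    by (auto intro!: derivative_eq_intros)
  have "\<exists>P. \<forall>u. (\<forall>t. apply_bcontfun (P u) t
      = exp (- 2 * L * clamp 0 b t) *\<^sub>R I u (clamp 0 b t))"
  proof (rule choice, rule allI)
    fix u
    have "continuous_on (cbox 0 b) (\<lambda>t. exp (- 2 * L * t) *\<^sub>R I u t)"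
      unfolding cbox_interval using I_deriv
      by (intro continuous_intros) (meson continuous_on_eq_continuous_within has_vector_derivative_continuous)
    from continuous_on_cbox_bcontfunE[OF this]
    show "\<exists>Pu. \<forall>t. apply_bcontfun Pu t = exp (- 2 * L * clamp 0 b t) *\<^sub>R I u (clamp 0 b t)" by metis
  qed
  then obtain P where P: "\<And>u t. apply_bcontfun (P u) t
      = exp (- 2 * L * clamp 0 b t) *\<^sub>R I u (clamp 0 b t)" by blast
  have contr: "dist (P u) (P v) \<le> 1/2 * dist u v" for u v
  proof (rule dist_bound)
    fix t
    define \<tau> where "\<tau> = clamp 0 b t"
    have \<tau>: "\<tau> \<in> {0..b}" using clamp_in_interval[of 0 b t] b by (auto simp: \<tau>_def cbox_interval)
    have "norm ((I u \<tau> - I v \<tau>) - (I u 0 - I v 0))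
        \<le> (dist u v / 2) * exp (2 * L * \<tau>) - (dist u v / 2) * exp (2 * L * 0)"
    proof (rule norm_increment_le)
      fix s assume s: "s \<in> {0..\<tau>}"
      show "((\<lambda>s. I u s - I v s) has_vector_derivative G u s - G v s) (at s within {0..\<tau>})"
        using I_deriv[of s u] I_deriv[of s v] s \<tau>
        by (auto intro!: derivative_eq_intros intro: has_vector_derivative_within_subset)
      show "((\<lambda>s. (dist u v / 2) * exp (2 * L * s)) has_real_derivative
          L * exp (2 * L * s) * dist u v) (at s within {0..\<tau>})"
        by (auto intro!: derivative_eq_intros)
    next
      fix s
      have "norm (G u s - G v s) \<le> L * norm (exp (2 * L * s) *\<^sub>R u s - exp (2 * L * s) *\<^sub>R v s)"
        unfolding G_def by (rule Lip)
      also have "\<dots> = L * exp (2 * L * s) * dist (u s) (v s)"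
        by (simp add: dist_norm flip: scaleR_diff_right)
      also have "\<dots> \<le> L * exp (2 * L * s) * dist u v"
        using L by (intro mult_left_mono dist_bounded) auto
      finally show "norm (G u s - G v s) \<le> L * exp (2 * L * s) * dist u v" .
    qed (use \<tau> in auto)
    also have "\<dots> \<le> exp (2 * L * \<tau>) * (1/2 * dist u v)" by simp
    finally have "norm (I u \<tau> - I v \<tau>) \<le> exp (2 * L * \<tau>) * (1/2 * dist u v)"
      by (simp add: I_def)
    then have "exp (- 2 * L * \<tau>) * norm (I u \<tau> - I v \<tau>) \<le> exp (- 2 * L * \<tau>) * (exp (2 * L * \<tau>) * (1/2 * dist u v))"
      by (intro mult_left_mono) auto
    also have "\<dots> = 1/2 * dist u v" by (simp flip: exp_add mult.assoc)
    finally show "dist (P u t) (P v t) \<le> 1/2 * dist u v"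
      unfolding P \<tau>_def[symmetric] by (simp add: dist_norm flip: scaleR_diff_right)
  qed
  obtain u where u: "P u = u"
    using banach_fix_type[of "1/2" P] contr by auto
  have "exp (2 * L * t) *\<^sub>R u t = I u t" if "t \<in> {0..b}" for t
    using P[of u t] that by (simp add: u cbox_interval flip: exp_add)
  then have eq: "G u t = F (I u t)" if "t \<in> {0..b}" for t
    using that by (simp add: G_def)
  show ?thesis
    using I_deriv[of _ u] eq by (intro exI[of _ "I u"]) (auto simp: I_def)
qed

section \<open>Bounded Lipschitz functions and continuously differentiable functions\<close>

text \<open>Boundedness is part of the notion because it makes it closed under products. Every right-hand side
below is a polynomial in the state and in \<open>1 / norm q\<close>, so Lipschitz bounds follow from closure
rules alone. Unlike bounds on derivatives they need no convexity, which matters because the region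
around a Kepler orbit has a hole at the origin.\<close>

definition bounded_lipschitz_on :: "'a::real_normed_vector set \<Rightarrow> ('a \<Rightarrow> 'b::real_normed_vector) \<Rightarrow> bool" where
  "bounded_lipschitz_on S f \<longleftrightarrow>
     (\<exists>B. \<forall>x\<in>S. norm (f x) \<le> B \<and> (\<forall>y\<in>S. norm (f x - f y) \<le> B * norm (x - y)))"

lemma bounded_lipschitz_onI:
  assumes "\<And>x. x \<in> S \<Longrightarrow> norm (f x) \<le> B"
    and "\<And>x y. x \<in> S \<Longrightarrow> y \<in> S \<Longrightarrow> norm (f x - f y) \<le> L * norm (x - y)"
  shows "bounded_lipschitz_on S f"
  unfolding bounded_lipschitz_on_def
proof (intro exI[of _ "max B L"] ballI conjI)
  fix x y assume x: "x \<in> S" and y: "y \<in> S"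
  show "norm (f x) \<le> max B L" using assms(1)[OF x] by simp
  show "norm (f x - f y) \<le> max B L * norm (x - y)"
    using assms(2)[OF x y] by (rule order_trans) (simp add: mult_right_mono)
qed

lemma bounded_lipschitz_onE:
  assumes "bounded_lipschitz_on S f"
  obtains B where "0 < B" "\<And>x. x \<in> S \<Longrightarrow> norm (f x) \<le> B"
    "\<And>x y. x \<in> S \<Longrightarrow> y \<in> S \<Longrightarrow> norm (f x - f y) \<le> B * norm (x - y)"
proof -
  obtain B where B: "\<And>x. x \<in> S \<Longrightarrow> norm (f x) \<le> B"
    "\<And>x y. x \<in> S \<Longrightarrow> y \<in> S \<Longrightarrow> norm (f x - f y) \<le> B * norm (x - y)"
    using assms unfolding bounded_lipschitz_on_def by blast
  show ?thesis
  proof (rule that[of "max B 1"])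
    fix x y assume x: "x \<in> S" and y: "y \<in> S"
    show "norm (f x - f y) \<le> max B 1 * norm (x - y)"
      using B(2)[OF x y] by (rule order_trans) (simp add: mult_right_mono)
  qed (use B(1) in \<open>force+\<close>)
qed

lemma bounded_lipschitz_on_subset: "bounded_lipschitz_on S f \<Longrightarrow> T \<subseteq> S \<Longrightarrow> bounded_lipschitz_on T f"
  unfolding bounded_lipschitz_on_def by blast

lemma bounded_lipschitz_on_const: "bounded_lipschitz_on S (\<lambda>x. c)"
  by (rule bounded_lipschitz_onI[of _ _ "norm c" 0]) auto

lemma bounded_lipschitz_on_add:
  assumes "bounded_lipschitz_on S f" "bounded_lipschitz_on S g"
  shows "bounded_lipschitz_on S (\<lambda>x. f x + g x)"
proof -
  obtain A where A: "\<And>x. x \<in> S \<Longrightarrow> norm (f x) \<le> A"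
    "\<And>x y. x \<in> S \<Longrightarrow> y \<in> S \<Longrightarrow> norm (f x - f y) \<le> A * norm (x - y)"
    using assms(1) by (rule bounded_lipschitz_onE) blast
  obtain B where B: "\<And>x. x \<in> S \<Longrightarrow> norm (g x) \<le> B"
    "\<And>x y. x \<in> S \<Longrightarrow> y \<in> S \<Longrightarrow> norm (g x - g y) \<le> B * norm (x - y)"
    using assms(2) by (rule bounded_lipschitz_onE) blast
  show ?thesis
  proof (rule bounded_lipschitz_onI)
    fix x y assume x: "x \<in> S" and y: "y \<in> S"
    show "norm (f x + g x) \<le> A + B" using A(1)[OF x] B(1)[OF x] by (intro norm_triangle_le) simp
    have "norm (f x + g x - (f y + g y)) \<le> norm (f x - f y) + norm (g x - g y)"
      by (metis add_diff_add norm_triangle_ineq)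
    then show "norm (f x + g x - (f y + g y)) \<le> (A + B) * norm (x - y)"
      using A(2)[OF x y] B(2)[OF x y] by (simp add: algebra_simps)
  qed
qed

lemma bounded_lipschitz_on_bounded_bilinear:
  assumes "bounded_bilinear bil" "bounded_lipschitz_on S f" "bounded_lipschitz_on S g"
  shows "bounded_lipschitz_on S (\<lambda>x. bil (f x) (g x))"
proof -
  interpret bounded_bilinear bil by fact
  obtain A where A: "0 < A" "\<And>x. x \<in> S \<Longrightarrow> norm (f x) \<le> A"
    "\<And>x y. x \<in> S \<Longrightarrow> y \<in> S \<Longrightarrow> norm (f x - f y) \<le> A * norm (x - y)"
    using assms(2) by (rule bounded_lipschitz_onE) blast
  obtain B where B: "0 < B" "\<And>x. x \<in> S \<Longrightarrow> norm (g x) \<le> B"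
    "\<And>x y. x \<in> S \<Longrightarrow> y \<in> S \<Longrightarrow> norm (g x - g y) \<le> B * norm (x - y)"
    using assms(3) by (rule bounded_lipschitz_onE) blast
  obtain K where K: "0 \<le> K" "\<And>a b. norm (bil a b) \<le> norm a * norm b * K"
    using nonneg_bounded by blast
  show ?thesis
  proof (rule bounded_lipschitz_onI)
    fix x y assume x: "x \<in> S" and y: "y \<in> S"
    have "norm (f x) * norm (g x) * K \<le> A * B * K"
      using A(1) A(2)[OF x] B(1) B(2)[OF x] K by (intro mult_mono) auto
    then show "norm (bil (f x) (g x)) \<le> A * B * K" using K(2) order_trans by blast
    have "bil (f x) (g x) - bil (f y) (g y) = bil (f x) (g x - g y) + bil (f x - f y) (g y)"
      by (simp add: diff_left diff_right)
    then have "norm (bil (f x) (g x) - bil (f y) (g y))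
        \<le> norm (f x) * norm (g x - g y) * K + norm (f x - f y) * norm (g y) * K"
      using K(2) by (metis norm_triangle_mono)
    also have "\<dots> \<le> A * (B * norm (x - y)) * K + (A * norm (x - y)) * B * K"
      using A(1) A(2)[OF x] A(3)[OF x y] B(1) B(2)[OF y] B(3)[OF x y] K
      by (intro add_mono mult_right_mono mult_mono) auto
    also have "\<dots> = (2 * A * B * K) * norm (x - y)" by (simp add: algebra_simps)
    finally show "norm (bil (f x) (g x) - bil (f y) (g y)) \<le> (2 * A * B * K) * norm (x - y)" .
  qed
qed

lemmas bounded_lipschitz_on_scaleR = bounded_lipschitz_on_bounded_bilinear[OF bounded_bilinear_scaleR]
  and bounded_lipschitz_on_inner = bounded_lipschitz_on_bounded_bilinear[OF bounded_bilinear_inner]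
  and bounded_lipschitz_on_mult = bounded_lipschitz_on_bounded_bilinear[OF bounded_bilinear_mult]

lemma bounded_lipschitz_on_power:
  fixes f :: "'a::real_normed_vector \<Rightarrow> 'b::real_normed_algebra_1"
  assumes "bounded_lipschitz_on S f"
  shows "bounded_lipschitz_on S (\<lambda>x. f x ^ n)"
  by (induction n) (auto intro!: bounded_lipschitz_on_const bounded_lipschitz_on_mult assms)

lemma bounded_lipschitz_on_bounded_linear:
  assumes "bounded_linear T" "bounded_lipschitz_on S f"
  shows "bounded_lipschitz_on S (\<lambda>x. T (f x))"
proof -
  have "bounded_bilinear (\<lambda>(r::real) x. r *\<^sub>R T x)"
    by (rule bounded_bilinear.comp[OF bounded_bilinear_scaleR bounded_linear_ident assms(1)])
  from bounded_lipschitz_on_bounded_bilinear[OF this bounded_lipschitz_on_const[of _ 1] assms(2)]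
  show ?thesis by simp
qed

lemma bounded_lipschitz_on_minus: "bounded_lipschitz_on S f \<Longrightarrow> bounded_lipschitz_on S (\<lambda>x. - f x)"
  by (rule bounded_lipschitz_on_bounded_linear[OF bounded_linear_minus[OF bounded_linear_ident]])

lemma bounded_lipschitz_on_diff:
  "bounded_lipschitz_on S f \<Longrightarrow> bounded_lipschitz_on S g \<Longrightarrow> bounded_lipschitz_on S (\<lambda>x. f x - g x)"
  using bounded_lipschitz_on_add[of S f "\<lambda>x. - g x"] bounded_lipschitz_on_minus[of S g] by simp

lemma bounded_lipschitz_on_Pair:
  assumes "bounded_lipschitz_on S f" "bounded_lipschitz_on S g"
  shows "bounded_lipschitz_on S (\<lambda>x. (f x, g x))"
  using bounded_lipschitz_on_add[OF
      bounded_lipschitz_on_bounded_linear[OF bounded_linear_Pair[OF bounded_linear_ident bounded_linear_zero] assms(1)]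
      bounded_lipschitz_on_bounded_linear[OF bounded_linear_Pair[OF bounded_linear_zero bounded_linear_ident] assms(2)]]
  by simp

lemma bounded_lipschitz_on_of_bounded_linear:
  assumes "bounded_linear T" "bounded S"
  shows "bounded_lipschitz_on S T"
proof -
  obtain R where "\<And>x. x \<in> S \<Longrightarrow> norm x \<le> R" using assms(2) by (auto simp: bounded_iff)
  then have "bounded_lipschitz_on S (\<lambda>x. x)" by (rule bounded_lipschitz_onI[of _ _ _ 1]) auto
  then show ?thesis by (rule bounded_lipschitz_on_bounded_linear[OF assms(1)])
qed

lemma inverse_diff_le:
  fixes r s :: real
  assumes c: "0 < c" and "c \<le> r" "c \<le> s"
  shows "\<bar>1 / r - 1 / s\<bar> \<le> (1 / c\<^sup>2) * \<bar>r - s\<bar>"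
proof -
  have "\<bar>1 / r - 1 / s\<bar> = \<bar>r - s\<bar> / (r * s)"
    using assms by (auto simp: field_simps abs_if)
  also have "\<dots> \<le> \<bar>r - s\<bar> / c\<^sup>2"
    using assms by (intro divide_left_mono mult_pos_pos) (auto simp: power2_eq_square intro!: mult_mono)
  finally show ?thesis by simp
qed

lemma bounded_lipschitz_on_inverse:
  assumes f: "\<And>x y. x \<in> S \<Longrightarrow> y \<in> S \<Longrightarrow> \<bar>f x - f y\<bar> \<le> L * norm (x - y)"
    and c: "0 < c" and low: "\<And>x. x \<in> S \<Longrightarrow> c \<le> f x"
  shows "bounded_lipschitz_on S (\<lambda>x. 1 / f x :: real)"
proof (rule bounded_lipschitz_onI)
  fix x y assume x: "x \<in> S" and y: "y \<in> S"
  show "norm (1 / f x) \<le> 1 / c"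
    using c low[OF x] by (simp add: frac_le)
  have "\<bar>1 / f x - 1 / f y\<bar> \<le> (1 / c\<^sup>2) * \<bar>f x - f y\<bar>"
    by (rule inverse_diff_le[OF c low[OF x] low[OF y]])
  also have "\<dots> \<le> (1 / c\<^sup>2) * (L * norm (x - y))"
    by (intro mult_left_mono f x y) auto
  finally show "norm (1 / f x - 1 / f y) \<le> (1 / c\<^sup>2 * L) * norm (x - y)" by simp
qed

lemmas bounded_lipschitz_on_intros =
  bounded_lipschitz_on_const bounded_lipschitz_on_add bounded_lipschitz_on_diff
  bounded_lipschitz_on_minus bounded_lipschitz_on_scaleR bounded_lipschitz_on_inner
  bounded_lipschitz_on_mult bounded_lipschitz_on_power bounded_lipschitz_on_Pair

text \<open>Radial clamping to a ball, which turns Lipschitz functions on the ball into globally Lipschitz ones.\<close>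

lemma closest_point_cball_0:
  fixes x :: "'a::euclidean_space"
  assumes "0 \<le> R"
  shows "norm (closest_point (cball 0 R) x) \<le> R"
    and "norm (closest_point (cball 0 R) x - closest_point (cball 0 R) y) \<le> norm (x - y)"
    and "norm x \<le> R \<Longrightarrow> closest_point (cball 0 R) x = x"
proof -
  show "norm (closest_point (cball 0 R) x) \<le> R"
    using closest_point_in_set[of "cball 0 R" x] assms by auto
  show "norm (closest_point (cball 0 R) x - closest_point (cball 0 R) y) \<le> norm (x - y)"
    using closest_point_lipschitz[of "cball 0 R" x y] assms by (auto simp: dist_norm)
  show "norm x \<le> R \<Longrightarrow> closest_point (cball 0 R) x = x" by (simp add: closest_point_self)
qed

text \<open>Continuity of the derivative is tested in each direction separately. In finite dimension this amounts to
continuity in operator norm (\<open>continuously_differentiable_on_blinfun\<close>), while closure under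
products is immediate.\<close>

definition continuously_differentiable_on ::
  "'a::real_normed_vector set \<Rightarrow> ('a \<Rightarrow> 'b::real_normed_vector) \<Rightarrow> bool" where
  "continuously_differentiable_on S f \<longleftrightarrow>
     (\<exists>D. (\<forall>x\<in>S. (f has_derivative D x) (at x)) \<and> (\<forall>v. continuous_on S (\<lambda>x. D x v)))"

lemma continuously_differentiable_on_bounded_linear:
  "bounded_linear T \<Longrightarrow> continuously_differentiable_on S T"
  unfolding continuously_differentiable_on_def
  by (intro exI[of _ "\<lambda>_. T"]) (auto intro: bounded_linear.has_derivative has_derivative_ident)

lemma continuously_differentiable_on_const: "continuously_differentiable_on S (\<lambda>x. c)"
  unfolding continuously_differentiable_on_def
  by (intro exI[of _ "\<lambda>_ _. 0"]) auto

lemma continuously_differentiable_on_add: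
  assumes "continuously_differentiable_on S f" "continuously_differentiable_on S g"
  shows "continuously_differentiable_on S (\<lambda>x. f x + g x)"
proof -
  obtain D where D: "\<And>x. x \<in> S \<Longrightarrow> (f has_derivative D x) (at x)" "\<And>v. continuous_on S (\<lambda>x. D x v)"
    using assms(1) unfolding continuously_differentiable_on_def by blast
  obtain E where E: "\<And>x. x \<in> S \<Longrightarrow> (g has_derivative E x) (at x)" "\<And>v. continuous_on S (\<lambda>x. E x v)"
    using assms(2) unfolding continuously_differentiable_on_def by blast
  show ?thesis unfolding continuously_differentiable_on_def
    by (intro exI[of _ "\<lambda>x v. D x v + E x v"]) (auto intro!: has_derivative_add continuous_intros D E)
qed

lemma continuously_differentiable_on_bounded_bilinear:
  assumes "bounded_bilinear bil" "continuously_differentiable_on S f" "continuously_differentiable_on S g"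
  shows "continuously_differentiable_on S (\<lambda>x. bil (f x) (g x))"
proof -
  obtain D where D: "\<And>x. x \<in> S \<Longrightarrow> (f has_derivative D x) (at x)" "\<And>v. continuous_on S (\<lambda>x. D x v)"
    using assms(2) unfolding continuously_differentiable_on_def by blast
  obtain E where E: "\<And>x. x \<in> S \<Longrightarrow> (g has_derivative E x) (at x)" "\<And>v. continuous_on S (\<lambda>x. E x v)"
    using assms(3) unfolding continuously_differentiable_on_def by blast
  have cont: "continuous_on S f" "continuous_on S g"
    using D(1) E(1) by (auto intro!: continuous_at_imp_continuous_on dest: has_derivative_continuous)
  show ?thesis unfolding continuously_differentiable_on_def
    by (intro exI[of _ "\<lambda>x v. bil (f x) (E x v) + bil (D x v) (g x)"])
      (auto intro!: bounded_bilinear.FDERIV[OF assms(1)] continuous_intros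
        bounded_bilinear.continuous_on[OF assms(1)] D E cont)
qed

lemmas continuously_differentiable_on_scaleR =
    continuously_differentiable_on_bounded_bilinear[OF bounded_bilinear_scaleR]
  and continuously_differentiable_on_inner =
    continuously_differentiable_on_bounded_bilinear[OF bounded_bilinear_inner]
  and continuously_differentiable_on_mult =
    continuously_differentiable_on_bounded_bilinear[OF bounded_bilinear_mult]

lemma continuously_differentiable_on_diff:
  assumes "continuously_differentiable_on S f" "continuously_differentiable_on S g"
  shows "continuously_differentiable_on S (\<lambda>x. f x - g x)"
  using continuously_differentiable_on_add[OF assms(1) continuously_differentiable_on_scaleR[OF
        continuously_differentiable_on_const[of S "- 1 :: real"] assms(2)]]
  by simp

lemma continuously_differentiable_on_power:
  fixes f :: "'a::real_normed_vector \<Rightarrow> 'b::real_normed_algebra_1"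
  assumes "continuously_differentiable_on S f"
  shows "continuously_differentiable_on S (\<lambda>x. f x ^ n)"
  by (induction n)
    (auto intro!: continuously_differentiable_on_const continuously_differentiable_on_mult assms)

text \<open>The right-hand side is precomposed with the projection onto the ball. The resulting global solution
cannot leave the ball before time \<open>r / M\<close>, and up to then it solves the original equation.\<close>

lemma picard_lindelof_cball:
  fixes F :: "'a::euclidean_space \<Rightarrow> 'a"
  assumes F: "bounded_lipschitz_on (cball z\<^sub>0 r) F"
    and M: "\<And>z. z \<in> cball z\<^sub>0 r \<Longrightarrow> norm (F z) \<le> M" and b: "0 \<le> b" "M * b \<le> r" and r: "0 \<le> r"
  shows "\<exists>z. z 0 = z\<^sub>0 \<and> (\<forall>t\<in>{0..b}. (z has_vector_derivative F (z t)) (at t within {0..b}) \<and>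
    z t \<in> cball z\<^sub>0 r \<and> norm (z t - z\<^sub>0) \<le> M * t)"
proof -
  obtain L where L: "0 < L" "\<And>x y. x \<in> cball z\<^sub>0 r \<Longrightarrow> y \<in> cball z\<^sub>0 r \<Longrightarrow> norm (F x - F y) \<le> L * norm (x - y)"
    using F by (rule bounded_lipschitz_onE) blast
  let ?\<pi> = "closest_point (cball z\<^sub>0 r)"
  have \<pi>: "?\<pi> x \<in> cball z\<^sub>0 r" "norm (?\<pi> x - ?\<pi> y) \<le> norm (x - y)" for x y
    using closest_point_in_set[of "cball z\<^sub>0 r" x] closest_point_lipschitz[of "cball z\<^sub>0 r" x y] r
    by (auto simp: dist_norm)
  have "norm (F (?\<pi> x) - F (?\<pi> y)) \<le> L * norm (x - y)" for x y
    using L(2)[OF \<pi>(1) \<pi>(1), of x y] mult_left_mono[OF \<pi>(2)[of x y], of L] L(1) by linarith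
  from picard_lindelof[OF this L(1) b(1)]
  obtain z where z: "z 0 = z\<^sub>0" "\<And>t. t \<in> {0..b} \<Longrightarrow> (z has_vector_derivative F (?\<pi> (z t))) (at t within {0..b})"
    by blast
  have inc: "norm (z t - z\<^sub>0) \<le> M * t" if t: "t \<in> {0..b}" for t
    using norm_increment_initial_le[OF z(2) M[OF \<pi>(1)] t] z(1) by simp
  have M0: "0 \<le> M" using order_trans[OF norm_ge_zero M[of z\<^sub>0]] r by simp
  have mem: "z t \<in> cball z\<^sub>0 r" if t: "t \<in> {0..b}" for t
  proof -
    have "M * t \<le> M * b" using t M0 by (intro mult_left_mono) auto
    then show ?thesis using inc[OF t] b(2) by (simp add: dist_norm norm_minus_commute)
  qed
  show ?thesis
    using z inc mem by (intro exI[of _ z]) (auto simp: closest_point_self)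
qed

lemma has_derivative_inverse_norm:
  fixes q :: "'a::real_inner"
  assumes "q \<noteq> 0"
  shows "((\<lambda>q. 1 / norm q) has_derivative (\<lambda>v. - ((1 / norm q) ^ 3 * (q \<bullet> v)))) (at q)"
proof -
  have "((\<lambda>q. inverse (norm q)) has_derivative
      (\<lambda>v. - (inverse (norm q) * (v \<bullet> sgn q) * inverse (norm q)))) (at q)"
    using assms by (intro Deriv.has_derivative_inverse has_derivative_norm) auto
  moreover have "- (inverse (norm q) * (v \<bullet> sgn q) * inverse (norm q)) = - ((1 / norm q) ^ 3 * (q \<bullet> v))" for v
    by (simp add: sgn_div_norm field_simps power3_eq_cube inner_commute)
  ultimately show ?thesis by (simp add: inverse_eq_divide)
qed

lemma continuously_differentiable_on_inverse_norm_fst: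
  "continuously_differentiable_on {z :: 'a::real_inner \<times> 'b::real_normed_vector. fst z \<noteq> 0} (\<lambda>z. 1 / norm (fst z))"
  unfolding continuously_differentiable_on_def
proof (intro exI conjI ballI allI)
  fix z :: "'a \<times> 'b" assume "z \<in> {z. fst z \<noteq> 0}"
  then have z: "fst z \<noteq> 0" by simp
  show "((\<lambda>z. 1 / norm (fst z)) has_derivative (\<lambda>v. - ((1 / norm (fst z)) ^ 3 * (fst z \<bullet> fst v)))) (at z)"
    using has_derivative_compose[OF has_derivative_fst[OF has_derivative_ident] has_derivative_inverse_norm[OF z]]
    by simp
next
  fix v :: "'a \<times> 'b"
  show "continuous_on {z. fst z \<noteq> 0} (\<lambda>z::'a \<times> 'b. - ((1 / norm (fst z)) ^ 3 * (fst z \<bullet> fst v)))"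
    by (intro continuous_intros) auto
qed

lemmas continuously_differentiable_on_intros =
  continuously_differentiable_on_const continuously_differentiable_on_add
  continuously_differentiable_on_scaleR continuously_differentiable_on_inner
  continuously_differentiable_on_mult continuously_differentiable_on_power
  continuously_differentiable_on_inverse_norm_fst
  continuously_differentiable_on_bounded_linear[OF bounded_linear_fst]
  continuously_differentiable_on_bounded_linear[OF bounded_linear_snd]

lemma continuously_differentiable_on_blinfun:
  fixes f :: "'a::euclidean_space \<Rightarrow> 'b::real_normed_vector"
  assumes "continuously_differentiable_on S f"
  obtains f' where "\<And>x. x \<in> S \<Longrightarrow> (f has_derivative blinfun_apply (f' x)) (at x)" "continuous_on S f'"
proof -
  obtain D where D: "\<And>x. x \<in> S \<Longrightarrow> (f has_derivative D x) (at x)" "\<And>v. continuous_on S (\<lambda>x. D x v)"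
    using assms unfolding continuously_differentiable_on_def by blast
  have eq: "blinfun_apply (Blinfun (D x)) = D x" if "x \<in> S" for x
    using D(1)[OF that] has_derivative_bounded_linear bounded_linear_Blinfun_apply by blast
  show ?thesis
  proof (rule that)
    show "x \<in> S \<Longrightarrow> (f has_derivative blinfun_apply (Blinfun (D x))) (at x)" for x
      using D(1) eq by simp
    show "continuous_on S (\<lambda>x. Blinfun (D x))"
      using D(2) eq by (intro continuous_on_blinfun_componentwise) (simp cong: continuous_on_cong)
  qed
qed

section \<open>Consistency of the implicit midpoint rule\<close>

text \<open>\<open>kepler_force_d1 q a\<close> is the derivative of the force at \<open>q\<close> in direction \<open>a\<close>, and
\<open>kepler_force_d2 q p\<close> is its second derivative at \<open>q\<close> applied to \<open>(p, p)\<close>.\<close>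

definition kepler_force_d1 :: "real^2 \<Rightarrow> real^2 \<Rightarrow> real^2" where
  "kepler_force_d1 q a = (3 * (1 / norm q) ^ 5 * (q \<bullet> a)) *\<^sub>R q - (1 / norm q) ^ 3 *\<^sub>R a"

definition kepler_force_d2 :: "real^2 \<Rightarrow> real^2 \<Rightarrow> real^2" where
  "kepler_force_d2 q p = (6 * (1 / norm q) ^ 5 * (q \<bullet> p)) *\<^sub>R p
     + (3 * (1 / norm q) ^ 5 * (p \<bullet> p) - 15 * (1 / norm q) ^ 7 * (q \<bullet> p)\<^sup>2) *\<^sub>R q"

text \<open>The \<open>h\<^sup>2\<close> term of the modified equation as a polynomial in \<open>s = 1 / norm q\<close>, \<open>q\<close> and \<open>p\<close>.
The variable \<open>s\<close> is kept separate so that it can be cut off near the collision later.\<close>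

definition midpoint_poly :: "real \<Rightarrow> real^2 \<Rightarrow> real^2 \<Rightarrow> real^2" where
  "midpoint_poly s q p = (1/8 * s ^ 5 * (p \<bullet> p) - 1/3 * s ^ 6 - 5/8 * s ^ 7 * (q \<bullet> p)\<^sup>2) *\<^sub>R q
     + (1/4 * s ^ 5 * (q \<bullet> p)) *\<^sub>R p"

definition midpoint_term :: "real^2 \<Rightarrow> real^2 \<Rightarrow> real^2" where
  "midpoint_term q p = midpoint_poly (1 / norm q) q p"

lemma kepler_force_alt: "kepler_force q = - ((1 / norm q) ^ 3 *\<^sub>R q)"
  by (simp add: kepler_force_def power_divide)

lemma midpoint_term_eq:
  assumes "q \<noteq> 0"
  shows "midpoint_term q p = (1/6) *\<^sub>R kepler_force_d1 q (kepler_force q) + (1/24) *\<^sub>R kepler_force_d2 q p"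
proof -
  define r where "r = norm q"
  have r: "r \<noteq> 0" "q \<bullet> q = r\<^sup>2" using assms by (auto simp: r_def power2_norm_eq_inner)
  show ?thesis
    using r(1)
    unfolding midpoint_term_def midpoint_poly_def kepler_force_d1_def kepler_force_d2_def kepler_force_alt
      r_def[symmetric] inner_minus_right inner_scaleR_right r(2)
    by (simp add: vec_eq_iff field_simps eval_nat_numeral)
qed

lemma has_real_derivative_inverse_norm_curve:
  fixes Y :: "real \<Rightarrow> 'a::real_inner"
  assumes "(Y has_vector_derivative W) (at t within S)" "Y t \<noteq> 0"
  shows "((\<lambda>s. 1 / norm (Y s)) has_real_derivative - ((1 / norm (Y t)) ^ 3 * (Y t \<bullet> W))) (at t within S)"
  using has_derivative_compose[OF assms(1)[unfolded has_vector_derivative_def]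
      has_derivative_at_withinI[OF has_derivative_inverse_norm[OF assms(2)]]]
  unfolding has_field_derivative_def by (rule has_derivative_eq_rhs) (auto simp: fun_eq_iff)

lemma has_real_derivative_inner_curve:
  fixes Y Z :: "real \<Rightarrow> 'a::real_inner"
  assumes "(Y has_vector_derivative Y') (at t within S)" "(Z has_vector_derivative Z') (at t within S)"
  shows "((\<lambda>s. Y s \<bullet> Z s) has_real_derivative Y t \<bullet> Z' + Y' \<bullet> Z t) (at t within S)"
  using bounded_bilinear.has_vector_derivative[OF bounded_bilinear_inner assms]
  by (simp add: has_real_derivative_iff_has_vector_derivative)

lemma has_vector_derivative_kepler_force_curve:
  assumes Y: "(Y has_vector_derivative W) (at t within S)" and "Y t \<noteq> 0"
  shows "((\<lambda>s. kepler_force (Y s)) has_vector_derivative kepler_force_d1 (Y t) W) (at t within S)"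
  unfolding kepler_force_alt kepler_force_d1_def
  by (rule assms has_real_derivative_inverse_norm_curve derivative_eq_intros refl)+
    (simp add: eval_nat_numeral algebra_simps)

lemma has_vector_derivative_kepler_force_d1_curve:
  assumes Y: "(Y has_vector_derivative W t) (at t within S)" and "Y t \<noteq> 0"
    and W: "(W has_vector_derivative A) (at t within S)"
  shows "((\<lambda>s. kepler_force_d1 (Y s) (W s)) has_vector_derivative
    kepler_force_d2 (Y t) (W t) + kepler_force_d1 (Y t) A) (at t within S)"
  unfolding kepler_force_d1_def kepler_force_d2_def
  by (rule assms has_real_derivative_inverse_norm_curve has_real_derivative_inner_curve derivative_eq_intros refl)+
    (simp add: vec_eq_iff eval_nat_numeral algebra_simps add_divide_distrib)

lemma bounded_lipschitz_on_inverse_norm: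
  fixes T :: "'a::real_normed_vector \<Rightarrow> 'b::real_normed_vector"
  assumes T: "bounded_linear T" and c: "0 < c" and low: "\<And>x. x \<in> S \<Longrightarrow> c \<le> norm (T x)"
  shows "bounded_lipschitz_on S (\<lambda>x. 1 / norm (T x))"
proof -
  interpret bounded_linear T by fact
  obtain K where K: "\<And>x. norm (T x) \<le> norm x * K" using bounded by blast
  show ?thesis
  proof (rule bounded_lipschitz_on_inverse[OF _ c low])
  fix x y
  have "\<bar>norm (T x) - norm (T y)\<bar> \<le> norm (T (x - y))" unfolding diff by (rule norm_triangle_ineq3)
  then show "\<bar>norm (T x) - norm (T y)\<bar> \<le> K * norm (x - y)" using K[of "x - y"] by (simp add: mult.commute)
  qed
qed

text \<open>A part of phase space that stays away from collision and from infinity. It may serve as a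
neighbourhood of a compact set of states, and the force and its derivatives are Lipschitz on it.\<close>

definition shell :: "real \<Rightarrow> real \<Rightarrow> ((real^2) \<times> (real^2)) set" where
  "shell c R = {(q, p). c \<le> norm q \<and> norm q \<le> R \<and> norm p \<le> R}"

lemma bounded_shell: "bounded (shell c R)"
proof -
  have "shell c R \<subseteq> cball 0 R \<times> cball 0 R" by (auto simp: shell_def)
  then show ?thesis by (rule bounded_subset[rotated]) (intro bounded_Times bounded_cball)
qed

lemma bounded_lipschitz_on_shell_atoms:
  assumes "0 < c"
  shows "bounded_lipschitz_on (shell c R) fst" "bounded_lipschitz_on (shell c R) snd"
    "bounded_lipschitz_on (shell c R) (\<lambda>z. 1 / norm (fst z))"
  by (intro bounded_lipschitz_on_of_bounded_linear bounded_shell bounded_linear_fst bounded_linear_snd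
      bounded_lipschitz_on_inverse_norm[where c = c] assms; simp add: shell_def split: prod.splits)+

lemma bounded_lipschitz_on_kepler_force:
  "0 < c \<Longrightarrow> bounded_lipschitz_on (shell c R) (\<lambda>z. kepler_force (fst z))"
  unfolding kepler_force_alt
  by (intro bounded_lipschitz_on_intros bounded_lipschitz_on_shell_atoms)

lemma bounded_lipschitz_on_midpoint_poly:
  assumes "bounded_lipschitz_on S s" "bounded_lipschitz_on S q" "bounded_lipschitz_on S p"
  shows "bounded_lipschitz_on S (\<lambda>z. midpoint_poly (s z) (q z) (p z))"
  unfolding midpoint_poly_def by (intro bounded_lipschitz_on_intros assms)

lemma bounded_lipschitz_on_midpoint_term:
  "0 < c \<Longrightarrow> bounded_lipschitz_on (shell c R) (\<lambda>z. midpoint_term (fst z) (snd z))"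
  unfolding midpoint_term_def
  by (intro bounded_lipschitz_on_midpoint_poly bounded_lipschitz_on_shell_atoms)

lemma bounded_lipschitz_on_kepler_force_second_derivative:
  assumes "0 < c"
  shows "bounded_lipschitz_on {(q, p, a). c \<le> norm q \<and> norm q \<le> R \<and> norm p \<le> R \<and> norm a \<le> R'}
    (\<lambda>z. kepler_force_d2 (fst z) (fst (snd z)) + kepler_force_d1 (fst z) (snd (snd z)))"
    (is "bounded_lipschitz_on ?S _")
proof -
  have "?S \<subseteq> cball 0 R \<times> cball 0 R \<times> cball 0 R'" by auto
  then have bd: "bounded ?S" by (rule bounded_subset[rotated]) (intro bounded_Times bounded_cball)
  have q: "bounded_lipschitz_on ?S fst" "bounded_lipschitz_on ?S (\<lambda>z. fst (snd z))" "bounded_lipschitz_on ?S (\<lambda>z. snd (snd z))"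
    by (intro bounded_lipschitz_on_of_bounded_linear bd bounded_linear_fst bounded_linear_fst_comp bounded_linear_snd_comp bounded_linear_snd)+
  have n: "bounded_lipschitz_on ?S (\<lambda>z. 1 / norm (fst z))"
    using assms by (intro bounded_lipschitz_on_inverse_norm[where c = c] bounded_linear_fst) auto
  show ?thesis unfolding kepler_force_d2_def kepler_force_d1_def
    by (intro bounded_lipschitz_on_intros q n)
qed

text \<open>An arc of length \<open>h\<close> of a solution of \<open>Y'' = f(Y) + h\<^sup>2 \<Gamma>\<close> with a bounded Lipschitz forcing
\<open>\<Gamma>\<close>. Forward and time-reversed arcs of a solution of the truncated equation both have this form,
which is why the forcing is a function of time rather than of the state. The condition
\<open>h * R \<le> c\<close> keeps the midpoint of the end points outside the ball of radius \<open>c/2\<close>.\<close>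

definition forced_kepler_arc ::
  "real \<Rightarrow> real \<Rightarrow> real \<Rightarrow> real \<Rightarrow> (real \<Rightarrow> real^2) \<Rightarrow> (real \<Rightarrow> real^2) \<Rightarrow> (real \<Rightarrow> real^2) \<Rightarrow> bool" where
  "forced_kepler_arc c R G h Y W \<Gamma> \<longleftrightarrow> 0 < h \<and> h \<le> 1 \<and> h * R \<le> c \<and> (\<forall>s\<in>{0..h}.
     (Y has_vector_derivative W s) (at s within {0..h}) \<and>
     (W has_vector_derivative kepler_force (Y s) + h\<^sup>2 *\<^sub>R \<Gamma> s) (at s within {0..h}) \<and>
     (Y s, W s) \<in> shell c R \<and> norm (\<Gamma> s) \<le> G \<and> norm (\<Gamma> s - \<Gamma> 0) \<le> G * s)"

text \<open>The errors of the Taylor expansions of the position after a step \<open>h\<close>, with forcing \<open>\<gamma>\<close>, and of the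
force at the midpoint between \<open>q\<close> and \<open>q'\<close>.\<close>

definition position_remainder :: "real \<Rightarrow> real^2 \<Rightarrow> real^2 \<Rightarrow> real^2 \<Rightarrow> real^2 \<Rightarrow> real^2" where
  "position_remainder h q p \<gamma> q' = q' - q - h *\<^sub>R p - (h\<^sup>2/2) *\<^sub>R (kepler_force q + h\<^sup>2 *\<^sub>R \<gamma>)
     - (h^3/6) *\<^sub>R kepler_force_d1 q p
     - (h^4/24) *\<^sub>R (kepler_force_d2 q p + kepler_force_d1 q (kepler_force q))"

definition midpoint_force_remainder :: "real \<Rightarrow> real^2 \<Rightarrow> real^2 \<Rightarrow> real^2 \<Rightarrow> real^2" where
  "midpoint_force_remainder h q p q' = kepler_force ((1/2) *\<^sub>R (q + q')) - kepler_force q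
     - (h/2) *\<^sub>R kepler_force_d1 q p
     - (h\<^sup>2/2) *\<^sub>R ((1/4) *\<^sub>R kepler_force_d2 q p + (1/2) *\<^sub>R kepler_force_d1 q (kepler_force q))"

text \<open>The second derivatives of \<open>f(Y)\<close> and of \<open>f\<close> along the midpoints \<open>(Y 0 + Y s) / 2\<close> are
Lipschitz functions of position, velocity and acceleration, all of which vary by \<open>O(h)\<close> on the arc.
Both forces thus have second order expansions with an error \<open>O(h\<^sup>3)\<close>. Integrating the first one
twice, together with the forcing, gives the fifth order error in the position.\<close>

lemma midpoint_expansion:
  fixes c R G :: real
  assumes c: "0 < c" and R: "0 \<le> R" and G: "0 \<le> G"
  shows "\<exists>C. \<forall>h Y W \<Gamma>. forced_kepler_arc c R G h Y W \<Gamma> \<longrightarrow>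
    norm (position_remainder h (Y 0) (W 0) (\<Gamma> 0) (Y h)) \<le> C * h ^ 5 \<and>
    norm (midpoint_force_remainder h (Y 0) (W 0) (Y h)) \<le> C * h ^ 3"
proof -
  have c2: "0 < c/2" using c by simp
  obtain B where B: "0 < B" "\<And>z. z \<in> shell c R \<Longrightarrow> norm (kepler_force (fst z)) \<le> B"
    "\<And>z z'. z \<in> shell c R \<Longrightarrow> z' \<in> shell c R \<Longrightarrow> norm (kepler_force (fst z) - kepler_force (fst z')) \<le> B * norm (z - z')"
    using bounded_lipschitz_on_kepler_force[OF c, of R] by (rule bounded_lipschitz_onE) blast
  define H where "H q p a = kepler_force_d2 q p + kepler_force_d1 q a" for q p a
  define S where "S = {(q::real^2, p::real^2, a::real^2). c/2 \<le> norm q \<and> norm q \<le> R \<and> norm p \<le> R \<and> norm a \<le> B + G}"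
  obtain B' where B': "0 < B'"
    "\<And>z z'. z \<in> S \<Longrightarrow> z' \<in> S \<Longrightarrow> norm (H (fst z) (fst (snd z)) (snd (snd z)) - H (fst z') (fst (snd z')) (snd (snd z'))) \<le> B' * norm (z - z')"
    using bounded_lipschitz_on_kepler_force_second_derivative[OF c2, of R "B + G"]
    unfolding S_def[symmetric] H_def[symmetric] by (rule bounded_lipschitz_onE) blast
  have H_diff: "norm (H q p a - H q' p' a') \<le> B' * (norm (q - q') + norm (p - p') + norm (a - a'))"
    if "(q, p, a) \<in> S" "(q', p', a') \<in> S" for q p a q' p' a'
  proof -
    have "norm (H q p a - H q' p' a') \<le> B' * norm ((q, p, a) - (q', p', a'))"
      using B'(2)[OF that] by simp
    also have "\<dots> \<le> B' * (norm (q - q') + (norm (p - p') + norm (a - a')))"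
      using B'(1) by (intro mult_left_mono) (auto simp: intro!: order_trans[OF norm_Pair_le] norm_Pair_le)
    finally show ?thesis by (simp add: add.assoc)
  qed
  define E where "E = B' * (R + (B + G) + (B * (R + (B + G)) + G))"
  have E: "0 \<le> E" using B(1) B'(1) R G by (simp add: E_def)
  show ?thesis
  proof (intro exI[of _ "E + G"] allI impI)
    fix h :: real and Y W \<Gamma> :: "real \<Rightarrow> real^2"
    assume arc: "forced_kepler_arc c R G h Y W \<Gamma>"
    define A where "A s = kepler_force (Y s) + h\<^sup>2 *\<^sub>R \<Gamma> s" for s
    have h: "0 < h" "h \<le> 1" "h * R \<le> c"
      using arc by (simp_all add: forced_kepler_arc_def)
    have Y: "(Y has_vector_derivative W s) (at s within {0..h})"
      and W: "(W has_vector_derivative A s) (at s within {0..h})"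
      and sh: "(Y s, W s) \<in> shell c R"
      and \<Gamma>: "norm (\<Gamma> s) \<le> G" and \<Gamma>L: "norm (\<Gamma> s - \<Gamma> 0) \<le> G * s" if "s \<in> {0..h}" for s
      using arc that unfolding forced_kepler_arc_def A_def by blast+
    define f0 where "f0 = kepler_force (Y 0)"
    define d1 where "d1 = kepler_force_d1 (Y 0) (W 0)"
    define K0 where "K0 = H (Y 0) (W 0) f0"
    have z: "0 \<in> {0..h}" and hh: "h \<in> {0..h}" using h by auto
    have h2: "h\<^sup>2 \<le> h" "h\<^sup>2 \<le> 1" using h by (auto simp: power2_eq_square mult_left_le mult_le_one)
    have bnd: "c \<le> norm (Y s)" "norm (Y s) \<le> R" "norm (W s) \<le> R" if "s \<in> {0..h}" for s
      using sh[OF that] by (auto simp: shell_def)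
    have nz: "Y s \<noteq> 0" if "s \<in> {0..h}" for s using bnd(1)[OF that] c by auto
    have fB: "norm (kepler_force (Y s)) \<le> B" if "s \<in> {0..h}" for s using B(2)[OF sh[OF that]] by simp
    have h\<Gamma>: "norm (h\<^sup>2 *\<^sub>R \<Gamma> s) \<le> h * G" "norm (h\<^sup>2 *\<^sub>R \<Gamma> s) \<le> G" if "s \<in> {0..h}" for s
    proof -
      show "norm (h\<^sup>2 *\<^sub>R \<Gamma> s) \<le> h * G" using h2 \<Gamma>[OF that] h by (simp add: mult_mono)
      also have "\<dots> \<le> G" using h G by (simp add: mult_left_le_one_le)
      finally show "norm (h\<^sup>2 *\<^sub>R \<Gamma> s) \<le> G" .
    qed
    have AB: "norm (A s) \<le> B + G" if "s \<in> {0..h}" for s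
      unfolding A_def using fB[OF that] h\<Gamma>(2)[OF that] by (intro norm_triangle_le add_mono)
    have Yd: "norm (Y s - Y 0) \<le> R * h" if s: "s \<in> {0..h}" for s
    proof -
      have "norm (Y s - Y 0) \<le> R * s" by (rule norm_increment_initial_le[OF Y bnd(3) s])
      also have "\<dots> \<le> R * h" using s R by (intro mult_left_mono) auto
      finally show ?thesis .
    qed
    have Wd: "norm (W s - W 0) \<le> (B + G) * h" if s: "s \<in> {0..h}" for s
    proof -
      have "norm (W s - W 0) \<le> (B + G) * s" by (rule norm_increment_initial_le[OF W AB s])
      also have "\<dots> \<le> (B + G) * h" using s B(1) G by (intro mult_left_mono) auto
      finally show ?thesis .
    qed
    have Ad: "norm (A s - f0) \<le> (B * (R + (B + G)) + G) * h" if s: "s \<in> {0..h}" for s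
    proof -
      have "norm (kepler_force (Y s) - f0) \<le> B * norm ((Y s, W s) - (Y 0, W 0))"
        using B(3)[OF sh[OF s] sh[OF z]] by (simp add: f0_def)
      also have "\<dots> \<le> B * (R * h + (B + G) * h)"
        using B(1) Yd[OF s] Wd[OF s] by (intro mult_left_mono) (auto intro!: order_trans[OF norm_Pair_le] add_mono)
      finally have "norm (kepler_force (Y s) - f0) + norm (h\<^sup>2 *\<^sub>R \<Gamma> s) \<le> B * (R * h + (B + G) * h) + h * G"
        using h\<Gamma>(1)[OF s] by simp
      moreover have "norm (A s - f0) \<le> norm (kepler_force (Y s) - f0) + norm (h\<^sup>2 *\<^sub>R \<Gamma> s)"
        unfolding A_def using norm_triangle_ineq[of "kepler_force (Y s) - f0" "h\<^sup>2 *\<^sub>R \<Gamma> s"] by (simp add: algebra_simps)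
      ultimately show ?thesis by (simp add: algebra_simps)
    qed
    have base: "(Y 0, W 0, f0) \<in> S" using bnd[OF z] fB[OF z] c G by (auto simp: S_def f0_def)

    have force: "norm (kepler_force (Y s) - f0 - s *\<^sub>R d1 - (s\<^sup>2/2) *\<^sub>R K0) \<le> (E * h) * h\<^sup>2"
      if s: "s \<in> {0..h}" for s
      unfolding f0_def d1_def
    proof (rule taylor_second_order_bound[OF _ _ _ s])
      fix r assume r: "r \<in> {0..h}"
      show "((\<lambda>s. kepler_force (Y s)) has_vector_derivative kepler_force_d1 (Y r) (W r)) (at r within {0..h})"
        by (rule has_vector_derivative_kepler_force_curve[OF Y[OF r] nz[OF r]])
      show "((\<lambda>s. kepler_force_d1 (Y s) (W s)) has_vector_derivative H (Y r) (W r) (A r)) (at r within {0..h})"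
        unfolding H_def by (rule has_vector_derivative_kepler_force_d1_curve[OF Y[OF r] nz[OF r] W[OF r]])
      have "norm (H (Y r) (W r) (A r) - K0) \<le> B' * (norm (Y r - Y 0) + norm (W r - W 0) + norm (A r - f0))"
        unfolding K0_def by (rule H_diff[OF _ base]) (use bnd[OF r] AB[OF r] c in \<open>auto simp: S_def\<close>)
      also have "\<dots> \<le> B' * (R * h + (B + G) * h + (B * (R + (B + G)) + G) * h)"
        using B'(1) by (intro mult_left_mono add_mono Yd Wd Ad r) auto
      also have "\<dots> = E * h" by (simp add: E_def algebra_simps)
      finally show "norm (H (Y r) (W r) (A r) - K0) \<le> E * h" .
    qed
    let ?P = "\<lambda>s. (s^3/6) *\<^sub>R d1 + (s^4/24) *\<^sub>R K0"
    have "norm ((Y h - ?P h) - (Y 0 - ?P 0) - h *\<^sub>R (W 0 - ((0\<^sup>2/2) *\<^sub>R d1 + (0^3/6) *\<^sub>R K0))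
        - (h\<^sup>2/2) *\<^sub>R (f0 + h\<^sup>2 *\<^sub>R \<Gamma> 0)) \<le> ((E + G) * h^3) * h\<^sup>2"
    proof (rule taylor_second_order_bound[OF _ _ _ hh])
      fix r assume r: "r \<in> {0..h}"
      show "((\<lambda>s. Y s - ?P s) has_vector_derivative W r - ((r\<^sup>2/2) *\<^sub>R d1 + (r^3/6) *\<^sub>R K0)) (at r within {0..h})"
        using Y[OF r] by (auto intro!: derivative_eq_intros)
      show "((\<lambda>s. W s - ((s\<^sup>2/2) *\<^sub>R d1 + (s^3/6) *\<^sub>R K0)) has_vector_derivative A r - (r *\<^sub>R d1 + (r\<^sup>2/2) *\<^sub>R K0)) (at r within {0..h})"
        using W[OF r] by (auto intro!: derivative_eq_intros)
      have "A r - (r *\<^sub>R d1 + (r\<^sup>2/2) *\<^sub>R K0) - (f0 + h\<^sup>2 *\<^sub>R \<Gamma> 0)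
          = (kepler_force (Y r) - f0 - r *\<^sub>R d1 - (r\<^sup>2/2) *\<^sub>R K0) + h\<^sup>2 *\<^sub>R (\<Gamma> r - \<Gamma> 0)"
        unfolding A_def by (simp add: algebra_simps)
      moreover have "norm (h\<^sup>2 *\<^sub>R (\<Gamma> r - \<Gamma> 0)) \<le> h\<^sup>2 * (G * h)"
        using \<Gamma>L[OF r] r G by (auto intro!: mult_left_mono order_trans[OF \<Gamma>L])
      ultimately have "norm (A r - (r *\<^sub>R d1 + (r\<^sup>2/2) *\<^sub>R K0) - (f0 + h\<^sup>2 *\<^sub>R \<Gamma> 0)) \<le> (E * h) * h\<^sup>2 + h\<^sup>2 * (G * h)"
        using force[OF r] by (metis norm_triangle_mono)
      then show "norm (A r - (r *\<^sub>R d1 + (r\<^sup>2/2) *\<^sub>R K0) - (f0 + h\<^sup>2 *\<^sub>R \<Gamma> 0)) \<le> (E + G) * h^3"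
        by (simp add: algebra_simps eval_nat_numeral)
    qed
    then have pos: "norm (Y h - Y 0 - h *\<^sub>R W 0 - (h\<^sup>2/2) *\<^sub>R (f0 + h\<^sup>2 *\<^sub>R \<Gamma> 0) - (h^3/6) *\<^sub>R d1 - (h^4/24) *\<^sub>R K0) \<le> (E + G) * h^5"
      by (simp add: algebra_simps eval_nat_numeral)

    define m where "m s = (1/2) *\<^sub>R (Y 0 + Y s)" for s
    have m0: "m 0 = Y 0" by (simp add: m_def flip: scaleR_2)
    have m: "(m has_vector_derivative (1/2) *\<^sub>R W s) (at s within {0..h})" if "s \<in> {0..h}" for s
      unfolding m_def using Y[OF that] by (auto intro!: derivative_eq_intros)
    have md: "norm (m s - Y 0) \<le> R * h / 2" if "s \<in> {0..h}" for s
    proof -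
      have "m s - Y 0 = (1/2) *\<^sub>R (Y s - Y 0)" by (simp add: m_def vec_eq_iff field_simps)
      then show ?thesis using Yd[OF that] by simp
    qed
    have ml: "c/2 \<le> norm (m s)" if "s \<in> {0..h}" for s
      using md[OF that] bnd(1)[OF z] h(3) norm_triangle_ineq2[of "Y 0" "Y 0 - m s"]
      by (simp add: norm_minus_commute mult.commute)
    have mu: "norm (m s) \<le> R" if "s \<in> {0..h}" for s
      unfolding m_def using bnd(2)[OF that] bnd(2)[OF z] norm_triangle_ineq[of "Y 0" "Y s"] by simp
    define K1 where "K1 = H (Y 0) ((1/2) *\<^sub>R W 0) ((1/2) *\<^sub>R f0)"
    have "norm (kepler_force (m h) - kepler_force (m 0) - h *\<^sub>R kepler_force_d1 (m 0) ((1/2) *\<^sub>R W 0) - (h\<^sup>2/2) *\<^sub>R K1) \<le> (E * h) * h\<^sup>2"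
    proof (rule taylor_second_order_bound[OF _ _ _ hh])
      fix r assume r: "r \<in> {0..h}"
      have nzm: "m r \<noteq> 0" using ml[OF r] c by auto
      show "((\<lambda>s. kepler_force (m s)) has_vector_derivative kepler_force_d1 (m r) ((1/2) *\<^sub>R W r)) (at r within {0..h})"
        by (rule has_vector_derivative_kepler_force_curve[OF m[OF r] nzm])
      show "((\<lambda>s. kepler_force_d1 (m s) ((1/2) *\<^sub>R W s)) has_vector_derivative H (m r) ((1/2) *\<^sub>R W r) ((1/2) *\<^sub>R A r)) (at r within {0..h})"
        unfolding H_def
        by (rule has_vector_derivative_kepler_force_d1_curve[where W = "\<lambda>s. (1/2) *\<^sub>R W s", OF m[OF r] nzm])
          (use W[OF r] in \<open>auto intro!: derivative_eq_intros\<close>)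
      have "norm (H (m r) ((1/2) *\<^sub>R W r) ((1/2) *\<^sub>R A r) - K1)
          \<le> B' * (norm (m r - Y 0) + norm ((1/2) *\<^sub>R W r - (1/2) *\<^sub>R W 0) + norm ((1/2) *\<^sub>R A r - (1/2) *\<^sub>R f0))"
        unfolding K1_def
        by (rule H_diff)
          (use bnd[OF r] AB[OF r] c ml[OF r] mu[OF r] bnd[OF z] fB[OF z] G R B(1) in \<open>auto simp: S_def f0_def\<close>)
      also have "\<dots> \<le> B' * (R * h + (B + G) * h + (B * (R + (B + G)) + G) * h)"
      proof (intro mult_left_mono add_mono)
        show "norm (m r - Y 0) \<le> R * h" using md[OF r] R h(1) by (smt (verit) field_sum_of_halves mult_nonneg_nonneg)
        show "norm ((1/2) *\<^sub>R W r - (1/2) *\<^sub>R W 0) \<le> (B + G) * h"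
          using Wd[OF r] norm_ge_zero[of "W r - W 0"]
          unfolding scaleR_diff_right[symmetric] norm_scaleR by linarith
        show "norm ((1/2) *\<^sub>R A r - (1/2) *\<^sub>R f0) \<le> (B * (R + (B + G)) + G) * h"
          using Ad[OF r] norm_ge_zero[of "A r - f0"]
          unfolding scaleR_diff_right[symmetric] norm_scaleR by linarith
      qed (use B'(1) in auto)
      also have "\<dots> = E * h" by (simp add: E_def algebra_simps)
      finally show "norm (H (m r) ((1/2) *\<^sub>R W r) ((1/2) *\<^sub>R A r) - K1) \<le> E * h" .
    qed
    also have "(E * h) * h\<^sup>2 \<le> (E + G) * h ^ 3"
      using G h by (simp add: eval_nat_numeral algebra_simps)
    also have "kepler_force_d1 (m 0) ((1/2) *\<^sub>R W 0) = (1/2) *\<^sub>R d1"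
      unfolding m0 d1_def kepler_force_d1_def by (simp add: algebra_simps)
    also have "K1 = (1/4) *\<^sub>R kepler_force_d2 (Y 0) (W 0) + (1/2) *\<^sub>R kepler_force_d1 (Y 0) f0"
      unfolding K1_def H_def kepler_force_d2_def kepler_force_d1_def by (simp add: algebra_simps power2_eq_square)
    finally have mid: "norm (kepler_force ((1/2) *\<^sub>R (Y 0 + Y h)) - f0 - (h/2) *\<^sub>R d1
      - (h\<^sup>2/2) *\<^sub>R ((1/4) *\<^sub>R kepler_force_d2 (Y 0) (W 0) + (1/2) *\<^sub>R kepler_force_d1 (Y 0) f0)) \<le> (E + G) * h ^ 3"
      unfolding m0 f0_def by (simp add: m_def)
    show "norm (position_remainder h (Y 0) (W 0) (\<Gamma> 0) (Y h)) \<le> (E + G) * h ^ 5 \<and>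
      norm (midpoint_force_remainder h (Y 0) (W 0) (Y h)) \<le> (E + G) * h ^ 3"
      using pos mid unfolding position_remainder_def midpoint_force_remainder_def f0_def d1_def K0_def H_def by blast
  qed
qed

lemma solves_truncated_iff:
  "solves (truncated_rhs g h) S y w \<longleftrightarrow>
    (\<forall>t\<in>S. y t \<noteq> 0 \<and> (y has_vector_derivative w t) (at t within S) \<and>
       (w has_vector_derivative kepler_force (y t) + h\<^sup>2 *\<^sub>R g (y t) (w t)) (at t within S))"
  unfolding solves_within_def truncated_rhs_def by auto

lemma compact_subset_shell:
  assumes "compact Q" "Q \<subseteq> {z :: (real^2) \<times> (real^2). fst z \<noteq> 0}"
  obtains c R where "0 < c" "0 \<le> R" "Q \<subseteq> shell c R"
proof -
  have "compact ((\<lambda>z. 1 / norm (fst z)) ` Q)"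
    using assms by (intro compact_continuous_image continuous_intros) auto
  from compact_imp_bounded[OF this]
  obtain B where B: "0 < B" "\<forall>r\<in>(\<lambda>z. 1 / norm (fst z)) ` Q. norm r \<le> B"
    unfolding bounded_pos by blast
  obtain R where R: "0 < R" "\<And>z. z \<in> Q \<Longrightarrow> norm z \<le> R"
    using compact_imp_bounded[OF assms(1)] by (auto simp: bounded_pos)
  show ?thesis
  proof (rule that[of "1 / B" R])
    show "Q \<subseteq> shell (1 / B) R"
    proof
      fix z assume z: "z \<in> Q"
      then have "norm (fst z) > 0" using assms(2) by auto
      then have "1 / B \<le> norm (fst z)" using B(1) B(2)[rule_format, OF imageI[OF z]] by (simp add: field_simps)
      moreover have "norm (fst z) \<le> R" "norm (snd z) \<le> R"
        using R(2)[OF z] norm_fst_le[of "fst z" "snd z"] norm_snd_le[of "snd z" "fst z"] by auto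
      ultimately show "z \<in> shell (1 / B) R" by (auto simp: shell_def)
    qed
  qed (use B R in auto)
qed

text \<open>The forward and the backward arc from time \<open>t\<close> have opposite velocities. In the symmetric
difference and in the average of the two midpoint forces the odd powers of \<open>h\<close> cancel, and at
order \<open>h\<^sup>2\<close> there remains \<open>g + (f'' + f' f) / 12 - f'' / 8 - f' f / 4\<close>, which is \<open>g\<close> minus the midpoint term.\<close>

theorem midpoint_consistency:
  fixes g :: "real^2 \<Rightarrow> real^2 \<Rightarrow> real^2"
  assumes g': "\<And>z. fst z \<noteq> 0 \<Longrightarrow> ((\<lambda>(q, p). g q p) has_derivative blinfun_apply (g' z)) (at z)"
    and g'_cont: "continuous_on {z. fst z \<noteq> 0} g'"
    and Q: "compact Q" "Q \<subseteq> {z. fst z \<noteq> 0}"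
  shows "\<exists>C. \<forall>\<^sub>F h in at_right 0. \<forall>y w t.
     solves (truncated_rhs g h) {t - h..t + h} y w \<and> (\<forall>s\<in>{t - h..t + h}. (y s, w s) \<in> Q) \<longrightarrow>
       norm (midpoint_residual h y t - h\<^sup>2 *\<^sub>R (g (y t) (w t) - midpoint_term (y t) (w t))) \<le> C * h ^ 3"
proof -
  obtain c R where c: "0 < c" and R: "0 \<le> R" and QS: "Q \<subseteq> shell c R"
    using compact_subset_shell[OF Q] .
  have "continuous_on Q (\<lambda>(q, p). g q p)"
    using g' Q(2) by (intro continuous_at_imp_continuous_on) (blast dest: has_derivative_continuous)
  from compact_imp_bounded[OF compact_continuous_image[OF this Q(1)]]
  obtain G0 where G0: "0 < G0" "\<forall>z\<in>Q. norm ((\<lambda>(q, p). g q p) z) \<le> G0"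
    unfolding bounded_pos by blast
  from compact_imp_bounded[OF compact_continuous_image[OF continuous_on_subset[OF g'_cont Q(2)] Q(1)]]
  obtain G1 where G1: "0 < G1" "\<And>z. z \<in> Q \<Longrightarrow> norm (g' z) \<le> G1"
    unfolding bounded_pos by blast
  obtain B where B: "0 < B" "\<And>z. z \<in> shell c R \<Longrightarrow> norm (kepler_force (fst z)) \<le> B"
    using bounded_lipschitz_on_kepler_force[OF c, of R] by (rule bounded_lipschitz_onE) blast
  define G where "G = max G0 (G1 * (R + (B + G0)))"
  have G: "0 \<le> G" using G0 by (simp add: G_def)
  obtain C where C: "\<And>h Y W \<Gamma>. forced_kepler_arc c R G h Y W \<Gamma> \<Longrightarrow>
    norm (position_remainder h (Y 0) (W 0) (\<Gamma> 0) (Y h)) \<le> C * h ^ 5 \<and>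
    norm (midpoint_force_remainder h (Y 0) (W 0) (Y h)) \<le> C * h ^ 3"
    using midpoint_expansion[OF c R G] by blast
  have "norm (midpoint_residual h y t - h\<^sup>2 *\<^sub>R (g (y t) (w t) - midpoint_term (y t) (w t))) \<le> (3 * C) * h ^ 3"
    if h: "0 < h" "h \<le> 1" "h * R \<le> c"
      and sol: "solves (truncated_rhs g h) {t - h..t + h} y w"
      and inQ: "\<forall>s\<in>{t - h..t + h}. (y s, w s) \<in> Q" for h y w t
  proof -
    define f where "f = kepler_force (y t)"
    define d1 where "d1 = kepler_force_d1 (y t) (w t)"
    define e1 where "e1 = kepler_force_d1 (y t) f"
    define d2 where "d2 = kepler_force_d2 (y t) (w t)"
    define \<gamma> where "\<gamma> = g (y t) (w t)"
    have half: "norm (position_remainder h (y t) (\<sigma> *\<^sub>R w t) \<gamma> (y (t + \<sigma> * h))) \<le> C * h ^ 5 \<and>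
      norm (midpoint_force_remainder h (y t) (\<sigma> *\<^sub>R w t) (y (t + \<sigma> * h))) \<le> C * h ^ 3"
      if \<sigma>: "\<sigma> = 1 \<or> \<sigma> = -1" for \<sigma> :: real
    proof -
      have ran: "t + \<sigma> * s \<in> {t - h..t + h}" if "s \<in> {0..h}" for s using \<sigma> that h by auto
      have \<sigma>2: "\<sigma> * \<sigma> = 1" using \<sigma> by auto
      have shift: "((\<lambda>s. u (t + \<sigma> * s)) has_vector_derivative \<sigma> *\<^sub>R u') (at s within {0..h})"
        if "(u has_vector_derivative u') (at (t + \<sigma> * s) within {t - h..t + h})"
        for u :: "real \<Rightarrow> real^2" and u' s
      proof -
        have "((\<lambda>s. t + \<sigma> * s) has_vector_derivative \<sigma>) (at s within {0..h})"
          by (auto intro!: derivative_eq_intros simp flip: has_real_derivative_iff_has_vector_derivative)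
        moreover have "(u has_vector_derivative u') (at (t + \<sigma> * s) within (\<lambda>s. t + \<sigma> * s) ` {0..h})"
          using ran by (intro has_vector_derivative_within_subset[OF that]) auto
        ultimately show ?thesis by (rule vector_diff_chain_within[unfolded o_def])
      qed
      define \<Gamma> where "\<Gamma> s = g (y (t + \<sigma> * s)) (w (t + \<sigma> * s))" for s
      define A where "A s = kepler_force (y (t + \<sigma> * s)) + h\<^sup>2 *\<^sub>R \<Gamma> s" for s
      have dy: "((\<lambda>s. y (t + \<sigma> * s)) has_vector_derivative \<sigma> *\<^sub>R w (t + \<sigma> * s)) (at s within {0..h})"
        if s: "s \<in> {0..h}" for s
        using sol ran[OF s] by (intro shift) (auto simp: solves_truncated_iff)
      have dw: "((\<lambda>s. w (t + \<sigma> * s)) has_vector_derivative \<sigma> *\<^sub>R A s) (at s within {0..h})"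
        if s: "s \<in> {0..h}" for s
        using sol ran[OF s] by (intro shift) (auto simp: solves_truncated_iff A_def \<Gamma>_def)
      have inS: "(y (t + \<sigma> * s), w (t + \<sigma> * s)) \<in> shell c R" if s: "s \<in> {0..h}" for s
        using inQ ran[OF s] QS by auto
      have \<Gamma>0: "norm (\<Gamma> s) \<le> G0" if s: "s \<in> {0..h}" for s
        using G0(2) inQ ran[OF s] unfolding \<Gamma>_def by fastforce
      have AB: "norm (A s) \<le> B + G0" if s: "s \<in> {0..h}" for s
      proof -
        have "norm (h\<^sup>2 *\<^sub>R \<Gamma> s) \<le> 1 * G0"
          unfolding norm_scaleR using h \<Gamma>0[OF s] by (intro mult_mono) (auto simp: power_le_one)
        then show ?thesis unfolding A_def using B(2)[OF inS[OF s]] by (intro norm_triangle_le add_mono) auto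
      qed
      have \<Gamma>L: "norm (\<Gamma> s - \<Gamma> 0) \<le> (G1 * (R + (B + G0))) * s" if s: "s \<in> {0..h}" for s
      proof (rule norm_increment_initial_le[OF _ _ s])
        fix r assume r: "r \<in> {0..h}"
        let ?z = "(y (t + \<sigma> * r), w (t + \<sigma> * r))" and ?z' = "(\<sigma> *\<^sub>R w (t + \<sigma> * r), \<sigma> *\<^sub>R A r)"
        have zQ: "?z \<in> Q" using inQ ran[OF r] by auto
        have dz: "((\<lambda>s. (y (t + \<sigma> * s), w (t + \<sigma> * s))) has_vector_derivative ?z') (at r within {0..h})"
          by (intro has_vector_derivative_Pair dy dw r)
        have dg: "((\<lambda>(q, p). g q p) has_derivative blinfun_apply (g' ?z)) (at ?z)"
          using zQ Q(2) by (intro g') auto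
        have "\<Gamma> = (\<lambda>s. (\<lambda>(q, p). g q p) (y (t + \<sigma> * s), w (t + \<sigma> * s)))"
          by (simp add: \<Gamma>_def fun_eq_iff)
        then show "(\<Gamma> has_vector_derivative blinfun_apply (g' ?z) ?z') (at r within {0..h})"
          using has_derivative_compose[OF dz[unfolded has_vector_derivative_def] dg]
          unfolding has_vector_derivative_def blinfun.scaleR_right by simp
        have "norm ?z' \<le> R + (B + G0)"
          using \<sigma> inS[OF r] AB[OF r]
          by (intro order_trans[OF norm_Pair_le] add_mono) (auto simp: shell_def)
        then show "norm (blinfun_apply (g' ?z) ?z') \<le> G1 * (R + (B + G0))"
          using G1(2)[OF zQ] G1(1) by (intro order_trans[OF norm_blinfun] mult_mono) auto
      qed
      have "forced_kepler_arc c R G h (\<lambda>s. y (t + \<sigma> * s)) (\<lambda>s. \<sigma> *\<^sub>R w (t + \<sigma> * s)) \<Gamma>"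
        unfolding forced_kepler_arc_def
      proof (intro conjI ballI h)
        fix s assume s: "s \<in> {0..h}"
        show "((\<lambda>s. y (t + \<sigma> * s)) has_vector_derivative \<sigma> *\<^sub>R w (t + \<sigma> * s)) (at s within {0..h})" by (rule dy[OF s])
        show "((\<lambda>s. \<sigma> *\<^sub>R w (t + \<sigma> * s)) has_vector_derivative
            kepler_force (y (t + \<sigma> * s)) + h\<^sup>2 *\<^sub>R \<Gamma> s) (at s within {0..h})"
          using bounded_linear.has_vector_derivative[OF bounded_linear_scaleR_right[of \<sigma>] dw[OF s]]
          unfolding scaleR_scaleR \<sigma>2 A_def by simp
        show "(y (t + \<sigma> * s), \<sigma> *\<^sub>R w (t + \<sigma> * s)) \<in> shell c R"
          using inS[OF s] \<sigma> by (auto simp: shell_def)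
        show "norm (\<Gamma> s) \<le> G" using \<Gamma>0[OF s] by (simp add: G_def)
        show "norm (\<Gamma> s - \<Gamma> 0) \<le> G * s"
          by (rule order_trans[OF \<Gamma>L[OF s]]) (use s in \<open>auto simp: G_def intro!: mult_right_mono\<close>)
      qed
      from C[OF this] show ?thesis by (simp add: \<Gamma>_def \<gamma>_def)
    qed
    define yp where "yp = position_remainder h (y t) (w t) \<gamma> (y (t + h))"
    define ym where "ym = position_remainder h (y t) (- w t) \<gamma> (y (t - h))"
    define mp where "mp = midpoint_force_remainder h (y t) (w t) (y (t + h))"
    define mm where "mm = midpoint_force_remainder h (y t) (- w t) (y (t - h))"
    have bounds: "norm yp \<le> C * h^5" "norm ym \<le> C * h^5" "norm mp \<le> C * h^3" "norm mm \<le> C * h^3"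
      using half[of 1] half[of "-1"] by (simp_all add: yp_def ym_def mp_def mm_def)
    have neg: "kepler_force_d1 (y t) (- w t) = - d1" "kepler_force_d2 (y t) (- w t) = d2"
      by (simp_all add: d1_def d2_def kepler_force_d1_def kepler_force_d2_def)
    have "t \<in> {t - h..t + h}" using h by auto
    then have "y t \<noteq> 0" using sol by (auto simp: solves_truncated_iff)
    note g0 = midpoint_term_eq[OF this, of "w t", folded f_def, folded e1_def d2_def]
    have eq: "midpoint_residual h y t - h\<^sup>2 *\<^sub>R (\<gamma> - midpoint_term (y t) (w t))
        = (1 / h\<^sup>2) *\<^sub>R (yp + ym) - (1/2) *\<^sub>R (mp + mm)"
      unfolding midpoint_residual_def g0 yp_def ym_def mp_def mm_def position_remainder_def
        midpoint_force_remainder_def neg f_def[symmetric] d1_def[symmetric] d2_def[symmetric]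
        e1_def[symmetric] add.commute[of "y (t - h)" "y t"]
      using h(1) by (simp add: vec_eq_iff field_simps eval_nat_numeral)
    have "norm ((1 / h\<^sup>2) *\<^sub>R (yp + ym)) = (1 / h\<^sup>2) * norm (yp + ym)" by simp
    also have "\<dots> \<le> (1 / h\<^sup>2) * (C * h^5 + C * h^5)"
      using bounds by (intro mult_left_mono norm_triangle_le add_mono) auto
    also have "\<dots> = 2 * C * h^3" using h(1) by (simp add: field_simps eval_nat_numeral)
    finally have 1: "norm ((1 / h\<^sup>2) *\<^sub>R (yp + ym)) \<le> 2 * C * h^3" .
    have "norm ((1/2) *\<^sub>R (mp + mm)) \<le> C * h^3"
      using bounds(3,4) norm_triangle_ineq[of mp mm] by simp
    with 1 have "norm ((1 / h\<^sup>2) *\<^sub>R (yp + ym) - (1/2) *\<^sub>R (mp + mm)) \<le> 2 * C * h^3 + C * h^3"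
      using norm_triangle_ineq4[of "(1 / h\<^sup>2) *\<^sub>R (yp + ym)" "(1/2) *\<^sub>R (mp + mm)"] by linarith
    then show ?thesis unfolding eq[unfolded \<gamma>_def] by simp
  qed
  moreover have "\<forall>\<^sub>F h in at_right 0. 0 < h \<and> h \<le> 1 \<and> h * R \<le> c"
  proof -
    have "h * R \<le> c" if "0 < h" "h < c / (R + 1)" for h
    proof -
      have "h * R \<le> h * (R + 1)" using that by simp
      also have "\<dots> \<le> c" using that R by (simp add: field_simps)
      finally show ?thesis .
    qed
    then show ?thesis
      unfolding eventually_at_right_field using c R
      by (intro exI[of _ "min 1 (c / (R + 1))"]) auto
  qed
  ultimately show ?thesis
    by (intro exI[of _ "3 * C"]) (auto elim!: eventually_mono)
qed

section \<open>The modified equation of the implicit midpoint rule\<close>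

lemma bounded_lipschitz_on_cball_C1:
  fixes f :: "'a::euclidean_space \<Rightarrow> 'b::real_normed_vector"
  assumes f': "\<And>x. x \<in> cball a r \<Longrightarrow> (f has_derivative blinfun_apply (f' x)) (at x)"
    and cont: "continuous_on (cball a r) f'"
  shows "bounded_lipschitz_on (cball a r) f"
proof -
  have "continuous_on (cball a r) f"
    using f' by (intro continuous_at_imp_continuous_on) (blast dest: has_derivative_continuous)
  from compact_imp_bounded[OF compact_continuous_image[OF this compact_cball]]
  obtain B where B: "\<forall>x\<in>cball a r. norm (f x) \<le> B" unfolding bounded_pos by blast
  from compact_imp_bounded[OF compact_continuous_image[OF cont compact_cball]]
  obtain L where L: "\<forall>x\<in>cball a r. norm (f' x) \<le> L" unfolding bounded_pos by blast
  show ?thesis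
  proof (rule bounded_lipschitz_onI[of _ _ B L])
    fix x y assume "x \<in> cball a r" "y \<in> cball a r"
    then show "norm (f x - f y) \<le> L * norm (x - y)"
      using f' L
      by (intro differentiable_bound[of "cball a r" f "\<lambda>x. blinfun_apply (f' x)"])
        (auto intro: has_derivative_at_withinI simp: norm_blinfun.rep_eq[symmetric])
  qed (use B in auto)
qed

lemma midpoint_modified_term_midpoint_term: "midpoint_modified_term midpoint_term"
proof -
  let ?U = "{z :: (real^2) \<times> (real^2). fst z \<noteq> 0}"
  have "continuously_differentiable_on ?U (\<lambda>z. midpoint_term (fst z) (snd z))"
    unfolding midpoint_term_def midpoint_poly_def
    by (intro continuously_differentiable_on_intros continuously_differentiable_on_diff)
  then obtain g' where "\<And>z. z \<in> ?U \<Longrightarrow> ((\<lambda>z. midpoint_term (fst z) (snd z)) has_derivative blinfun_apply (g' z)) (at z)"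
    and cont: "continuous_on ?U g'"
    by (rule continuously_differentiable_on_blinfun) blast
  then have g': "\<And>z. fst z \<noteq> 0 \<Longrightarrow> ((\<lambda>(q, p). midpoint_term q p) has_derivative blinfun_apply (g' z)) (at z)"
    by (simp add: case_prod_unfold)
  show ?thesis
    unfolding midpoint_modified_term_def
  proof (intro conjI exI[of _ g'] allI impI)
    fix Q :: "((real^2) \<times> (real^2)) set" assume "compact Q \<and> Q \<subseteq> ?U"
    then have Q: "compact Q" "Q \<subseteq> ?U" by auto
    show "\<exists>C. \<forall>\<^sub>F h in at_right 0. \<forall>y w t. solves (truncated_rhs midpoint_term h) {t - h..t + h} y w \<and>
        (\<forall>s\<in>{t - h..t + h}. (y s, w s) \<in> Q) \<longrightarrow> norm (midpoint_residual h y t) \<le> C * h ^ 3"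
      using midpoint_consistency[OF g' cont Q] by simp
  qed (use g' cont in auto)
qed

text \<open>Two \<open>O(h\<^sup>3)\<close> bounds for the residual, one from the definition of a modified term and one from
\<open>midpoint_consistency\<close>, show that \<open>g\<close> differs from the midpoint term by \<open>O(h)\<close> at the midpoint
in time of a solution that starts at \<open>(q, p)\<close>. This point tends to \<open>(q, p)\<close> as \<open>h \<rightarrow> 0\<close>.\<close>

lemma midpoint_modified_term_unique:
  assumes g: "midpoint_modified_term g" and q: "q \<noteq> 0"
  shows "g q p = midpoint_term q p"
proof -
  obtain g' where g': "\<And>z. fst z \<noteq> 0 \<Longrightarrow> ((\<lambda>(q, p). g q p) has_derivative blinfun_apply (g' z)) (at z)"
    and g'_cont: "continuous_on {z. fst z \<noteq> 0} g'"
    using g unfolding midpoint_modified_term_def by blast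
  define r where "r = norm q / 2"
  have r: "0 < r" using q by (simp add: r_def)
  define Q where "Q = cball (q, p) r"
  have QS: "Q \<subseteq> shell r (norm q + norm p + r)"
  proof
    fix z assume "z \<in> Q"
    then have "norm ((q, p) - z) \<le> r" by (simp add: Q_def dist_norm)
    then have d: "norm (q - fst z) \<le> r" "norm (p - snd z) \<le> r"
      using norm_fst_le[of "q - fst z" "p - snd z"] norm_snd_le[of "p - snd z" "q - fst z"]
      by (cases z; auto)+
    have "norm q - norm (fst z) \<le> r" "norm (fst z) \<le> norm q + r" "norm (snd z) \<le> norm p + r"
      using norm_triangle_ineq2[of q "fst z"] norm_triangle_ineq2[of "fst z" q]
        norm_triangle_ineq2[of "snd z" p] d by (auto simp: norm_minus_commute)
    then show "z \<in> shell r (norm q + norm p + r)" using r norm_ge_zero[of p] norm_ge_zero[of q] unfolding shell_def r_def case_prod_unfold mem_Collect_eq by linarith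
  qed
  then have Q: "compact Q" "Q \<subseteq> {z. fst z \<noteq> 0}" "(q, p) \<in> Q"
    using r by (auto simp: Q_def shell_def)
  have "bounded_lipschitz_on Q (\<lambda>(q, p). g q p)"
    unfolding Q_def using Q(2)
    by (intro bounded_lipschitz_on_cball_C1[of _ _ _ g'] g' continuous_on_subset[OF g'_cont]) (auto simp: Q_def)
  then have gL: "bounded_lipschitz_on Q (\<lambda>z. g (fst z) (snd z))" by (simp add: case_prod_unfold)
  have mL: "bounded_lipschitz_on Q (\<lambda>z. midpoint_term (fst z) (snd z))"
    and fL: "bounded_lipschitz_on Q (\<lambda>z. kepler_force (fst z))"
    and sL: "bounded_lipschitz_on Q snd"
    using bounded_lipschitz_on_midpoint_term bounded_lipschitz_on_kepler_force bounded_lipschitz_on_shell_atoms(2)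
      bounded_lipschitz_on_subset[OF _ QS] r by blast+
  obtain Bg where Bg: "\<And>z. z \<in> Q \<Longrightarrow> norm (g (fst z) (snd z)) \<le> Bg"
    using gL by (rule bounded_lipschitz_onE) blast
  obtain Bf where Bf: "\<And>z. z \<in> Q \<Longrightarrow> norm (kepler_force (fst z)) \<le> Bf"
    using fL by (rule bounded_lipschitz_onE) blast
  obtain Bs where Bs: "0 < Bs" "\<And>z. z \<in> Q \<Longrightarrow> norm (snd z) \<le> Bs"
    using sL by (rule bounded_lipschitz_onE) blast
  obtain L where L: "0 < L" "\<And>z z'. z \<in> Q \<Longrightarrow> z' \<in> Q \<Longrightarrow>
      norm ((g (fst z) (snd z) - midpoint_term (fst z) (snd z)) - (g (fst z') (snd z') - midpoint_term (fst z') (snd z'))) \<le> L * norm (z - z')"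
    using bounded_lipschitz_on_diff[OF gL mL] by (rule bounded_lipschitz_onE) blast
  define M where "M = Bs + (Bf + Bg)"
  have "0 \<le> Bf" "0 \<le> Bg" using Bf[OF Q(3)] Bg[OF Q(3)] norm_ge_zero order_trans by blast+
  then have M: "0 < M" using Bs(1) by (simp add: M_def)
  obtain C where C: "\<forall>\<^sub>F h in at_right 0. \<forall>y w t.
     solves (truncated_rhs g h) {t - h..t + h} y w \<and> (\<forall>s\<in>{t - h..t + h}. (y s, w s) \<in> Q) \<longrightarrow>
       norm (midpoint_residual h y t - h\<^sup>2 *\<^sub>R (g (y t) (w t) - midpoint_term (y t) (w t))) \<le> C * h ^ 3"
    using midpoint_consistency[OF g' g'_cont Q(1,2)] by blast
  obtain C' where C': "\<forall>\<^sub>F h in at_right 0. \<forall>y w t.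
     solves (truncated_rhs g h) {t - h..t + h} y w \<and> (\<forall>s\<in>{t - h..t + h}. (y s, w s) \<in> Q) \<longrightarrow>
       norm (midpoint_residual h y t) \<le> C' * h ^ 3"
    using g Q(1,2) unfolding midpoint_modified_term_def by blast
  have small: "\<forall>\<^sub>F h in at_right 0. 0 < h \<and> h \<le> 1 \<and> M * (2 * h) \<le> r"
    unfolding eventually_at_right_field using r M
    by (intro exI[of _ "min 1 (r / (2 * M))"]) (auto simp: field_simps)
  have "\<forall>\<^sub>F h in at_right 0. norm (g q p - midpoint_term q p) \<le> (C + C' + L * M) * h"
    using C C' small
  proof eventually_elim
    fix h
    assume C: "\<forall>y w t. solves (truncated_rhs g h) {t - h..t + h} y w \<and> (\<forall>s\<in>{t - h..t + h}. (y s, w s) \<in> Q) \<longrightarrow>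
       norm (midpoint_residual h y t - h\<^sup>2 *\<^sub>R (g (y t) (w t) - midpoint_term (y t) (w t))) \<le> C * h ^ 3"
      and C': "\<forall>y w t. solves (truncated_rhs g h) {t - h..t + h} y w \<and> (\<forall>s\<in>{t - h..t + h}. (y s, w s) \<in> Q) \<longrightarrow>
       norm (midpoint_residual h y t) \<le> C' * h ^ 3"
      and "0 < h \<and> h \<le> 1 \<and> M * (2 * h) \<le> r"
    then have h: "0 < h" "h \<le> 1" "M * (2 * h) \<le> r" by auto
    define F where "F z = (snd z, kepler_force (fst z) + h\<^sup>2 *\<^sub>R g (fst z) (snd z))" for z
    have FL: "bounded_lipschitz_on Q F"
      unfolding F_def by (intro bounded_lipschitz_on_intros sL fL gL)
    have FM: "norm (F z) \<le> M" if z: "z \<in> Q" for z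
    proof -
      have "norm (h\<^sup>2 *\<^sub>R g (fst z) (snd z)) \<le> 1 * Bg"
        unfolding norm_scaleR using h Bg[OF z] by (intro mult_mono) (auto simp: power_le_one)
      then show ?thesis
        unfolding F_def M_def using Bs(2)[OF z] Bf[OF z]
        by (intro order_trans[OF norm_Pair_le] add_mono norm_triangle_le) auto
    qed
    obtain z where z: "z 0 = (q, p)" "\<And>t. t \<in> {0..2 * h} \<Longrightarrow> (z has_vector_derivative F (z t)) (at t within {0..2 * h}) \<and>
        z t \<in> Q \<and> norm (z t - (q, p)) \<le> M * t"
      using picard_lindelof_cball[OF FL[unfolded Q_def] FM[unfolded Q_def], of "2 * h"] h r Q_def by fastforce
    let ?y = "\<lambda>t. fst (z t)" and ?w = "\<lambda>t. snd (z t)"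
    \<comment> \<open>The residual is taken at time \<open>h\<close>, so the solution is needed forward in time only.\<close>
    have I: "{h - h..h + h} = {0..2 * h}" by auto
    have "solves (truncated_rhs g h) {h - h..h + h} ?y ?w \<and> (\<forall>s\<in>{h - h..h + h}. (?y s, ?w s) \<in> Q)"
      unfolding solves_truncated_iff I
    proof (intro conjI ballI)
      fix t assume t: "t \<in> {0..2 * h}"
      show "fst (z t) \<noteq> 0" "(fst (z t), snd (z t)) \<in> Q" using z(2)[OF t] Q(2) by auto
      show "(?y has_vector_derivative ?w t) (at t within {0..2 * h})"
        using bounded_linear.has_vector_derivative[OF bounded_linear_fst, of z "F (z t)"] z(2)[OF t]
        by (simp add: F_def)
      show "(?w has_vector_derivative kepler_force (?y t) + h\<^sup>2 *\<^sub>R g (?y t) (?w t)) (at t within {0..2 * h})"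
        using bounded_linear.has_vector_derivative[OF bounded_linear_snd, of z "F (z t)"] z(2)[OF t]
        by (simp add: F_def)
    qed
    with C C' have res: "norm (midpoint_residual h ?y h - h\<^sup>2 *\<^sub>R (g (?y h) (?w h) - midpoint_term (?y h) (?w h))) \<le> C * h ^ 3"
      "norm (midpoint_residual h ?y h) \<le> C' * h ^ 3" by blast+
    define \<delta> where "\<delta> = g (?y h) (?w h) - midpoint_term (?y h) (?w h)"
    have "norm (h\<^sup>2 *\<^sub>R \<delta>) \<le> C' * h^3 + C * h^3"
      using res norm_triangle_ineq4[of "midpoint_residual h ?y h" "midpoint_residual h ?y h - h\<^sup>2 *\<^sub>R \<delta>"]
      unfolding \<delta>_def by simp
    then have "h\<^sup>2 * norm \<delta> \<le> h\<^sup>2 * ((C + C') * h)" by (simp add: algebra_simps eval_nat_numeral)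
    then have 1: "norm \<delta> \<le> (C + C') * h" using h(1) by simp
    have zh: "h \<in> {0..2 * h}" using h by simp
    have "norm ((g q p - midpoint_term q p) - \<delta>) \<le> L * norm ((q, p) - z h)"
      using L(2)[OF Q(3), of "z h"] z(2)[OF zh] by (simp add: \<delta>_def)
    also have "\<dots> \<le> L * (M * h)"
      using z(2)[OF zh] L(1) by (intro mult_left_mono) (auto simp: norm_minus_commute)
    finally have "norm ((g q p - midpoint_term q p) - \<delta>) \<le> L * (M * h)" .
    with 1 show "norm (g q p - midpoint_term q p) \<le> (C + C' + L * M) * h"
      using norm_triangle_ineq[of "(g q p - midpoint_term q p) - \<delta>" \<delta>] by (simp add: algebra_simps)
  qed
  moreover have "((\<lambda>h. (C + C' + L * M) * h) \<longlongrightarrow> (C + C' + L * M) * 0) (at_right 0)"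
    by (intro tendsto_intros)
  ultimately have "norm (g q p - midpoint_term q p) \<le> (C + C' + L * M) * 0"
    by (intro tendsto_lowerbound) auto
  then show ?thesis by simp
qed

section \<open>Solutions of the truncated modified equation near a Kepler orbit\<close>

lemma kepler_solutionD:
  assumes "kepler_solution x v"
  shows "x t \<noteq> 0" "(x has_vector_derivative v t) (at t within S)"
    "(v has_vector_derivative kepler_force (x t)) (at t within S)"
  using assms unfolding kepler_solution_def solves_within_def
  by (auto intro: has_vector_derivative_at_within)

lemma kepler_solution_continuous:
  assumes "kepler_solution x v"
  shows "continuous_on S x" "continuous_on S v"
  using has_vector_derivative_continuous[OF kepler_solutionD(2)[OF assms]]
    has_vector_derivative_continuous[OF kepler_solutionD(3)[OF assms]]
  by (simp_all add: continuous_on_eq_continuous_within)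

text \<open>The shell contains the tube of radius \<open>c\<close> around the curve \<open>X\<close>, so Lipschitz constants on the shell may be used for
comparisons with \<open>X\<close>.\<close>

definition tube_in_shell :: "(real \<Rightarrow> (real^2) \<times> (real^2)) \<Rightarrow> real \<Rightarrow> real \<Rightarrow> real \<Rightarrow> bool" where
  "tube_in_shell X T c R \<longleftrightarrow> 0 < c \<and> (\<forall>t\<in>{0..T}. \<forall>z. norm (z - X t) \<le> c \<longrightarrow> z \<in> shell c R)"

lemma tube_in_shellD:
  assumes "tube_in_shell X T c R"
  shows "0 < c" "t \<in> {0..T} \<Longrightarrow> norm (z - X t) \<le> c \<Longrightarrow> z \<in> shell c R" "t \<in> {0..T} \<Longrightarrow> X t \<in> shell c R"
proof -
  show c: "0 < c" and mem: "t \<in> {0..T} \<Longrightarrow> norm (z - X t) \<le> c \<Longrightarrow> z \<in> shell c R" for t z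
    using assms unfolding tube_in_shell_def by blast+
  show "t \<in> {0..T} \<Longrightarrow> X t \<in> shell c R" using mem[of t "X t"] c by simp
qed

lemma tube_in_shell_exists:
  assumes sol: "kepler_solution x v"
  shows "\<exists>c R. tube_in_shell (\<lambda>t. (x t, v t)) T c R"
proof -
  let ?Q = "(\<lambda>t. (x t, v t)) ` {0..T}"
  have "compact ?Q"
    by (intro compact_continuous_image continuous_intros kepler_solution_continuous[OF sol]) auto
  moreover have "?Q \<subseteq> {z. fst z \<noteq> 0}" using kepler_solutionD(1)[OF sol] by auto
  ultimately obtain c R where c: "0 < c" and Q: "?Q \<subseteq> shell c R" by (rule compact_subset_shell)
  have "z \<in> shell (c/2) (R + c)" if t: "t \<in> {0..T}" and z: "norm (z - (x t, v t)) \<le> c/2" for t z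
  proof -
    have "(x t, v t) \<in> shell c R" using Q t by auto
    then have X: "c \<le> norm (x t)" "norm (x t) \<le> R" "norm (v t) \<le> R" by (auto simp: shell_def)
    have "norm (fst z - x t) \<le> c/2" "norm (snd z - v t) \<le> c/2"
      using z norm_fst_le[of "fst z - x t" "snd z - v t"] norm_snd_le[of "snd z - v t" "fst z - x t"]
      by (cases z; auto)+
    then have "norm (x t) - norm (fst z) \<le> c/2" "norm (fst z) - norm (x t) \<le> c/2" "norm (snd z) - norm (v t) \<le> c/2"
      using norm_triangle_ineq2 norm_minus_commute order_trans by metis+
    then show ?thesis using X c unfolding shell_def case_prod_unfold mem_Collect_eq by linarith
  qed
  then show ?thesis
    using c by (intro exI[of _ "c/2"] exI[of _ "R + c"]) (auto simp: tube_in_shell_def)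
qed

text \<open>Stability of the Kepler flow on a bounded time interval. The defect is controlled only while the
curve remains in the tube. This allows modified right-hand sides that agree with the Kepler
equation only there.\<close>

lemma kepler_perturbation:
  assumes sol: "kepler_solution x v" and tube: "tube_in_shell (\<lambda>t. (x t, v t)) T c R"
  shows "\<exists>C>0. \<forall>\<epsilon> z z'. 0 < \<epsilon> \<and> C * \<epsilon> \<le> c \<and> z 0 = (x 0, v 0) \<and>
      (\<forall>t\<in>{0..T}. (z has_vector_derivative z' t) (at t within {0..T}) \<and>
        (norm (z t - (x t, v t)) \<le> c \<longrightarrow> norm (z' t - (snd (z t), kepler_force (fst (z t)))) \<le> \<epsilon>)) \<longrightarrow>
      (\<forall>t\<in>{0..T}. norm (z t - (x t, v t)) \<le> C * \<epsilon>)"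
proof -
  have c: "0 < c" using tube by (simp add: tube_in_shell_def)
  obtain B where B: "0 < B" "\<And>z z'. z \<in> shell c R \<Longrightarrow> z' \<in> shell c R \<Longrightarrow>
      norm (kepler_force (fst z) - kepler_force (fst z')) \<le> B * norm (z - z')"
    using bounded_lipschitz_on_kepler_force[OF c, of R] by (rule bounded_lipschitz_onE) blast
  define M where "M = 1 + B"
  have M: "0 < M" using B by (simp add: M_def)
  show ?thesis
  proof (intro exI[of _ "2 / M * exp (2 * M * T)"] conjI allI impI ballI)
    show "0 < 2 / M * exp (2 * M * T)" using M by simp
  next
    fix \<epsilon> z z' t
    assume H: "0 < \<epsilon> \<and> 2 / M * exp (2 * M * T) * \<epsilon> \<le> c \<and> z 0 = (x 0, v 0) \<and>
      (\<forall>t\<in>{0..T}. (z has_vector_derivative z' t) (at t within {0..T}) \<and>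
        (norm (z t - (x t, v t)) \<le> c \<longrightarrow> norm (z' t - (snd (z t), kepler_force (fst (z t)))) \<le> \<epsilon>))"
    assume t: "t \<in> {0..T}"
    have "norm (z t - (x t, v t)) \<le> 2 * \<epsilon> / M * exp (2 * M * T)"
    proof (rule gronwall_tube[where d = "\<lambda>t. z t - (x t, v t)", OF _ _ _ M _ _ t])
      fix s assume s: "s \<in> {0..T}"
      show "((\<lambda>t. z t - (x t, v t)) has_vector_derivative z' s - (v s, kepler_force (x s))) (at s within {0..T})"
        using H s by (intro has_vector_derivative_diff has_vector_derivative_Pair kepler_solutionD[OF sol]) auto
      assume le: "norm (z s - (x s, v s)) \<le> c"
      have "z s \<in> shell c R" "(x s, v s) \<in> shell c R"
        using tube_in_shellD(2)[OF tube s le] tube_in_shellD(3)[OF tube s] by auto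
      then have f: "norm (kepler_force (fst (z s)) - kepler_force (x s)) \<le> B * norm (z s - (x s, v s))"
        using B(2)[of "z s" "(x s, v s)"] by simp
      have "norm (snd (z s) - v s) \<le> norm (z s - (x s, v s))"
        using norm_snd_le[of "snd (z s) - v s" "fst (z s) - x s"] by (cases "z s") auto
      note v = this
      have "norm ((snd (z s), kepler_force (fst (z s))) - (v s, kepler_force (x s)))
          = norm (snd (z s) - v s, kepler_force (fst (z s)) - kepler_force (x s))" by simp
      also have "\<dots> \<le> norm (snd (z s) - v s) + norm (kepler_force (fst (z s)) - kepler_force (x s))"
        by (rule norm_Pair_le)
      also have "\<dots> \<le> norm (z s - (x s, v s)) + B * norm (z s - (x s, v s))"
        by (intro add_mono v f)
      finally have "norm ((snd (z s), kepler_force (fst (z s))) - (v s, kepler_force (x s))) \<le> M * norm (z s - (x s, v s))"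
        by (simp add: M_def distrib_right)
      moreover have "norm (z' s - (snd (z s), kepler_force (fst (z s)))) \<le> \<epsilon>" using H s le by blast
      ultimately show "norm (z' s - (v s, kepler_force (x s))) \<le> M * norm (z s - (x s, v s)) + \<epsilon>"
        using norm_triangle_ineq[of "z' s - (snd (z s), kepler_force (fst (z s)))"
            "(snd (z s), kepler_force (fst (z s))) - (v s, kepler_force (x s))"]
        unfolding diff_add_cancel add_diff_eq by linarith
    qed (use H in \<open>auto simp: mult.commute mult.left_commute\<close>)
    then show "norm (z t - (x t, v t)) \<le> 2 / M * exp (2 * M * T) * \<epsilon>" by (simp add: mult_ac)
  qed
qed

text \<open>Uniqueness is stability with arbitrarily small defect.\<close>

lemma kepler_solution_unique:
  assumes sol: "kepler_solution x v" and sol': "kepler_solution y w"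
    and init: "y 0 = x 0" "w 0 = v 0" and t: "0 \<le> t"
  shows "y t = x t"
proof -
  obtain c R where tube: "tube_in_shell (\<lambda>t. (x t, v t)) t c R"
    using tube_in_shell_exists[OF sol] by blast
  then have c: "0 < c" by (simp add: tube_in_shell_def)
  obtain C where C: "C > 0" "\<forall>\<epsilon> z z'. 0 < \<epsilon> \<and> C * \<epsilon> \<le> c \<and> z 0 = (x 0, v 0) \<and>
      (\<forall>s\<in>{0..t}. (z has_vector_derivative z' s) (at s within {0..t}) \<and>
        (norm (z s - (x s, v s)) \<le> c \<longrightarrow> norm (z' s - (snd (z s), kepler_force (fst (z s)))) \<le> \<epsilon>)) \<longrightarrow>
      (\<forall>s\<in>{0..t}. norm (z s - (x s, v s)) \<le> C * \<epsilon>)"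
    using kepler_perturbation[OF sol tube] by blast
  let ?d = "norm ((y t, w t) - (x t, v t))"
  have le: "?d \<le> C * \<epsilon>" if "0 < \<epsilon>" "\<epsilon> \<le> c / C" for \<epsilon>
  proof -
    have "((\<lambda>s. (y s, w s)) has_vector_derivative (w s, kepler_force (y s))) (at s within {0..t})" for s
      by (intro has_vector_derivative_Pair kepler_solutionD[OF sol'])
    then show ?thesis
      using C(2)[rule_format, of \<epsilon> "\<lambda>s. (y s, w s)" "\<lambda>s. (w s, kepler_force (y s))" t] that C(1) init t
      by (simp add: field_simps)
  qed
  have "?d = 0"
  proof (rule ccontr)
    assume "?d \<noteq> 0"
    then have d: "0 < ?d" using norm_ge_zero[of "(y t, w t) - (x t, v t)"] by linarith
    define \<epsilon> where "\<epsilon> = min (c / C) (?d / (2 * C))"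
    have "0 < \<epsilon>" "\<epsilon> \<le> c / C" using c C(1) d by (auto simp: \<epsilon>_def)
    from le[OF this] have "?d \<le> C * (?d / (2 * C))"
      using C(1) by (smt (verit) \<epsilon>_def min.cobounded2 mult_left_mono)
    then show False using d C(1) by simp
  qed
  then show ?thesis by (simp add: prod_eq_iff)
qed

lemma eventually_at_right_0_mult_le:
  assumes "0 < b"
  shows "\<forall>\<^sub>F h in at_right (0::real). a * h \<le> b"
proof -
  have "((\<lambda>h. a * h) \<longlongrightarrow> a * 0) (at_right 0)" by (intro tendsto_intros)
  from order_tendstoD(2)[OF this, of b] assms show ?thesis by (auto elim: eventually_mono)
qed

lemma eventually_at_right_0_small:
  assumes "0 < b"
  shows "\<forall>\<^sub>F h in at_right (0::real). 0 < h \<and> h \<le> 1 \<and> a * h\<^sup>2 \<le> b"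
proof -
  have "\<forall>\<^sub>F h in at_right (0::real). 0 < h" by (simp add: eventually_at_right_less)
  moreover have "\<forall>\<^sub>F h in at_right (0::real). 1 * h \<le> 1" by (rule eventually_at_right_0_mult_le) simp
  moreover have "\<forall>\<^sub>F h in at_right (0::real). \<bar>a\<bar> * h \<le> b" using assms by (rule eventually_at_right_0_mult_le)
  ultimately show ?thesis
  proof eventually_elim
    case (elim h)
    have "a * h\<^sup>2 \<le> \<bar>a\<bar> * h\<^sup>2" by (intro mult_right_mono) auto
    also have "\<dots> \<le> \<bar>a\<bar> * h" using elim by (intro mult_left_mono) (auto simp: power2_eq_square mult_left_le)
    finally show ?case using elim by auto
  qed
qed

text \<open>The \<open>h\<^sup>2\<close> term and the admitted defect together are a perturbation of size \<open>O(h\<^sup>2)\<close>. The bound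
\<open>C * h\<^sup>2 \<le> c\<close> is part of the conclusion so that the solution is known to lie in the tube.\<close>

lemma truncated_solution_close:
  assumes sol: "kepler_solution x v" and tube: "tube_in_shell (\<lambda>t. (x t, v t)) T c R"
    and K: "0 \<le> K"
  shows "\<exists>C>0. \<forall>\<^sub>F h in at_right 0. \<forall>z z'. z 0 = (x 0, v 0) \<and>
      (\<forall>t\<in>{0..T}. (z has_vector_derivative z' t) (at t within {0..T}) \<and>
        (norm (z t - (x t, v t)) \<le> c \<longrightarrow>
          norm (z' t - (snd (z t), truncated_rhs midpoint_term h (fst (z t)) (snd (z t)))) \<le> K * h ^ 4)) \<longrightarrow>
      (\<forall>t\<in>{0..T}. norm (z t - (x t, v t)) \<le> C * h\<^sup>2) \<and> C * h\<^sup>2 \<le> c"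
proof -
  have c: "0 < c" using tube by (simp add: tube_in_shell_def)
  obtain C where C: "C > 0" "\<And>\<epsilon> z z'. 0 < \<epsilon> \<and> C * \<epsilon> \<le> c \<and> z 0 = (x 0, v 0) \<and>
      (\<forall>t\<in>{0..T}. (z has_vector_derivative z' t) (at t within {0..T}) \<and>
        (norm (z t - (x t, v t)) \<le> c \<longrightarrow> norm (z' t - (snd (z t), kepler_force (fst (z t)))) \<le> \<epsilon>)) \<Longrightarrow>
      (\<forall>t\<in>{0..T}. norm (z t - (x t, v t)) \<le> C * \<epsilon>)"
    using kepler_perturbation[OF sol tube] by blast
  obtain G where G: "0 < G" "\<And>z. z \<in> shell c R \<Longrightarrow> norm (midpoint_term (fst z) (snd z)) \<le> G"
    using bounded_lipschitz_on_midpoint_term[OF c, of R] by (rule bounded_lipschitz_onE) blast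
  have "\<forall>\<^sub>F h in at_right 0. \<forall>z z'. z 0 = (x 0, v 0) \<and>
      (\<forall>t\<in>{0..T}. (z has_vector_derivative z' t) (at t within {0..T}) \<and>
        (norm (z t - (x t, v t)) \<le> c \<longrightarrow>
          norm (z' t - (snd (z t), truncated_rhs midpoint_term h (fst (z t)) (snd (z t)))) \<le> K * h ^ 4)) \<longrightarrow>
      (\<forall>t\<in>{0..T}. norm (z t - (x t, v t)) \<le> (C * (K + G)) * h\<^sup>2) \<and> (C * (K + G)) * h\<^sup>2 \<le> c"
    using eventually_at_right_0_small[OF c, of "C * (K + G)"]
  proof eventually_elim
    case (elim h)
    then have h: "0 < h" "h \<le> 1" "C * (K + G) * h\<^sup>2 \<le> c" by auto
    show ?case
    proof (intro allI impI)
      fix z z'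
      assume H: "z 0 = (x 0, v 0) \<and>
        (\<forall>t\<in>{0..T}. (z has_vector_derivative z' t) (at t within {0..T}) \<and>
          (norm (z t - (x t, v t)) \<le> c \<longrightarrow>
            norm (z' t - (snd (z t), truncated_rhs midpoint_term h (fst (z t)) (snd (z t)))) \<le> K * h ^ 4))"
      have "norm (z' t - (snd (z t), kepler_force (fst (z t)))) \<le> (K + G) * h\<^sup>2"
        if t: "t \<in> {0..T}" and le: "norm (z t - (x t, v t)) \<le> c" for t
      proof -
        have "z t \<in> shell c R" using tube_in_shellD(2)[OF tube t le] .
        then have g: "norm (0 :: real^2, h\<^sup>2 *\<^sub>R midpoint_term (fst (z t)) (snd (z t))) \<le> G * h\<^sup>2"
          using G(2)[of "z t"] by (simp add: norm_Pair mult_left_mono mult.commute[of G])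
        have "norm (z' t - (snd (z t), truncated_rhs midpoint_term h (fst (z t)) (snd (z t)))) \<le> K * h ^ 4"
          using H t le by blast
        also have "K * h ^ 4 \<le> K * h\<^sup>2" using h K by (intro mult_left_mono power_decreasing) auto
        finally have "norm (z' t - (snd (z t), truncated_rhs midpoint_term h (fst (z t)) (snd (z t)))) \<le> K * h\<^sup>2" .
        note norm_triangle_mono[OF this g]
        moreover have "z' t - (snd (z t), kepler_force (fst (z t)))
            = (z' t - (snd (z t), truncated_rhs midpoint_term h (fst (z t)) (snd (z t))))
              + (0, h\<^sup>2 *\<^sub>R midpoint_term (fst (z t)) (snd (z t)))"
          by (cases "z' t") (simp add: truncated_rhs_def)
        ultimately show ?thesis by (simp only: distrib_right)
      qed
      moreover have "0 < (K + G) * h\<^sup>2" using h K G by simp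
      ultimately have "\<forall>t\<in>{0..T}. norm (z t - (x t, v t)) \<le> C * ((K + G) * h\<^sup>2)"
        using H h(3) by (intro C(2)[of _ z z']) (auto simp: mult.assoc)
      then show "(\<forall>t\<in>{0..T}. norm (z t - (x t, v t)) \<le> (C * (K + G)) * h\<^sup>2) \<and> (C * (K + G)) * h\<^sup>2 \<le> c"
        using h(3) by (simp add: mult.assoc)
    qed
  qed
  moreover have "0 < C * (K + G)" using C(1) K G(1) by simp
  ultimately show ?thesis by blast
qed

text \<open>The truncated equation is singular at the origin and grows in the velocity. Clamping \<open>q\<close>, \<open>p\<close> and
\<open>1 / norm q\<close> yields a globally Lipschitz equation that agrees with it on the shell. The solution of the clamped equation
stays in the tube for small \<open>h\<close>, hence solves the original one.\<close>

lemma truncated_solution_exists: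
  assumes sol: "kepler_solution x v" and T: "0 \<le> T"
  shows "\<forall>\<^sub>F h in at_right 0. \<exists>y w. solves (truncated_rhs midpoint_term h) {0..T} y w \<and> y 0 = x 0 \<and> w 0 = v 0"
proof -
  obtain c R where tube: "tube_in_shell (\<lambda>t. (x t, v t)) T c R"
    using tube_in_shell_exists[OF sol] by blast
  then have c: "0 < c" by (simp add: tube_in_shell_def)
  have "(x 0, v 0) \<in> shell c R" using tube_in_shellD(3)[OF tube, of 0] T by auto
  then have R: "0 \<le> R" using norm_ge_zero[of "v 0"] by (auto simp: shell_def simp del: norm_ge_zero)
  let ?\<pi> = "closest_point (cball 0 R) :: real^2 \<Rightarrow> real^2"
  have \<pi>: "bounded_lipschitz_on UNIV (\<lambda>z :: (real^2) \<times> (real^2). ?\<pi> (T z))"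
    if T: "\<And>z z'. norm (T z - T z') \<le> norm (z - z')" for T :: "(real^2) \<times> (real^2) \<Rightarrow> real^2"
    by (rule bounded_lipschitz_onI[of _ _ R 1])
      (use closest_point_cball_0[OF R] order_trans[OF closest_point_cball_0(2)[OF R] T] in auto)
  have q: "bounded_lipschitz_on UNIV (\<lambda>z :: (real^2) \<times> (real^2). ?\<pi> (fst z))"
    and p: "bounded_lipschitz_on UNIV (\<lambda>z :: (real^2) \<times> (real^2). ?\<pi> (snd z))"
    by (intro \<pi>; metis norm_fst_le norm_snd_le fst_diff snd_diff prod.collapse)+
  have s: "bounded_lipschitz_on UNIV (\<lambda>z :: (real^2) \<times> (real^2). 1 / max c (norm (fst z)))"
  proof (rule bounded_lipschitz_on_inverse[OF _ c, where L = 1])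
    fix z z' :: "(real^2) \<times> (real^2)"
    have "\<bar>max c (norm (fst z)) - max c (norm (fst z'))\<bar> \<le> \<bar>norm (fst z) - norm (fst z')\<bar>" by linarith
    also have "\<dots> \<le> norm (fst z - fst z')" by (rule norm_triangle_ineq3)
    also have "\<dots> \<le> norm (z - z')" by (metis norm_fst_le fst_diff prod.collapse)
    finally show "\<bar>max c (norm (fst z)) - max c (norm (fst z'))\<bar> \<le> 1 * norm (z - z')" by simp
  qed auto
  define F where "F h z = (?\<pi> (snd z), - ((1 / max c (norm (fst z))) ^ 3 *\<^sub>R ?\<pi> (fst z))
      + h\<^sup>2 *\<^sub>R midpoint_poly (1 / max c (norm (fst z))) (?\<pi> (fst z)) (?\<pi> (snd z)))" for h z
  have F_eq: "F h z = (snd z, truncated_rhs midpoint_term h (fst z) (snd z))" if "z \<in> shell c R" for h z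
  proof -
    have z: "max c (norm (fst z)) = norm (fst z)" "norm (fst z) \<le> R" "norm (snd z) \<le> R"
      using that by (auto simp: shell_def)
    show ?thesis
      unfolding F_def truncated_rhs_def midpoint_term_def kepler_force_alt z(1)
        closest_point_cball_0(3)[OF R z(2)] closest_point_cball_0(3)[OF R z(3)] ..
  qed
  have ex: "\<exists>z. z 0 = (x 0, v 0) \<and> (\<forall>t\<in>{0..T}. (z has_vector_derivative F h (z t)) (at t within {0..T}))" for h
  proof -
    have "bounded_lipschitz_on UNIV (F h)"
      unfolding F_def by (intro bounded_lipschitz_on_intros bounded_lipschitz_on_midpoint_poly q p s)
    then obtain L where "0 < L" "\<And>z z'. norm (F h z - F h z') \<le> L * norm (z - z')"
      by (rule bounded_lipschitz_onE) blast
    then show ?thesis using T by (intro picard_lindelof)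
  qed
  obtain C where C: "\<forall>\<^sub>F h in at_right 0. \<forall>z z'. z 0 = (x 0, v 0) \<and>
      (\<forall>t\<in>{0..T}. (z has_vector_derivative z' t) (at t within {0..T}) \<and>
        (norm (z t - (x t, v t)) \<le> c \<longrightarrow>
          norm (z' t - (snd (z t), truncated_rhs midpoint_term h (fst (z t)) (snd (z t)))) \<le> 0 * h ^ 4)) \<longrightarrow>
      (\<forall>t\<in>{0..T}. norm (z t - (x t, v t)) \<le> C * h\<^sup>2) \<and> C * h\<^sup>2 \<le> c"
    using truncated_solution_close[OF sol tube order_refl] by blast
  then show ?thesis
  proof eventually_elim
    case (elim h)
    obtain z where z0: "z 0 = (x 0, v 0)"
      and z: "\<And>t. t \<in> {0..T} \<Longrightarrow> (z has_vector_derivative F h (z t)) (at t within {0..T})"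
      using ex[of h] by blast
    have "(\<forall>t\<in>{0..T}. norm (z t - (x t, v t)) \<le> C * h\<^sup>2) \<and> C * h\<^sup>2 \<le> c"
    proof (rule elim[rule_format, of z "\<lambda>t. F h (z t)"], intro conjI ballI impI z0 z)
      fix t assume "t \<in> {0..T}" "norm (z t - (x t, v t)) \<le> c"
      then have "z t \<in> shell c R" by (rule tube_in_shellD(2)[OF tube])
      then show "norm (F h (z t) - (snd (z t), truncated_rhs midpoint_term h (fst (z t)) (snd (z t)))) \<le> 0 * h ^ 4"
        by (simp add: F_eq)
    qed
    then have sh: "z t \<in> shell c R" if "t \<in> {0..T}" for t
      using that by (intro tube_in_shellD(2)[OF tube]) force+
    have "solves (truncated_rhs midpoint_term h) {0..T} (\<lambda>t. fst (z t)) (\<lambda>t. snd (z t))"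
      unfolding solves_truncated_iff
    proof (intro ballI conjI)
      fix t assume t: "t \<in> {0..T}"
      note zt = z[OF t, unfolded F_eq[OF sh[OF t]] truncated_rhs_def]
      show "fst (z t) \<noteq> 0" using sh[OF t] c by (auto simp: shell_def)
      show "((\<lambda>t. fst (z t)) has_vector_derivative snd (z t)) (at t within {0..T})"
        using bounded_linear.has_vector_derivative[OF bounded_linear_fst zt] by simp
      show "((\<lambda>t. snd (z t)) has_vector_derivative kepler_force (fst (z t)) + h\<^sup>2 *\<^sub>R midpoint_term (fst (z t)) (snd (z t)))
          (at t within {0..T})"
        using bounded_linear.has_vector_derivative[OF bounded_linear_snd zt] by simp
    qed
    then show ?case using z0 by (intro exI[of _ "\<lambda>t. fst (z t)"] exI[of _ "\<lambda>t. snd (z t)"]) simp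
  qed
qed

section \<open>The Laplace--Runge--Lenz vector\<close>

lemma inner_real2: "(a :: real^2) \<bullet> b = a $ 1 * b $ 1 + a $ 2 * b $ 2"
  by (simp add: inner_vec_def sum_2)

lemma bounded_linear_ang_mom: "bounded_linear (ang_mom q)"
  unfolding linear_conv_bounded_linear[symmetric]
  by (rule linearI) (simp_all add: ang_mom_def algebra_simps)

text \<open>Lagrange's identity in the plane. The function \<open>ang_mom\<close> is used below as the cross
product of arbitrary vectors.\<close>

lemma ang_mom_squared: "(ang_mom a b)\<^sup>2 + (a \<bullet> b)\<^sup>2 = (norm a)\<^sup>2 * (norm b)\<^sup>2"
  unfolding ang_mom_def power2_norm_eq_inner inner_real2 by algebra

lemma abs_ang_mom_le: "\<bar>ang_mom a b\<bar> \<le> norm a * norm b"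
proof -
  have "\<bar>ang_mom a b\<bar>\<^sup>2 \<le> (norm a * norm b)\<^sup>2"
    using ang_mom_squared[of a b] zero_le_power2[of "a \<bullet> b"] unfolding power_mult_distrib power2_abs by linarith
  then show ?thesis by (rule power2_le_imp_le) simp
qed

text \<open>The derivative of \<open>lrl q p\<close> with respect to \<open>p\<close> in direction \<open>\<eta>\<close>. It is the rate of change of the
Laplace--Runge--Lenz vector caused by an acceleration \<open>\<eta>\<close> in addition to the Kepler force.\<close>

definition lrl_kick :: "real^2 \<Rightarrow> real^2 \<Rightarrow> real^2 \<Rightarrow> real^2" where
  "lrl_kick q p \<eta> = (2 * (p \<bullet> \<eta>)) *\<^sub>R q - (q \<bullet> \<eta>) *\<^sub>R p - (q \<bullet> p) *\<^sub>R \<eta>"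

lemma has_vector_derivative_lrl:
  assumes y: "(y has_vector_derivative w t) (at t within S)" and "y t \<noteq> 0"
    and w: "(w has_vector_derivative acc) (at t within S)"
  shows "((\<lambda>t. lrl (y t) (w t)) has_vector_derivative lrl_kick (y t) (w t) (acc - kepler_force (y t)))
    (at t within S)"
proof -
  define r where "r = norm (y t)"
  have r: "r \<noteq> 0" "y t \<bullet> y t = r\<^sup>2" using assms(2) by (auto simp: r_def power2_norm_eq_inner)
  show ?thesis
    unfolding lrl_def power2_norm_eq_inner lrl_kick_def kepler_force_alt
    apply (rule y w has_real_derivative_inverse_norm_curve[OF y assms(2)]
      has_real_derivative_inner_curve derivative_eq_intros refl)+
    using r(1) unfolding r_def[symmetric] inner_diff_right inner_minus_right inner_scaleR_right r(2) inner_commute[of "w t" "y t"]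
    by (simp add: vec_eq_iff field_simps eval_nat_numeral inner_commute)
qed

lemma norm_lrl_kick_le: "norm (lrl_kick q p \<eta>) \<le> 4 * norm q * norm p * norm \<eta>"
proof -
  have "norm ((2 * (p \<bullet> \<eta>)) *\<^sub>R q) \<le> 2 * norm q * norm p * norm \<eta>"
    using mult_right_mono[OF Cauchy_Schwarz_ineq2[of p \<eta>], of "norm q"] by (simp add: abs_mult algebra_simps)
  moreover have "norm ((q \<bullet> \<eta>) *\<^sub>R p) \<le> norm q * norm p * norm \<eta>"
    using mult_right_mono[OF Cauchy_Schwarz_ineq2[of q \<eta>], of "norm p"] by (simp add: algebra_simps)
  moreover have "norm ((q \<bullet> p) *\<^sub>R \<eta>) \<le> norm q * norm p * norm \<eta>"
    using mult_right_mono[OF Cauchy_Schwarz_ineq2[of q p], of "norm \<eta>"] by (simp add: algebra_simps)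
  ultimately show ?thesis
    unfolding lrl_kick_def
    using norm_triangle_ineq4[of "(2 * (p \<bullet> \<eta>)) *\<^sub>R q - (q \<bullet> \<eta>) *\<^sub>R p" "(q \<bullet> p) *\<^sub>R \<eta>"]
      norm_triangle_ineq4[of "(2 * (p \<bullet> \<eta>)) *\<^sub>R q" "(q \<bullet> \<eta>) *\<^sub>R p"]
    by linarith
qed

lemma lrl_kick_add: "lrl_kick q p (\<eta> + \<zeta>) = lrl_kick q p \<eta> + lrl_kick q p \<zeta>"
  and lrl_kick_scaleR: "lrl_kick q p (a *\<^sub>R \<eta>) = a *\<^sub>R lrl_kick q p \<eta>"
  by (simp_all add: lrl_kick_def algebra_simps)

lemma kepler_lrl_constant:
  assumes sol: "kepler_solution x v"
  shows "lrl (x t) (v t) = lrl (x 0) (v 0)"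
proof -
  have "((\<lambda>t. lrl (x t) (v t)) has_vector_derivative 0) (at t)" for t
    using has_vector_derivative_lrl[OF kepler_solutionD(2)[OF sol] kepler_solutionD(1)[OF sol] kepler_solutionD(3)[OF sol], of t UNIV]
    by (simp add: lrl_kick_def)
  then have "\<exists>c. \<forall>t\<in>UNIV. lrl (x t) (v t) = c"
    by (intro has_derivative_zero_constant) (simp_all add: has_vector_derivative_def)
  then show ?thesis by (metis UNIV_I)
qed

lemma kepler_ang_mom_constant:
  assumes sol: "kepler_solution x v"
  shows "ang_mom (x t) (v t) = ang_mom (x 0) (v 0)"
proof -
  have "((\<lambda>t. ang_mom (x t) (v t)) has_real_derivative 0) (at t)" for t
  proof -
    have x: "((\<lambda>t. x t $ i) has_real_derivative v t $ i) (at t)" for i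
      using bounded_linear.has_vector_derivative[OF bounded_linear_vec_nth kepler_solutionD(2)[OF sol]]
      by (simp add: has_real_derivative_iff_has_vector_derivative)
    have v: "((\<lambda>t. v t $ i) has_real_derivative kepler_force (x t) $ i) (at t)" for i
      using bounded_linear.has_vector_derivative[OF bounded_linear_vec_nth kepler_solutionD(3)[OF sol]]
      by (simp add: has_real_derivative_iff_has_vector_derivative)
    show ?thesis
      unfolding ang_mom_def
      by (rule derivative_eq_intros x v refl)+ (simp add: kepler_force_def)
  qed
  then show ?thesis by (intro DERIV_isconst_all) blast
qed

lemma bounded_lipschitz_on_lrl: "0 < c \<Longrightarrow> bounded_lipschitz_on (shell c R) (\<lambda>z. lrl (fst z) (snd z))"
  unfolding lrl_def power2_norm_eq_inner
  by (intro bounded_lipschitz_on_intros bounded_lipschitz_on_shell_atoms)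

lemma bounded_lipschitz_on_lrl_kick:
  "0 < c \<Longrightarrow> bounded_lipschitz_on (shell c R) (\<lambda>z. lrl_kick (fst z) (snd z) (midpoint_term (fst z) (snd z)))"
  unfolding lrl_kick_def
  by (intro bounded_lipschitz_on_intros bounded_lipschitz_on_shell_atoms bounded_lipschitz_on_midpoint_term)

text \<open>Here \<open>J\<close> is a primitive, along the Kepler orbit, of the cross product of \<open>E\<close> with the kick. The
kick along the perturbed solution is \<open>h\<^sup>2\<close> times a Lipschitz function of the state plus the
contribution of the defect. As the states differ by \<open>O(h\<^sup>2)\<close>, the derivative of the quantity
\<open>\<Delta> t = ang_mom E (lrl (y t) (w t)) - h\<^sup>2 * J t\<close> is \<open>O(h\<^sup>4)\<close>.\<close>

lemma lrl_drift:
  assumes sol: "kepler_solution x v" and T: "0 \<le> T" and K: "0 \<le> K"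
    and E: "E = lrl (x 0) (v 0)"
    and J: "\<And>t. t \<in> {0..T} \<Longrightarrow> (J has_real_derivative
      ang_mom E (lrl_kick (x t) (v t) (midpoint_term (x t) (v t)))) (at t within {0..T})"
  shows "\<exists>C>0. \<forall>\<^sub>F h in at_right 0. \<forall>y w.
      solves_within (K * h ^ 4) (truncated_rhs midpoint_term h) {0..T} y w \<and> y 0 = x 0 \<and> w 0 = v 0 \<longrightarrow>
      (\<forall>t\<in>{0..T}. norm (lrl (y t) (w t) - E) \<le> C * h\<^sup>2) \<and>
      \<bar>ang_mom E (lrl (y T) (w T)) - h\<^sup>2 * (J T - J 0)\<bar> \<le> C * h ^ 4"
proof -
  obtain c R where tube: "tube_in_shell (\<lambda>t. (x t, v t)) T c R"
    using tube_in_shell_exists[OF sol] by blast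
  note c = tube_in_shellD(1)[OF tube]
  obtain C0 where C0: "0 < C0" "\<forall>\<^sub>F h in at_right 0. \<forall>z z'. z 0 = (x 0, v 0) \<and>
      (\<forall>t\<in>{0..T}. (z has_vector_derivative z' t) (at t within {0..T}) \<and>
        (norm (z t - (x t, v t)) \<le> c \<longrightarrow>
          norm (z' t - (snd (z t), truncated_rhs midpoint_term h (fst (z t)) (snd (z t)))) \<le> K * h ^ 4)) \<longrightarrow>
      (\<forall>t\<in>{0..T}. norm (z t - (x t, v t)) \<le> C0 * h\<^sup>2) \<and> C0 * h\<^sup>2 \<le> c"
    using truncated_solution_close[OF sol tube K] by blast
  obtain L1 where L1: "0 < L1" "\<And>z z'. z \<in> shell c R \<Longrightarrow> z' \<in> shell c R \<Longrightarrow>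
      norm (lrl (fst z) (snd z) - lrl (fst z') (snd z')) \<le> L1 * norm (z - z')"
    using bounded_lipschitz_on_lrl[OF c, of R] by (rule bounded_lipschitz_onE) blast
  define \<Psi> where "\<Psi> z = lrl_kick (fst z) (snd z) (midpoint_term (fst z) (snd z))" for z
  obtain L2 where L2: "0 < L2" "\<And>z z'. z \<in> shell c R \<Longrightarrow> z' \<in> shell c R \<Longrightarrow>
      norm (\<Psi> z - \<Psi> z') \<le> L2 * norm (z - z')"
    using bounded_lipschitz_on_lrl_kick[OF c, of R, folded \<Psi>_def] by (rule bounded_lipschitz_onE) blast
  have "(x 0, v 0) \<in> shell c R" using tube_in_shellD(3)[OF tube, of 0] T by auto
  then have R: "0 \<le> R" using norm_ge_zero[of "v 0"] by (auto simp: shell_def simp del: norm_ge_zero)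
  define D where "D = norm E * (L2 * C0 + 4 * R * R * K) * T"
  have D: "0 \<le> D" using L2 C0 R K T by (simp add: D_def)
  define C where "C = max (L1 * C0) D"
  have Cpos: "0 < C" using L1 C0 by (simp add: C_def less_max_iff_disj)
  show ?thesis
  proof (intro exI[of _ C] conjI Cpos, use C0(2) eventually_at_right_less[of 0] in eventually_elim, intro allI impI)
    fix h :: real and y w
    assume close: "\<forall>z z'. z 0 = (x 0, v 0) \<and>
      (\<forall>t\<in>{0..T}. (z has_vector_derivative z' t) (at t within {0..T}) \<and>
        (norm (z t - (x t, v t)) \<le> c \<longrightarrow>
          norm (z' t - (snd (z t), truncated_rhs midpoint_term h (fst (z t)) (snd (z t)))) \<le> K * h ^ 4)) \<longrightarrow>
      (\<forall>t\<in>{0..T}. norm (z t - (x t, v t)) \<le> C0 * h\<^sup>2) \<and> C0 * h\<^sup>2 \<le> c"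
      and h: "0 < h"
      and H: "solves_within (K * h ^ 4) (truncated_rhs midpoint_term h) {0..T} y w \<and> y 0 = x 0 \<and> w 0 = v 0"
    then have acc_ex: "\<forall>t\<in>{0..T}. \<exists>acc. (w has_vector_derivative acc) (at t within {0..T}) \<and>
        norm (acc - truncated_rhs midpoint_term h (y t) (w t)) \<le> K * h ^ 4"
      unfolding solves_within_def by blast
    from bchoice[OF acc_ex] obtain acc where acc: "\<And>t. t \<in> {0..T} \<Longrightarrow> (w has_vector_derivative acc t) (at t within {0..T})"
      "\<And>t. t \<in> {0..T} \<Longrightarrow> norm (acc t - truncated_rhs midpoint_term h (y t) (w t)) \<le> K * h ^ 4"
      by blast
    have y: "\<And>t. t \<in> {0..T} \<Longrightarrow> (y has_vector_derivative w t) (at t within {0..T})"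
      "\<And>t. t \<in> {0..T} \<Longrightarrow> y t \<noteq> 0"
      using H unfolding solves_within_def by blast+
    have "(\<forall>t\<in>{0..T}. norm ((y t, w t) - (x t, v t)) \<le> C0 * h\<^sup>2) \<and> C0 * h\<^sup>2 \<le> c"
      by (rule close[rule_format, of "\<lambda>t. (y t, w t)" "\<lambda>t. (w t, acc t)"])
        (use H acc y in \<open>auto intro!: has_vector_derivative_Pair simp: norm_Pair\<close>)
    then have z: "norm ((y t, w t) - (x t, v t)) \<le> C0 * h\<^sup>2" "(y t, w t) \<in> shell c R" "(x t, v t) \<in> shell c R"
      if "t \<in> {0..T}" for t
      using tube_in_shellD(2)[OF tube that, of "(y t, w t)"] tube_in_shellD(3)[OF tube that] that by force+
    have lrl_close: "norm (lrl (y t) (w t) - E) \<le> C * h\<^sup>2" if t: "t \<in> {0..T}" for t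
    proof -
      have "norm (lrl (y t) (w t) - lrl (x t) (v t)) \<le> L1 * norm ((y t, w t) - (x t, v t))"
        using L1(2)[OF z(2,3)[OF t]] by (simp only: fst_conv snd_conv)
      also have "\<dots> \<le> L1 * (C0 * h\<^sup>2)" using L1(1) z(1)[OF t] by (intro mult_left_mono) auto
      also have "\<dots> \<le> C * h\<^sup>2" unfolding mult.assoc[symmetric] by (intro mult_right_mono) (auto simp: C_def)
      finally show ?thesis unfolding E kepler_lrl_constant[OF sol, of t] .
    qed
    define \<Delta> where "\<Delta> t = ang_mom E (lrl (y t) (w t)) - h\<^sup>2 * J t" for t
    define \<Delta>' where "\<Delta>' t = ang_mom E (lrl_kick (y t) (w t) (acc t - kepler_force (y t)))
       - h\<^sup>2 * ang_mom E (\<Psi> (x t, v t))" for t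
    have \<Delta>_deriv: "(\<Delta> has_vector_derivative \<Delta>' t) (at t within {0..T})" if t: "t \<in> {0..T}" for t
      unfolding \<Delta>_def \<Delta>'_def \<Psi>_def fst_conv snd_conv
    proof (rule has_vector_derivative_diff)
      show "((\<lambda>t. ang_mom E (lrl (y t) (w t))) has_vector_derivative
          ang_mom E (lrl_kick (y t) (w t) (acc t - kepler_force (y t)))) (at t within {0..T})"
        by (rule bounded_linear.has_vector_derivative[OF bounded_linear_ang_mom
              has_vector_derivative_lrl[OF y(1)[OF t] y(2)[OF t] acc(1)[OF t]]])
      show "((\<lambda>t. h\<^sup>2 * J t) has_vector_derivative
          h\<^sup>2 * ang_mom E (lrl_kick (x t) (v t) (midpoint_term (x t) (v t)))) (at t within {0..T})"
        using DERIV_cmult[OF J[OF t]] by (simp only: has_real_derivative_iff_has_vector_derivative)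
    qed
    have \<Delta>_le: "norm (\<Delta>' t) \<le> norm E * (L2 * C0 + 4 * R * R * K) * h ^ 4" if t: "t \<in> {0..T}" for t
    proof -
      define \<eta> where "\<eta> = acc t - truncated_rhs midpoint_term h (y t) (w t)"
      have "acc t - kepler_force (y t) = h\<^sup>2 *\<^sub>R midpoint_term (y t) (w t) + \<eta>"
        by (simp add: \<eta>_def truncated_rhs_def)
      then have "\<Delta>' t = ang_mom E (h\<^sup>2 *\<^sub>R (\<Psi> (y t, w t) - \<Psi> (x t, v t)) + lrl_kick (y t) (w t) \<eta>)"
        unfolding \<Delta>'_def \<Psi>_def
        using bounded_linear.linear[OF bounded_linear_ang_mom[of E]]
        by (simp add: lrl_kick_add lrl_kick_scaleR linear_add linear_diff linear_scale algebra_simps)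
      also have "norm \<dots> \<le> norm E * norm (h\<^sup>2 *\<^sub>R (\<Psi> (y t, w t) - \<Psi> (x t, v t)) + lrl_kick (y t) (w t) \<eta>)"
        using abs_ang_mom_le by simp
      also have "\<dots> \<le> norm E * (h\<^sup>2 * (L2 * (C0 * h\<^sup>2)) + 4 * R * R * (K * h ^ 4))"
      proof (intro mult_left_mono norm_triangle_le add_mono)
        have "norm (\<Psi> (y t, w t) - \<Psi> (x t, v t)) \<le> L2 * norm ((y t, w t) - (x t, v t))"
          by (rule L2(2)[OF z(2,3)[OF t]])
        also have "\<dots> \<le> L2 * (C0 * h\<^sup>2)" using L2(1) z(1)[OF t] by (intro mult_left_mono) auto
        finally show "norm (h\<^sup>2 *\<^sub>R (\<Psi> (y t, w t) - \<Psi> (x t, v t))) \<le> h\<^sup>2 * (L2 * (C0 * h\<^sup>2))"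
          by (simp add: mult_left_mono)
        have "norm (lrl_kick (y t) (w t) \<eta>) \<le> 4 * norm (y t) * norm (w t) * norm \<eta>" by (rule norm_lrl_kick_le)
        also have "\<dots> \<le> 4 * R * R * (K * h ^ 4)"
          using z(2)[OF t] acc(2)[OF t] R by (intro mult_mono) (auto simp: shell_def \<eta>_def)
        finally show "norm (lrl_kick (y t) (w t) \<eta>) \<le> 4 * R * R * (K * h ^ 4)" .
      qed auto
      finally show ?thesis by (simp add: algebra_simps eval_nat_numeral)
    qed
    have "norm (\<Delta> T - \<Delta> 0) \<le> (norm E * (L2 * C0 + 4 * R * R * K) * h ^ 4) * T"
      using norm_increment_initial_le[OF \<Delta>_deriv \<Delta>_le] T by simp
    moreover have "\<Delta> T - \<Delta> 0 = ang_mom E (lrl (y T) (w T)) - h\<^sup>2 * (J T - J 0)"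
      using H by (simp add: \<Delta>_def E ang_mom_def algebra_simps)
    ultimately have "\<bar>ang_mom E (lrl (y T) (w T)) - h\<^sup>2 * (J T - J 0)\<bar> \<le> D * h ^ 4"
      by (simp add: D_def mult_ac)
    also have "\<dots> \<le> C * h ^ 4" by (intro mult_right_mono) (auto simp: C_def)
    finally show "(\<forall>t\<in>{0..T}. norm (lrl (y t) (w t) - E) \<le> C * h\<^sup>2) \<and>
      \<bar>ang_mom E (lrl (y T) (w T)) - h\<^sup>2 * (J T - J 0)\<bar> \<le> C * h ^ 4"
      using lrl_close by blast
  qed
qed

lemma abs_arctan_minus_le: "\<bar>arctan z - z\<bar> \<le> z\<^sup>2"
proof -
  have "norm ((z - arctan z) - (0 - arctan 0)) \<le> \<bar>z\<bar> * norm (z - 0)"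
  proof (rule field_differentiable_bound[where S = "cball 0 \<bar>z\<bar>" and f = "\<lambda>z. z - arctan z"])
    fix s :: real assume s: "s \<in> cball 0 \<bar>z\<bar>"
    show "((\<lambda>z. z - arctan z) has_real_derivative s\<^sup>2 / (1 + s\<^sup>2)) (at s within cball 0 \<bar>z\<bar>)"
      by (auto intro!: derivative_eq_intros simp: field_simps sum_power2_eq_zero_iff add_nonneg_eq_0_iff)
    have "s\<^sup>2 \<le> \<bar>s\<bar> * (1 + s\<^sup>2)"
    proof (cases "\<bar>s\<bar> \<le> 1")
      case True
      then have "\<bar>s\<bar> * \<bar>s\<bar> \<le> \<bar>s\<bar> * 1" by (intro mult_left_mono) auto
      then show ?thesis by (simp add: power2_eq_square distrib_left add_increasing2)
    next
      case False
      then have "1 * s\<^sup>2 \<le> \<bar>s\<bar> * (1 + s\<^sup>2)" by (intro mult_mono) auto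
      then show ?thesis by simp
    qed
    then have "s\<^sup>2 / (1 + s\<^sup>2) \<le> \<bar>s\<bar>" by (simp add: divide_le_eq add_pos_nonneg)
    then show "norm (s\<^sup>2 / (1 + s\<^sup>2)) \<le> \<bar>z\<bar>" using s by simp
  qed (auto simp: dist_norm)
  then show ?thesis by (simp add: power2_eq_square abs_minus_commute flip: abs_mult)
qed

lemma norm_real2_squared: "(norm (E :: real^2))\<^sup>2 = (E $ 1)\<^sup>2 + (E $ 2)\<^sup>2"
  unfolding power2_norm_eq_inner inner_real2 by (simp add: power2_eq_square)

lemma real2_polar: obtains \<omega> where "(E :: real^2) $ 1 = norm E * cos \<omega>" "E $ 2 = norm E * sin \<omega>"
proof (cases "E = 0")
  case False
  then have "(E $ 1 / norm E)\<^sup>2 + (E $ 2 / norm E)\<^sup>2 = 1"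
    unfolding power_divide add_divide_distrib[symmetric] norm_real2_squared[symmetric] by simp
  then obtain \<omega> where "E $ 1 / norm E = cos \<omega>" "E $ 2 / norm E = sin \<omega>"
    using sincos_total_2pi by metis
  with False show ?thesis by (intro that[of \<omega>]) (auto simp: field_simps)
qed (simp add: that)

text \<open>As long as the vector stays within distance \<open>norm E\<close> of its initial value \<open>E\<close>, its angle with \<open>E\<close> has a
positive cosine. By the intermediate value theorem no continuous choice of the angle can then leave
\<open>(-\<pi>/2, \<pi>/2)\<close> around its initial value, where the tangent determines it. Conversely the arctangent
provides such a choice.\<close>

lemma lrl_angle_change_iff:
  assumes T: "0 \<le> T" and cont: "continuous_on {0..T} (\<lambda>t. lrl (y t) (w t))"
    and l0: "lrl (y 0) (w 0) = E"
    and near: "\<And>t. t \<in> {0..T} \<Longrightarrow> norm (lrl (y t) (w t) - E) < norm E"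
  shows "lrl_angle_change T y w \<rho> \<longleftrightarrow>
    \<rho> = arctan (ang_mom E (lrl (y T) (w T)) / (E \<bullet> lrl (y T) (w T)))"
proof -
  define l where "l t = lrl (y t) (w t)" for t
  have pos: "0 < E \<bullet> l t" if "t \<in> {0..T}" for t
  proof -
    have "(norm (l t - E))\<^sup>2 < (norm E)\<^sup>2"
      using near[OF that] by (intro power_strict_mono) (auto simp: l_def)
    then have "l t \<bullet> l t < 2 * (E \<bullet> l t)"
      by (simp add: power2_norm_eq_inner inner_diff inner_commute)
    then show ?thesis using inner_ge_zero[of "l t"] by linarith
  qed
  have E: "0 < norm E" using pos[of 0] T by auto
  have l: "0 < norm (l t)" if "t \<in> {0..T}" for t using pos[OF that] by auto
  define \<phi> where "\<phi> t = arctan (ang_mom E (l t) / (E \<bullet> l t))" for t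
  have \<phi>_cos_sin: "cos (\<phi> t) = (E \<bullet> l t) / (norm E * norm (l t))" "sin (\<phi> t) = ang_mom E (l t) / (norm E * norm (l t))"
    if t: "t \<in> {0..T}" for t
  proof -
    have "1 + (ang_mom E (l t) / (E \<bullet> l t))\<^sup>2 = (norm E * norm (l t) / (E \<bullet> l t))\<^sup>2"
      using pos[OF t] ang_mom_squared[of E "l t"] by (simp add: field_simps power_mult_distrib)
    then have "sqrt (1 + (ang_mom E (l t) / (E \<bullet> l t))\<^sup>2) = norm E * norm (l t) / (E \<bullet> l t)"
      using pos[OF t] by simp
    then show "cos (\<phi> t) = (E \<bullet> l t) / (norm E * norm (l t))" "sin (\<phi> t) = ang_mom E (l t) / (norm E * norm (l t))"
      unfolding \<phi>_def cos_arctan sin_arctan using pos[OF t] by simp_all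
  qed
  have \<phi>_cont: "continuous_on {0..T} \<phi>"
  proof -
    have lc: "continuous_on {0..T} l" using cont by (simp add: l_def)
    show ?thesis unfolding \<phi>_def
      by (intro continuous_intros bounded_linear.continuous_on[OF bounded_linear_ang_mom lc] lc)
        (use pos in force)
  qed
  have \<phi>0: "\<phi> 0 = 0" by (simp add: \<phi>_def l_def l0 ang_mom_def)
  show ?thesis
    unfolding l_def[symmetric] \<phi>_def[symmetric]
  proof
    assume \<rho>: "\<rho> = \<phi> T"
    obtain \<omega>\<^sub>0 where \<omega>\<^sub>0: "E $ 1 = norm E * cos \<omega>\<^sub>0" "E $ 2 = norm E * sin \<omega>\<^sub>0" by (rule real2_polar)
    show "lrl_angle_change T y w \<rho>"
      unfolding lrl_angle_change_def l_def[symmetric]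
    proof (intro exI[of _ "\<lambda>t. \<omega>\<^sub>0 + \<phi> t"] conjI ballI)
      show "continuous_on {0..T} (\<lambda>t. \<omega>\<^sub>0 + \<phi> t)" by (intro continuous_intros \<phi>_cont)
      fix t assume t: "t \<in> {0..T}"
      show "l t \<noteq> 0" using l[OF t] by auto
      have n: "(E $ 1)\<^sup>2 + (E $ 2)\<^sup>2 = (norm E)\<^sup>2"
        by (simp only: norm_real2_squared)
      have "norm (l t) * cos (\<omega>\<^sub>0 + \<phi> t) = (E $ 1 * (E \<bullet> l t) - E $ 2 * ang_mom E (l t)) / (norm E)\<^sup>2"
        using E l[OF t] by (simp add: cos_add \<phi>_cos_sin[OF t] \<omega>\<^sub>0 field_simps power2_eq_square)
      also have "E $ 1 * (E \<bullet> l t) - E $ 2 * ang_mom E (l t) = (norm E)\<^sup>2 * (l t $ 1)"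
        unfolding n[symmetric] by (simp add: inner_real2 ang_mom_def algebra_simps power2_eq_square)
      finally show "l t $ 1 = norm (l t) * cos (\<omega>\<^sub>0 + \<phi> t)" using E by simp
      have "norm (l t) * sin (\<omega>\<^sub>0 + \<phi> t) = (E $ 2 * (E \<bullet> l t) + E $ 1 * ang_mom E (l t)) / (norm E)\<^sup>2"
        using E l[OF t] by (simp add: sin_add \<phi>_cos_sin[OF t] \<omega>\<^sub>0 field_simps power2_eq_square)
      also have "E $ 2 * (E \<bullet> l t) + E $ 1 * ang_mom E (l t) = (norm E)\<^sup>2 * (l t $ 2)"
        unfolding n[symmetric] by (simp add: inner_real2 ang_mom_def algebra_simps power2_eq_square)
      finally show "l t $ 2 = norm (l t) * sin (\<omega>\<^sub>0 + \<phi> t)" using E by simp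
    qed (simp add: \<rho> \<phi>0)
  next
    assume "lrl_angle_change T y w \<rho>"
    then obtain \<omega> where \<omega>_cont: "continuous_on {0..T} \<omega>"
      and \<omega>: "\<And>t. t \<in> {0..T} \<Longrightarrow> l t $ 1 = norm (l t) * cos (\<omega> t) \<and> l t $ 2 = norm (l t) * sin (\<omega> t)"
      and \<rho>: "\<rho> = \<omega> T - \<omega> 0"
      unfolding lrl_angle_change_def l_def by blast
    have "l 0 = E" by (simp add: l_def l0)
    with \<omega>[of 0] T have E12: "E $ 1 = norm E * cos (\<omega> 0)" "E $ 2 = norm E * sin (\<omega> 0)" by auto
    have cs: "E \<bullet> l t = norm E * norm (l t) * cos (\<omega> t - \<omega> 0)"
      "ang_mom E (l t) = norm E * norm (l t) * sin (\<omega> t - \<omega> 0)" if "t \<in> {0..T}" for t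
      using \<omega>[OF that] by (simp_all add: inner_real2 ang_mom_def E12 cos_diff sin_diff algebra_simps)
    have cos_pos: "0 < cos (\<omega> t - \<omega> 0)" if "t \<in> {0..T}" for t
      using zero_less_mult_pos[OF pos[OF that, unfolded cs(1)[OF that]]] E l[OF that] by simp
    have c: "continuous_on {0..T} (\<lambda>t. \<omega> t - \<omega> 0)" by (intro continuous_intros \<omega>_cont)
    have "\<omega> T - \<omega> 0 < pi/2"
    proof (rule ccontr)
      assume "\<not> \<omega> T - \<omega> 0 < pi/2"
      then obtain t where t: "0 \<le> t" "t \<le> T" "\<omega> t - \<omega> 0 = pi/2"
        using IVT'[of "\<lambda>t. \<omega> t - \<omega> 0" 0 "pi/2" T] T c pi_gt_zero by force
      have "cos (\<omega> t - \<omega> 0) = 0" unfolding t(3) by simp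
      then show False using cos_pos[of t] t(1,2) by simp
    qed
    moreover have "- (pi/2) < \<omega> T - \<omega> 0"
    proof (rule ccontr)
      assume "\<not> - (pi/2) < \<omega> T - \<omega> 0"
      then obtain t where t: "0 \<le> t" "t \<le> T" "\<omega> t - \<omega> 0 = - (pi/2)"
        using IVT2'[of "\<lambda>t. \<omega> t - \<omega> 0" T "- (pi/2)" 0] T c pi_gt_zero by force
      have "cos (\<omega> t - \<omega> 0) = 0" unfolding t(3) by simp
      then show False using cos_pos[of t] t(1,2) by simp
    qed
    moreover have "tan (\<omega> T - \<omega> 0) = ang_mom E (l T) / (E \<bullet> l T)"
      using E l[of T] T cs[of T] by (simp add: tan_def)
    ultimately show "\<rho> = \<phi> T"
      unfolding \<rho> \<phi>_def using arctan_unique by metis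
  qed
qed

section \<open>Geometry of Kepler orbits\<close>

text \<open>The polar equation of the orbit.\<close>

lemma lrl_inner_position: "q \<noteq> 0 \<Longrightarrow> lrl q p \<bullet> q = (ang_mom q p)\<^sup>2 - norm q"
proof -
  assume q: "q \<noteq> 0"
  have "lrl q p \<bullet> q = (norm p)\<^sup>2 * (q \<bullet> q) - (q \<bullet> p)\<^sup>2 - (1 / norm q) * (q \<bullet> q)"
    by (simp add: lrl_def inner_diff_left inner_commute[of p q] power2_eq_square)
  also have "\<dots> = (norm q)\<^sup>2 * (norm p)\<^sup>2 - (q \<bullet> p)\<^sup>2 - norm q"
    using q unfolding power2_norm_eq_inner[symmetric] by (simp add: power2_eq_square)
  finally show ?thesis using ang_mom_squared[of q p] by simp
qed

lemma ang_mom_lrl_position: "ang_mom (lrl q p) q = ang_mom q p * (q \<bullet> p)"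
  by (simp add: lrl_def ang_mom_def algebra_simps)

lemma lrl_inner_velocity: "lrl q p \<bullet> p = - (q \<bullet> p) / norm q"
  by (simp add: lrl_def inner_diff_left power2_norm_eq_inner)

lemma ang_mom_lrl_velocity: "ang_mom (lrl q p) p = ((norm p)\<^sup>2 - 1 / norm q) * ang_mom q p"
  by (simp add: lrl_def ang_mom_def algebra_simps)

lemma norm_lrl_squared:
  assumes "q \<noteq> 0"
  shows "(norm (lrl q p))\<^sup>2 = 1 + (ang_mom q p)\<^sup>2 * ((norm p)\<^sup>2 - 2 / norm q)"
proof -
  define r where "r = norm q"
  define N where "N = (norm p)\<^sup>2"
  define \<sigma> where "\<sigma> = q \<bullet> p"
  have r: "r \<noteq> 0" "q \<bullet> q = r\<^sup>2" "p \<bullet> p = N" using assms by (auto simp: r_def N_def power2_norm_eq_inner)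
  have L: "(ang_mom q p)\<^sup>2 = r\<^sup>2 * N - \<sigma>\<^sup>2"
    using ang_mom_squared[of q p] by (simp add: r_def N_def \<sigma>_def)
  have "(norm (lrl q p))\<^sup>2 = (N - 1/r)\<^sup>2 * r\<^sup>2 - 2 * (N - 1/r) * \<sigma>\<^sup>2 + \<sigma>\<^sup>2 * N"
    unfolding lrl_def power2_norm_eq_inner[of "_ - _"] r_def[symmetric] N_def[symmetric] \<sigma>_def[symmetric]
    by (simp add: inner_diff_left inner_diff_right r(2,3) inner_commute[of p q] \<sigma>_def[symmetric] power2_eq_square algebra_simps)
  also have "\<dots> = 1 + (r\<^sup>2 * N - \<sigma>\<^sup>2) * (N - 2 / r)"
    using r(1) by (simp add: power2_eq_square field_simps)
  finally show ?thesis by (simp add: L r_def N_def)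
qed

lemma real2_eqI:
  fixes E a b :: "real^2"
  assumes "E \<noteq> 0" "E \<bullet> a = E \<bullet> b" "ang_mom E a = ang_mom E b"
  shows "a = b"
proof -
  have "ang_mom E (a - b) = 0" "E \<bullet> (a - b) = 0"
    using assms(2,3) by (simp_all add: ang_mom_def inner_diff_right algebra_simps)
  with ang_mom_squared[of E "a - b"] assms(1) show ?thesis by simp
qed

text \<open>Given \<open>E\<close> and \<open>L\<close>, the distance fixes the component of the position along \<open>E\<close>, and \<open>q \<bullet> p\<close> the one
across it. The components of the velocity are then determined as well.\<close>

lemma kepler_state_eqI:
  assumes "lrl q p = lrl q' p'" "lrl q p \<noteq> 0" "ang_mom q p = ang_mom q' p'" "ang_mom q p \<noteq> 0"
    and "q \<noteq> 0" "q' \<noteq> 0" "norm q = norm q'" "q \<bullet> p = q' \<bullet> p'"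
  shows "q = q'" "p = p'"
proof -
  show "q = q'"
    by (rule real2_eqI[OF assms(2)])
      (use assms lrl_inner_position[of q p] lrl_inner_position[of q' p'] ang_mom_lrl_position[of q p]
          ang_mom_lrl_position[of q' p'] in auto)
  have "(norm p)\<^sup>2 = (norm p')\<^sup>2"
    using norm_lrl_squared[of q p] norm_lrl_squared[of q' p'] assms by simp
  then show "p = p'"
    by (intro real2_eqI[OF assms(2)])
      (use assms lrl_inner_velocity[of q p] lrl_inner_velocity[of q' p'] ang_mom_lrl_velocity[of q p]
          ang_mom_lrl_velocity[of q' p'] in auto)
qed

text \<open>The midpoint term is a combination \<open>\<alpha> q + \<beta> p\<close>, so the kick and \<open>lrl\<close> are combinations of \<open>q\<close> and \<open>p\<close> too.
Their cross product is a multiple of \<open>ang_mom q p\<close>, and most of the \<open>\<beta>\<close> terms cancel.\<close>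

lemma ang_mom_lrl_kick_midpoint_term:
  assumes "q \<noteq> 0"
  shows "ang_mom (lrl q p) (lrl_kick q p (midpoint_term q p)) = ang_mom q p *
    ((1/8 * (1 / norm q) ^ 5 * (norm p)\<^sup>2 - 1/3 * (1 / norm q) ^ 6 - 5/8 * (1 / norm q) ^ 7 * (q \<bullet> p)\<^sup>2)
       * (norm q - (ang_mom q p)\<^sup>2) + (1 / norm q) ^ 6 * (q \<bullet> p)\<^sup>2 / 2)"
proof -
  define r where "r = norm q"
  define N where "N = (norm p)\<^sup>2"
  define \<sigma> where "\<sigma> = q \<bullet> p"
  define \<alpha> where "\<alpha> = 1/8 * (1 / r) ^ 5 * N - 1/3 * (1 / r) ^ 6 - 5/8 * (1 / r) ^ 7 * \<sigma>\<^sup>2"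
  define \<beta> where "\<beta> = 1/4 * (1 / r) ^ 5 * \<sigma>"
  have r: "r \<noteq> 0" "q \<bullet> q = r\<^sup>2" "p \<bullet> p = N" using assms by (auto simp: r_def N_def power2_norm_eq_inner)
  have L: "(ang_mom q p)\<^sup>2 = r\<^sup>2 * N - \<sigma>\<^sup>2"
    using ang_mom_squared[of q p] by (simp add: r_def N_def \<sigma>_def)
  have g: "midpoint_term q p = \<alpha> *\<^sub>R q + \<beta> *\<^sub>R p"
    unfolding midpoint_term_def midpoint_poly_def \<alpha>_def \<beta>_def by (simp add: r_def N_def \<sigma>_def power2_norm_eq_inner)
  have kick: "lrl_kick q p (midpoint_term q p) = (\<alpha> * \<sigma> + 2 * \<beta> * N) *\<^sub>R q - (\<alpha> * r\<^sup>2 + 2 * \<beta> * \<sigma>) *\<^sub>R p"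
    unfolding lrl_kick_def g inner_add_right inner_scaleR_right r(2,3) inner_commute[of p q] \<sigma>_def[symmetric]
    by (simp add: algebra_simps vec_eq_iff)
  have "ang_mom (lrl q p) (lrl_kick q p (midpoint_term q p))
      = ang_mom q p * (\<sigma> * (\<alpha> * \<sigma> + 2 * \<beta> * N) - (N - 1/r) * (\<alpha> * r\<^sup>2 + 2 * \<beta> * \<sigma>))"
    unfolding kick lrl_def r_def[symmetric] N_def[symmetric] \<sigma>_def[symmetric]
    by (simp add: ang_mom_def algebra_simps)
  also have "\<sigma> * (\<alpha> * \<sigma> + 2 * \<beta> * N) - (N - 1/r) * (\<alpha> * r\<^sup>2 + 2 * \<beta> * \<sigma>)
      = \<alpha> * (r - (r\<^sup>2 * N - \<sigma>\<^sup>2)) + 2 * \<beta> * \<sigma> / r"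
    using r(1) by (simp add: field_simps power2_eq_square)
  also have "2 * \<beta> * \<sigma> / r = (1 / r) ^ 6 * \<sigma>\<^sup>2 / 2"
    using r(1) by (simp add: \<beta>_def field_simps eval_nat_numeral)
  finally show ?thesis
    unfolding L \<alpha>_def r_def N_def \<sigma>_def .
qed

text \<open>In the parametrisation by the eccentric anomaly \<open>s\<close> the distance from the focus is \<open>a - c * cos s\<close> with
\<open>c\<^sup>2 = a\<^sup>2 - b\<^sup>2\<close>, so the hypothesis is linear in \<open>cos s\<close> and \<open>sin s\<close>. The four vertices
\<open>s = 0, \<pi>, \<plusminus>\<pi>/2\<close> determine \<open>\<kappa>\<close> and the components of \<open>E\<close> along both axes.\<close>

lemma ellipse_lrl:
  assumes ell: "ellipse_focus_origin a b S"
    and S: "\<And>q. q \<in> S \<Longrightarrow> E \<bullet> q = \<kappa> - norm q"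
  shows "\<kappa> = b\<^sup>2 / a" "(norm E)\<^sup>2 = 1 - b\<^sup>2 / a\<^sup>2"
proof -
  define c where "c = sqrt (a\<^sup>2 - b\<^sup>2)"
  obtain u n where ab: "0 < b" "b \<le> a" and un: "norm u = 1" "norm n = 1" "u \<bullet> n = 0"
    and S_eq: "S = range (\<lambda>s. (a * cos s - c) *\<^sub>R u + (b * sin s) *\<^sub>R n)"
    using ell unfolding ellipse_focus_origin_def c_def by blast
  have c: "c\<^sup>2 = a\<^sup>2 - b\<^sup>2" "0 \<le> c" using ab by (auto simp: c_def power_mono)
  have ca: "c \<le> a" using c ab by (intro power2_le_imp_le[of c a]) auto
  have uu: "u \<bullet> u = 1" "n \<bullet> n = 1" using un by (simp_all add: norm_eq_1)
  have eq: "(a * cos s - c) * (E \<bullet> u) + b * sin s * (E \<bullet> n) = \<kappa> - (a - c * cos s)" for s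
  proof -
    let ?q = "(a * cos s - c) *\<^sub>R u + (b * sin s) *\<^sub>R n"
    have "(norm ?q)\<^sup>2 = (a * cos s - c)\<^sup>2 + (b * sin s)\<^sup>2"
      unfolding power2_norm_eq_inner
      by (simp add: inner_add_left inner_add_right uu un(3) inner_commute[of n u] power2_eq_square)
    also have "\<dots> = (a - c * cos s)\<^sup>2 + (a\<^sup>2 - c\<^sup>2 - b\<^sup>2) * ((cos s)\<^sup>2 - 1)"
    proof -
      have "(b * sin s)\<^sup>2 = b\<^sup>2 * (1 - (cos s)\<^sup>2)" by (simp add: power_mult_distrib sin_squared_eq)
      then show ?thesis by (simp add: power2_eq_square algebra_simps)
    qed
    finally have "(norm ?q)\<^sup>2 = (a - c * cos s)\<^sup>2" using c by simp
    moreover have "c * cos s \<le> c * 1" using c by (intro mult_left_mono) auto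
    then have "0 \<le> a - c * cos s" using ca by simp
    ultimately have "norm ?q = a - c * cos s" by (simp add: power2_eq_iff_nonneg)
    moreover have "E \<bullet> ?q = \<kappa> - norm ?q" by (rule S) (auto simp: S_eq)
    ultimately show ?thesis by (simp add: inner_add_right)
  qed
  have Eu: "E \<bullet> u = c / a"
    using eq[of 0] eq[of pi] ab by (simp add: field_simps)
  have \<kappa>: "\<kappa> = a - c * (E \<bullet> u)"
    using eq[of 0] eq[of pi] by (simp add: algebra_simps)
  have En: "E \<bullet> n = 0"
  proof -
    have "b * (E \<bullet> n) = 0" using eq[of "pi/2", simplified] eq[of "-(pi/2)", simplified] by linarith
    then show ?thesis using ab by simp
  qed
  show "\<kappa> = b\<^sup>2 / a"
    using \<kappa> Eu ab c by (simp add: field_simps power2_eq_square)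
  have "(u \<bullet> u) * (E \<bullet> n) = (u \<bullet> E) * (u \<bullet> n) + ang_mom u E * ang_mom u n"
    unfolding inner_real2 ang_mom_def by algebra
  then have "ang_mom u E * ang_mom u n = 0" using un(3) En by simp
  moreover have "(ang_mom u n)\<^sup>2 = 1" using ang_mom_squared[of u n] un by simp
  ultimately have "ang_mom u E = 0" by auto
  then have "(norm E)\<^sup>2 = (c / a)\<^sup>2" using ang_mom_squared[of u E] un Eu by (simp add: inner_commute)
  then show "(norm E)\<^sup>2 = 1 - b\<^sup>2 / a\<^sup>2" using c ab by (simp add: power_divide field_simps)
qed

section \<open>The drift of the Laplace--Runge--Lenz vector over one period\<close>

text \<open>The functions \<open>C = L\<^sup>2 / \<bar>x\<bar> - 1\<close> and \<open>S = L (x \<bullet> v) / \<bar>x\<bar>\<close> satisfy \<open>C' = - S \<phi>\<close> and \<open>S' = C \<phi>\<close> with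
\<open>\<phi> = L / \<bar>x\<bar>\<^sup>2\<close>, so \<open>(C, S)\<close> rotates with angular velocity \<open>\<phi>\<close> on the circle of radius \<open>e\<close>. The anomaly
\<open>u\<close> is therefore obtained as a primitive of \<open>\<phi>\<close>, without lifting the curve to an angle.\<close>

lemma kepler_true_anomaly:
  assumes sol: "kepler_solution x v" and T: "0 \<le> T"
    and L: "L = ang_mom (x 0) (v 0)" and e: "e = norm (lrl (x 0) (v 0))" "0 < e"
  shows "\<exists>u. \<forall>t\<in>{0..T}. (u has_real_derivative L * (1 / norm (x t))\<^sup>2) (at t within {0..T}) \<and>
    e * cos (u t) = L\<^sup>2 * (1 / norm (x t)) - 1 \<and> e * sin (u t) = L * (x t \<bullet> v t) * (1 / norm (x t))"
proof -
  define \<phi> where "\<phi> t = L * (1 / norm (x t))\<^sup>2" for t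
  define C where "C t = L\<^sup>2 * (1 / norm (x t)) - 1" for t
  define S where "S t = L * (x t \<bullet> v t) * (1 / norm (x t))" for t
  have nz: "x t \<noteq> 0" for t by (rule kepler_solutionD(1)[OF sol])
  have Lt: "ang_mom (x t) (v t) = L" for t unfolding L by (rule kepler_ang_mom_constant[OF sol])
  have L2: "L\<^sup>2 = (norm (x t))\<^sup>2 * (norm (v t))\<^sup>2 - (x t \<bullet> v t)\<^sup>2" for t
    using ang_mom_squared[of "x t" "v t"] by (simp add: Lt)
  have CS: "(C 0 / e)\<^sup>2 + (S 0 / e)\<^sup>2 = 1"
  proof -
    have "(C 0)\<^sup>2 + (S 0)\<^sup>2 = 1 - 2 * L\<^sup>2 / norm (x 0) + L\<^sup>2 * ((L\<^sup>2 + (x 0 \<bullet> v 0)\<^sup>2) / (norm (x 0))\<^sup>2)"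
      using nz[of 0] by (simp add: C_def S_def field_simps power2_eq_square)
    also have "L\<^sup>2 + (x 0 \<bullet> v 0)\<^sup>2 = (norm (x 0))\<^sup>2 * (norm (v 0))\<^sup>2" using L2[of 0] by simp
    finally have "(C 0)\<^sup>2 + (S 0)\<^sup>2 = e\<^sup>2"
      using nz[of 0] norm_lrl_squared[OF nz, of 0 "v 0"] by (simp add: e(1) Lt algebra_simps)
    then show ?thesis using e(2) by (simp add: power_divide flip: add_divide_distrib)
  qed
  obtain u0 where u0: "C 0 / e = cos u0" "S 0 / e = sin u0"
    using sincos_total_2pi[OF CS] by metis
  define u where "u t = u0 + integral {0..t} \<phi>" for t
  have \<phi>_cont: "continuous_on {0..T} \<phi>"
    unfolding \<phi>_def by (intro continuous_intros kepler_solution_continuous[OF sol]) (simp add: nz)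
  have u: "(u has_real_derivative \<phi> t) (at t within {0..T})" if "t \<in> {0..T}" for t
    unfolding u_def using integral_has_vector_derivative[OF \<phi>_cont that]
    by (auto intro!: derivative_eq_intros simp flip: has_real_derivative_iff_has_vector_derivative)
  have s: "((\<lambda>t. 1 / norm (x t)) has_real_derivative - ((1 / norm (x t)) ^ 3 * (x t \<bullet> v t))) (at t within {0..T})" for t
    by (rule has_real_derivative_inverse_norm_curve[OF kepler_solutionD(2)[OF sol] nz])
  have \<sigma>: "((\<lambda>t. x t \<bullet> v t) has_real_derivative x t \<bullet> kepler_force (x t) + v t \<bullet> v t) (at t within {0..T})" for t
    by (rule has_real_derivative_inner_curve[OF kepler_solutionD(2,3)[OF sol]])
  have C: "(C has_real_derivative - S t * \<phi> t) (at t within {0..T})" for t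
    unfolding C_def S_def \<phi>_def
    by (rule derivative_eq_intros s refl)+ (simp add: eval_nat_numeral)
  have S: "(S has_real_derivative C t * \<phi> t) (at t within {0..T})" for t
  proof -
    define r where "r = norm (x t)"
    have r: "r \<noteq> 0" using nz by (simp add: r_def)
    have "(S has_real_derivative L * (x t \<bullet> kepler_force (x t) + v t \<bullet> v t) * (1 / r)
        + - ((1 / r) ^ 3 * (x t \<bullet> v t)) * (L * (x t \<bullet> v t))) (at t within {0..T})"
      unfolding S_def r_def by (rule derivative_eq_intros s \<sigma> refl)+ simp
    moreover have "x t \<bullet> kepler_force (x t) = - 1 / r"
      using r by (simp add: kepler_force_def r_def power2_norm_eq_inner[symmetric] eval_nat_numeral)
    moreover have "L * (- 1 / r + v t \<bullet> v t) * (1 / r) + - ((1 / r) ^ 3 * (x t \<bullet> v t)) * (L * (x t \<bullet> v t)) = C t * \<phi> t"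
      unfolding C_def \<phi>_def L2[of t] r_def[symmetric] power2_norm_eq_inner[of "v t"]
      using r by (simp add: field_simps eval_nat_numeral)
    ultimately show ?thesis by simp
  qed
  \<comment> \<open>In the frame that rotates with \<open>u\<close> the point \<open>(C, S)\<close> is at rest.\<close>
  have rotated: "((\<lambda>t. C t * cos (u t) + S t * sin (u t)) has_real_derivative 0) (at t within {0..T})"
    "((\<lambda>t. S t * cos (u t) - C t * sin (u t)) has_real_derivative 0) (at t within {0..T})"
    if "t \<in> {0..T}" for t
    by (rule derivative_eq_intros C S u that refl | simp add: algebra_simps)+
  have CS0: "C 0 = e * cos (u 0)" "S 0 = e * sin (u 0)"
    using u0 e(2) by (simp_all add: u_def field_simps)
  have "e * cos (u 0) * cos (u 0) + e * sin (u 0) * sin (u 0) = e"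
    by (simp add: mult.assoc flip: distrib_left power2_eq_square)
  then have const: "C t * cos (u t) + S t * sin (u t) = e" "S t * cos (u t) - C t * sin (u t) = 0"
    if "t \<in> {0..T}" for t
    using zero_derivative_imp_eq_initial[OF rotated(1) that] zero_derivative_imp_eq_initial[OF rotated(2) that]
    unfolding CS0 by (simp_all add: mult_ac)
  have "e * cos (u t) = C t" "e * sin (u t) = S t" if t: "t \<in> {0..T}" for t
  proof -
    have 1: "cos (u t) * cos (u t) + sin (u t) * sin (u t) = 1"
      using sin_cos_squared_add[of "u t"] by (simp add: power2_eq_square)
    have "C t = (C t * cos (u t) + S t * sin (u t)) * cos (u t) - (S t * cos (u t) - C t * sin (u t)) * sin (u t)"
      "S t = (C t * cos (u t) + S t * sin (u t)) * sin (u t) + (S t * cos (u t) - C t * sin (u t)) * cos (u t)"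
      using 1 by algebra+
    then show "e * cos (u t) = C t" "e * sin (u t) = S t" unfolding const[OF t] by simp_all
  qed
  then show ?thesis
    using u by (intro exI[of _ u]) (simp add: C_def S_def \<phi>_def)
qed

lemma kepler_solution_shift:
  assumes "kepler_solution x v"
  shows "kepler_solution (\<lambda>t. x (t + s)) (\<lambda>t. v (t + s))"
proof -
  have shift: "((\<lambda>t. f (t + s)) has_vector_derivative f') (at t)"
    if "(f has_vector_derivative f') (at (t + s))" for f :: "real \<Rightarrow> real^2" and f' t
  proof -
    have "((\<lambda>t. t + s) has_vector_derivative 1) (at t)"
      by (auto intro!: derivative_eq_intros simp flip: has_real_derivative_iff_has_vector_derivative)
    from vector_diff_chain_at[OF this that] show ?thesis by (simp add: o_def)
  qed
  show ?thesis
    unfolding kepler_solution_def solves_within_def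
    using kepler_solutionD[OF assms] by (fastforce intro: shift)
qed

lemma kepler_periodic_velocity:
  assumes sol: "kepler_solution x v" and per: "\<And>t. x (t + T) = x t"
  shows "v (t + T) = v t"
proof -
  have "((\<lambda>t. x (t + T)) has_vector_derivative v (t + T)) (at t)"
    by (rule kepler_solutionD(2)[OF kepler_solution_shift[OF sol]])
  then show ?thesis
    using kepler_solutionD(2)[OF sol, of t UNIV] per by (simp add: vector_derivative_unique_at)
qed

text \<open>Uniqueness gives \<open>x (t + s) = x t\<close> forward in time, and the known period \<open>T\<close> carries this over to negative times.\<close>

lemma kepler_return_imp_period:
  assumes sol: "kepler_solution x v" and per: "\<And>t. x (t + T) = x t" "0 < T"
    and s: "x s = x 0" "v s = v 0"
  shows "x (t + s) = x t"
proof -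
  have nper: "x (t + real n * T) = x t" for n t
  proof (induction n)
    case (Suc n)
    have "x (t + real (Suc n) * T) = x ((t + real n * T) + T)" by (simp add: algebra_simps)
    then show ?case by (simp only: per Suc)
  qed simp
  obtain n :: nat where "- t / T \<le> real n" using real_arch_simple by blast
  then have n: "0 \<le> t + real n * T" using per(2) by (simp add: field_simps)
  have "x (t + s) = x ((t + real n * T) + s)" using nper[of "t + s" n] by (simp add: algebra_simps)
  also have "\<dots> = x (t + real n * T)"
    by (rule kepler_solution_unique[OF sol kepler_solution_shift[OF sol] _ _ n]) (simp_all add: s)
  finally show ?thesis by (simp add: nper)
qed

text \<open>After a period \<open>cos u\<close> and \<open>sin u\<close> return to their initial values and \<open>u\<close> has moved monotonically, so it has made
\<open>m \<ge> 1\<close> full turns. If \<open>m \<ge> 2\<close>, there is an earlier time at which \<open>u\<close> has made exactly one turn.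
The anomaly determines the state, so this would be a smaller period.\<close>

lemma true_anomaly_period:
  assumes sol: "kepler_solution x v" and per: "minimal_period x T"
    and L: "L = ang_mom (x 0) (v 0)" "L \<noteq> 0" and e: "e = norm (lrl (x 0) (v 0))" "0 < e"
    and u: "\<And>t. t \<in> {0..T} \<Longrightarrow> (u has_real_derivative L * (1 / norm (x t))\<^sup>2) (at t within {0..T}) \<and>
      e * cos (u t) = L\<^sup>2 * (1 / norm (x t)) - 1 \<and> e * sin (u t) = L * (x t \<bullet> v t) * (1 / norm (x t))"
  shows "u T - u 0 = 2 * pi * sgn L" "cos (u T) = cos (u 0)" "sin (u T) = sin (u 0)"
proof -
  have T: "0 < T" and xT: "\<And>t. x (t + T) = x t"
    and minimal: "\<And>s. 0 < s \<Longrightarrow> s < T \<Longrightarrow> \<exists>t. x (t + s) \<noteq> x t"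
    using per unfolding minimal_period_def by blast+
  have nz: "x t \<noteq> 0" for t by (rule kepler_solutionD(1)[OF sol])
  have "x T = x 0" "v T = v 0" using xT[of 0] kepler_periodic_velocity[OF sol xT, of 0] by simp_all
  then have cs: "e * cos (u T) = e * cos (u 0)" "e * sin (u T) = e * sin (u 0)"
    using u[of T] u[of 0] T by simp_all
  then show cos_sin: "cos (u T) = cos (u 0)" "sin (u T) = sin (u 0)" using e by simp_all
  then obtain k :: int where k: "u T = u 0 + 2 * pi * k" using sin_cos_eq_iff[of "u T" "u 0"] by auto
  define U where "U t = sgn L * (u t - u 0)" for t
  have U': "(U has_real_derivative \<bar>L\<bar> * (1 / norm (x t))\<^sup>2) (at t within {0..T})" if t: "t \<in> {0..T}" for t
    unfolding U_def using u[OF t] by (auto intro!: derivative_eq_intros simp: abs_sgn mult_ac)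
  then have U_cont: "continuous_on {0..T} U" by (rule DERIV_continuous_on)
  have "U 0 < U T"
  proof (rule DERIV_pos_imp_increasing_open[OF T _ U_cont])
    fix t assume t: "0 < t" "t < T"
    then have "(U has_real_derivative \<bar>L\<bar> * (1 / norm (x t))\<^sup>2) (at t)"
      using U'[of t] by (simp add: at_within_Icc_at)
    moreover have "0 < \<bar>L\<bar> * (1 / norm (x t))\<^sup>2" using L nz[of t] by simp
    ultimately show "\<exists>y. (U has_real_derivative y) (at t) \<and> 0 < y" by blast
  qed
  define m where "m = (if L > 0 then k else - k)"
  have UT: "U T = 2 * pi * real_of_int m" using L(2) k by (auto simp: U_def m_def sgn_if)
  have "0 < real_of_int m" 
  proof (rule zero_less_mult_pos)
    show "0 < 2 * pi * real_of_int m" using \<open>U 0 < U T\<close> UT by (simp add: U_def)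
  qed (use pi_gt_zero in simp)
  moreover have "m < 2"
  proof (rule ccontr)
    assume "\<not> m < 2"
    then have "2 * pi * 2 \<le> U T" unfolding UT by (intro mult_left_mono) auto
    moreover have "U 0 = 0" by (simp add: U_def)
    ultimately have "U 0 \<le> 2 * pi" "2 * pi \<le> U T" "2 * pi < U T" using pi_gt_zero by linarith+
    then obtain s where s: "0 \<le> s" "s \<le> T" "U s = 2 * pi"
      using IVT'[of U 0 "2 * pi" T] U_cont T by auto
    have "s \<noteq> 0" "s \<noteq> T" using s(3) \<open>2 * pi < U T\<close> by (auto simp: U_def)
    with s have sT: "0 < s" "s < T" by auto
    have "u s - u 0 = sgn L * (2 * pi)"
      using s(3) L(2) by (auto simp: U_def sgn_if split: if_splits)
    then have us: "u s = u 0 + sgn L * (2 * pi)" by simp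
    have "cos (u s) = cos (u 0)" "sin (u s) = sin (u 0)"
      unfolding us using L(2) by (auto simp: sgn_if cos_add sin_add)
    then have eqs: "L\<^sup>2 * (1 / norm (x s)) = L\<^sup>2 * (1 / norm (x 0))"
      "L * (x s \<bullet> v s) * (1 / norm (x s)) = L * (x 0 \<bullet> v 0) * (1 / norm (x 0))"
      using u[of s] u[of 0] sT by auto
    have n: "norm (x s) = norm (x 0)" using eqs(1) L(2) by simp
    have \<sigma>: "x s \<bullet> v s = x 0 \<bullet> v 0" using eqs(2) L(2) nz[of 0] unfolding n by simp
    have "x s = x 0" "v s = v 0"
      using kepler_state_eqI[of "x s" "v s" "x 0" "v 0"] kepler_lrl_constant[OF sol, of s]
        kepler_ang_mom_constant[OF sol, of s] e L nz n \<sigma> by auto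
    then have "\<And>t. x (t + s) = x t" by (rule kepler_return_imp_period[OF sol xT T])
    then show False using minimal[OF sT] by blast
  qed
  ultimately have "m = 1" by simp
  then show "u T - u 0 = 2 * pi * sgn L"
    using k L(2) by (auto simp: m_def sgn_if split: if_splits)
qed

text \<open>A primitive of \<open>cos u ^ k\<close>, by the usual reduction formula. It is the sum of a \<open>2 \<pi>\<close>-periodic
function and of \<open>cos_power_mean k * u\<close>.\<close>

fun cos_power_primitive :: "nat \<Rightarrow> real \<Rightarrow> real" where
  "cos_power_primitive 0 u = u"
| "cos_power_primitive (Suc 0) u = sin u"
| "cos_power_primitive (Suc (Suc k)) u =
     (cos u ^ Suc k * sin u + real (Suc k) * cos_power_primitive k u) / real (Suc (Suc k))"

lemma cos_power_primitive_derivative: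
  "(cos_power_primitive k has_real_derivative cos u ^ k) (at u within S)"
proof (induction k u rule: cos_power_primitive.induct)
  case (3 k u)
  have "((\<lambda>u. (cos u ^ Suc k * sin u + real (Suc k) * cos_power_primitive k u) / real (Suc (Suc k)))
    has_real_derivative (real (Suc k) * (- sin u * cos u ^ k) * sin u + cos u * cos u ^ Suc k
      + real (Suc k) * cos u ^ k) / real (Suc (Suc k))) (at u within S)"
    by (rule derivative_eq_intros 3 refl | simp)+
  also have "real (Suc k) * (- sin u * cos u ^ k) * sin u + cos u * cos u ^ Suc k + real (Suc k) * cos u ^ k
      = real (Suc k) * cos u ^ k * (1 - (sin u)\<^sup>2) + cos u ^ Suc (Suc k)"
    by (simp add: algebra_simps power2_eq_square)
  also have "\<dots> = real (Suc (Suc k)) * cos u ^ Suc (Suc k)"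
    unfolding cos_squared_eq[symmetric] by (simp add: power2_eq_square algebra_simps)
  finally show ?case by (simp add: fun_eq_iff[symmetric] del: power_Suc)
qed (auto intro!: derivative_eq_intros)

fun cos_power_mean :: "nat \<Rightarrow> real" where
  "cos_power_mean 0 = 1"
| "cos_power_mean (Suc 0) = 0"
| "cos_power_mean (Suc (Suc k)) = real (Suc k) / real (Suc (Suc k)) * cos_power_mean k"

lemma cos_power_primitive_period:
  assumes "cos u' = cos u" "sin u' = sin u"
  shows "cos_power_primitive k u' - cos_power_primitive k u = cos_power_mean k * (u' - u)"
proof (induction k rule: cos_power_mean.induct)
  case (3 k)
  have "cos_power_primitive (Suc (Suc k)) u' - cos_power_primitive (Suc (Suc k)) u
      = real (Suc k) * (cos_power_primitive k u' - cos_power_primitive k u) / real (Suc (Suc k))"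
    by (simp add: assms diff_divide_distrib[symmetric] right_diff_distrib del: of_nat_Suc)
  then show ?case unfolding 3 by simp
qed (simp_all add: assms)

text \<open>The coefficients of \<open>cos u ^ k\<close> in \<open>L\<^sup>6\<close> times the derivative of the drift with respect to the true
anomaly \<open>u\<close>, for an orbit of eccentricity \<open>e\<close>.\<close>

definition drift_coeff :: "real \<Rightarrow> nat \<Rightarrow> real" where
  "drift_coeff e k = [e\<^sup>2/2, 5/24 * e + 3/2 * e^3, 3/2 * e^4, - 5/4 * e^3 + e^5/2, - 5/3 * e^4, - 5/8 * e^5] ! k"

text \<open>With \<open>s = 1 / r\<close>, \<open>\<sigma> = q \<bullet> p\<close> and \<open>N = \<bar>p\<bar>\<^sup>2\<close> the left-hand side is the time derivative of the drift
(\<open>ang_mom_lrl_kick_midpoint_term\<close>), and \<open>L * s\<^sup>2\<close> is that of \<open>u\<close>. The hypotheses express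
\<open>s\<close>, \<open>N\<close> and \<open>s\<^sup>2 \<sigma>\<^sup>2\<close>, each multiplied by \<open>L\<^sup>2\<close>, as polynomials in \<open>e\<close> and \<open>c\<close>, where \<open>c\<close> and \<open>n\<close> stand for \<open>cos u\<close> and \<open>sin u\<close>.\<close>

lemma drift_in_true_anomaly:
  fixes L s r \<sigma> N e c n :: real
  assumes r: "r * s = 1" and L: "L \<noteq> 0"
    and c: "e * c = L\<^sup>2 * s - 1" and n: "e * n = L * \<sigma> * s" and cn: "n\<^sup>2 + c\<^sup>2 = 1"
    and e: "e\<^sup>2 = 1 + L\<^sup>2 * (N - 2 * s)"
  shows "L * ((1/8 * s ^ 5 * N - 1/3 * s ^ 6 - 5/8 * s ^ 7 * \<sigma>\<^sup>2) * (r - L\<^sup>2) + s ^ 6 * \<sigma>\<^sup>2 / 2)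
    = (\<Sum>k<6. drift_coeff e k * c ^ k) / L ^ 6 * (L * s\<^sup>2)"
proof -
  define \<kappa> where "\<kappa> = L\<^sup>2"
  define W where "W = s\<^sup>2 * \<sigma>\<^sup>2"
  define D where "D = 1 + e * c"
  have \<kappa>: "\<kappa> \<noteq> 0" using L by (simp add: \<kappa>_def)
  have "s * r = 1" using r by (simp add: mult.commute)
  have D: "\<kappa> * s = D" using c by (simp add: D_def \<kappa>_def)
  have N: "\<kappa> * N = 2 * D - (1 - e\<^sup>2)" using e D by (simp add: \<kappa>_def[symmetric] algebra_simps)
  have "(e * n)\<^sup>2 = (L * \<sigma> * s)\<^sup>2" by (simp only: n)
  then have "\<kappa> * W = e\<^sup>2 * n\<^sup>2" by (simp add: W_def \<kappa>_def power_mult_distrib mult_ac)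
  also have "n\<^sup>2 = 1 - c\<^sup>2" using cn by simp
  finally have W: "\<kappa> * W = e\<^sup>2 * (1 - c\<^sup>2)" .
  define I where "I = - (e * c) * (s\<^sup>2 * N / 8 - s^3 / 3 - 5/8 * s\<^sup>2 * W) + s\<^sup>2 * W / 2"
  have "\<kappa>^3 * I = - (e * c) * ((\<kappa> * s)\<^sup>2 * (\<kappa> * N) / 8 - (\<kappa> * s)^3 / 3 - 5/8 * (\<kappa> * s)\<^sup>2 * (\<kappa> * W)) + (\<kappa> * s)\<^sup>2 * (\<kappa> * W) / 2"
    by (simp add: I_def eval_nat_numeral algebra_simps)
  also have "\<dots> = (\<Sum>k<6. drift_coeff e k * c ^ k)"
    unfolding D N W unfolding D_def
    by (simp add: drift_coeff_def eval_nat_numeral lessThan_Suc field_simps)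
  finally have I: "I = (\<Sum>k<6. drift_coeff e k * c ^ k) / \<kappa>^3" using \<kappa> by (simp add: field_simps)
  have "(1/8 * s ^ 5 * N - 1/3 * s ^ 6 - 5/8 * s ^ 7 * \<sigma>\<^sup>2) * (r - \<kappa>)
      = s\<^sup>2 * (s\<^sup>2 * N / 8 - s^3 / 3 - 5/8 * s\<^sup>2 * W) * (s * r - \<kappa> * s)"
    by (simp add: W_def eval_nat_numeral algebra_simps)
  also have "s * r - \<kappa> * s = - (e * c)" unfolding D \<open>s * r = 1\<close> by (simp add: D_def)
  finally have "(1/8 * s ^ 5 * N - 1/3 * s ^ 6 - 5/8 * s ^ 7 * \<sigma>\<^sup>2) * (r - \<kappa>) + s ^ 6 * \<sigma>\<^sup>2 / 2 = s\<^sup>2 * I"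
    by (simp add: I_def W_def eval_nat_numeral algebra_simps)
  then show ?thesis by (simp add: I \<kappa>_def power_mult[symmetric] mult_ac)
qed

lemma kepler_drift_primitive:
  assumes sol: "kepler_solution x v" and per: "minimal_period x T"
    and L: "L = ang_mom (x 0) (v 0)" "L \<noteq> 0" and E: "E = lrl (x 0) (v 0)" "E \<noteq> 0"
  shows "\<exists>J. (\<forall>t\<in>{0..T}. (J has_real_derivative
      ang_mom E (lrl_kick (x t) (v t) (midpoint_term (x t) (v t)))) (at t within {0..T})) \<and>
    J T - J 0 = sgn L * (pi * (norm E)\<^sup>2 * (1 + (norm E)\<^sup>2 / 4) / L ^ 6)"
proof -
  have T: "0 < T" using per by (simp add: minimal_period_def)
  define e where "e = norm E"
  have e: "e = norm (lrl (x 0) (v 0))" "0 < e" using E by (simp_all add: e_def)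
  obtain u where u: "\<And>t. t \<in> {0..T} \<Longrightarrow> (u has_real_derivative L * (1 / norm (x t))\<^sup>2) (at t within {0..T}) \<and>
      e * cos (u t) = L\<^sup>2 * (1 / norm (x t)) - 1 \<and> e * sin (u t) = L * (x t \<bullet> v t) * (1 / norm (x t))"
    using kepler_true_anomaly[OF sol less_imp_le[OF T] L(1) e] by blast
  define J where "J t = (\<Sum>k<6. drift_coeff e k * cos_power_primitive k (u t)) / L ^ 6" for t
  show ?thesis
  proof (intro exI[of _ J] conjI ballI)
    fix t assume t: "t \<in> {0..T}"
    have nz: "x t \<noteq> 0" by (rule kepler_solutionD(1)[OF sol])
    have "ang_mom E (lrl_kick (x t) (v t) (midpoint_term (x t) (v t)))
        = (\<Sum>k<6. drift_coeff e k * cos (u t) ^ k) / L ^ 6 * (L * (1 / norm (x t))\<^sup>2)"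
    proof -
      have "E = lrl (x t) (v t)" "L = ang_mom (x t) (v t)"
        unfolding E L by (simp_all only: kepler_lrl_constant[OF sol, of t] kepler_ang_mom_constant[OF sol, of t])
      note Et = this
      show ?thesis
        unfolding Et(1) ang_mom_lrl_kick_midpoint_term[OF nz] Et(2)[symmetric]
        by (rule drift_in_true_anomaly[where n = "sin (u t)"])
          (use u[OF t] nz L norm_lrl_squared[OF nz, of "v t"] in \<open>auto simp: e_def Et(1)[symmetric] Et(2)[symmetric]\<close>)
    qed
    moreover have "((\<lambda>t. cos_power_primitive k (u t)) has_real_derivative cos (u t) ^ k * (L * (1 / norm (x t))\<^sup>2)) (at t within {0..T})" for k
      by (rule DERIV_chain2[OF cos_power_primitive_derivative]) (use u[OF t] in blast)
    then have "(J has_real_derivative (\<Sum>k<6. drift_coeff e k * (cos (u t) ^ k * (L * (1 / norm (x t))\<^sup>2))) / L ^ 6) (at t within {0..T})"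
      unfolding J_def by (intro DERIV_cdivide DERIV_sum DERIV_cmult)
    ultimately show "(J has_real_derivative ang_mom E (lrl_kick (x t) (v t) (midpoint_term (x t) (v t)))) (at t within {0..T})"
      by (simp add: sum_distrib_right sum_divide_distrib mult.assoc)
  next
    have period: "u T - u 0 = 2 * pi * sgn L" "cos (u T) = cos (u 0)" "sin (u T) = sin (u 0)"
      using true_anomaly_period[OF sol per L e, of u] u by blast+
    have "J T - J 0 = (\<Sum>k<6. drift_coeff e k * (cos_power_primitive k (u T) - cos_power_primitive k (u 0))) / L ^ 6"
      by (simp only: J_def diff_divide_distrib[symmetric] sum_subtractf[symmetric] right_diff_distrib)
    also have "\<dots> = (\<Sum>k<6. drift_coeff e k * cos_power_mean k) * (u T - u 0) / L ^ 6"
      unfolding cos_power_primitive_period[OF period(2,3)] by (simp only: sum_distrib_right mult.assoc)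
    also have "(\<Sum>k<6. drift_coeff e k * cos_power_mean k) = e\<^sup>2/2 + e^4/8"
      by (simp add: eval_nat_numeral lessThan_Suc drift_coeff_def)
    finally have "J T - J 0 = (e\<^sup>2/2 + e^4/8) * (u T - u 0) / L ^ 6" .
    then show "J T - J 0 = sgn L * (pi * (norm E)\<^sup>2 * (1 + (norm E)\<^sup>2 / 4) / L ^ 6)"
      unfolding period(1) e_def using L(2) by (simp add: field_simps eval_nat_numeral)
  qed
qed

section \<open>The numerical precession rate\<close>

text \<open>The modified term is determined away from collisions, where the solutions live, so it may be
replaced by \<open>midpoint_term\<close>.\<close>

lemma midpoint_precession_rate_iff:
  "midpoint_precession_rate q\<^sub>0 p\<^sub>0 T K h \<rho> \<longleftrightarrow>
    (\<exists>y w. solves_within (K * h ^ 4) (truncated_rhs midpoint_term h) {0..T} y w \<and>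
       y 0 = q\<^sub>0 \<and> w 0 = p\<^sub>0 \<and> lrl_angle_change T y w \<rho>)"
proof -
  have "solves_within \<epsilon> (truncated_rhs g h) S y w = solves_within \<epsilon> (truncated_rhs midpoint_term h) S y w"
    if "midpoint_modified_term g" for g \<epsilon> S y w
    unfolding solves_within_def truncated_rhs_def using midpoint_modified_term_unique[OF that] by metis
  then show ?thesis
    unfolding midpoint_precession_rate_def using midpoint_modified_term_midpoint_term by blast
qed

text \<open>The argument of the arctangent is \<open>O(h\<^sup>2)\<close>, so replacing the arctangent by its argument costs \<open>O(h\<^sup>4)\<close>, as does the
\<open>O(h\<^sup>2)\<close> error in the denominator.\<close>

lemma angle_expansion:
  assumes e: "0 < e" and C: "0 < C"
  shows "\<exists>C'. \<forall>\<^sub>F h in at_right (0::real). \<forall>A B. \<bar>A - h\<^sup>2 * \<Lambda>\<bar> \<le> C * h ^ 4 \<and> \<bar>B - e\<bar> \<le> C * h\<^sup>2 \<longrightarrow>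
    \<bar>arctan (A / B) - \<Lambda> / e * h\<^sup>2\<bar> \<le> C' * h ^ 4"
proof -
  define M where "M = 2 / e * (C + \<bar>\<Lambda>\<bar>)"
  define C' where "C' = M\<^sup>2 + 2 / e * (C + \<bar>\<Lambda>\<bar> / e * C)"
  show ?thesis
  proof (rule exI[of _ C'], use eventually_at_right_0_small[OF half_gt_zero[OF e], of C] in eventually_elim, intro allI impI)
    fix h A B :: real
    assume "0 < h \<and> h \<le> 1 \<and> C * h\<^sup>2 \<le> e / 2" and AB: "\<bar>A - h\<^sup>2 * \<Lambda>\<bar> \<le> C * h ^ 4 \<and> \<bar>B - e\<bar> \<le> C * h\<^sup>2"
    then have h: "0 < h" "h \<le> 1" "C * h\<^sup>2 \<le> e / 2" and A: "\<bar>A - h\<^sup>2 * \<Lambda>\<bar> \<le> C * h ^ 4" and B: "\<bar>B - e\<bar> \<le> C * h\<^sup>2"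
      by auto
    have Be: "e / 2 \<le> B" using B h(3) by linarith
    then have B0: "0 < B" using e by linarith
    have inv: "1 / B \<le> 2 / e" using Be e B0 by (simp add: field_simps)
    have h4: "h ^ 4 \<le> h\<^sup>2" using h by (intro power_decreasing) auto
    have "\<bar>h\<^sup>2 * \<Lambda>\<bar> = h\<^sup>2 * \<bar>\<Lambda>\<bar>" by (simp add: abs_mult)
    then have "\<bar>A\<bar> \<le> C * h ^ 4 + h\<^sup>2 * \<bar>\<Lambda>\<bar>" using A by linarith
    also have "\<dots> \<le> C * h\<^sup>2 + h\<^sup>2 * \<bar>\<Lambda>\<bar>" using h4 C by simp
    finally have A': "\<bar>A\<bar> \<le> (C + \<bar>\<Lambda>\<bar>) * h\<^sup>2" by (simp add: algebra_simps)
    have "\<bar>A / B\<bar> = (1 / B) * \<bar>A\<bar>" using B0 by (simp add: abs_divide)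
    also have "\<dots> \<le> (2 / e) * ((C + \<bar>\<Lambda>\<bar>) * h\<^sup>2)" using inv A' e by (intro mult_mono) auto
    finally have q: "\<bar>A / B\<bar> \<le> M * h\<^sup>2" by (simp only: M_def mult.assoc)
    have "\<bar>arctan (A / B) - A / B\<bar> \<le> \<bar>A / B\<bar>\<^sup>2" using abs_arctan_minus_le[of "A / B"] by (simp only: power2_abs)
    also have "\<dots> \<le> (M * h\<^sup>2)\<^sup>2" using q by (intro power_mono) auto
    finally have 1: "\<bar>arctan (A / B) - A / B\<bar> \<le> M\<^sup>2 * h ^ 4" by (simp add: power_mult_distrib flip: power_mult)
    have "A / B - \<Lambda> / e * h\<^sup>2 = (1 / B) * ((A - h\<^sup>2 * \<Lambda>) - \<Lambda> / e * h\<^sup>2 * (B - e))"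
      using B0 e by (simp add: field_simps)
    also have "\<bar>\<dots>\<bar> \<le> (2 / e) * (C * h ^ 4 + \<bar>\<Lambda>\<bar> / e * h\<^sup>2 * (C * h\<^sup>2))"
      unfolding abs_mult
    proof (rule mult_mono)
      show "\<bar>1 / B\<bar> \<le> 2 / e" using inv B0 by simp
      have "\<bar>\<Lambda> / e * h\<^sup>2 * (B - e)\<bar> \<le> \<bar>\<Lambda>\<bar> / e * h\<^sup>2 * (C * h\<^sup>2)"
      proof -
        have "\<bar>\<Lambda> / e * h\<^sup>2 * (B - e)\<bar> = \<bar>\<Lambda>\<bar> / e * h\<^sup>2 * \<bar>B - e\<bar>"
          using e by (simp add: abs_mult abs_divide)
        also have "\<dots> \<le> \<bar>\<Lambda>\<bar> / e * h\<^sup>2 * (C * h\<^sup>2)"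
          by (rule mult_left_mono[OF B]) (use e in simp)
        finally show ?thesis .
      qed
      then show "\<bar>(A - h\<^sup>2 * \<Lambda>) - \<Lambda> / e * h\<^sup>2 * (B - e)\<bar> \<le> C * h ^ 4 + \<bar>\<Lambda>\<bar> / e * h\<^sup>2 * (C * h\<^sup>2)"
        using A by linarith
    qed (use e in auto)
    finally have "\<bar>A / B - \<Lambda> / e * h\<^sup>2\<bar> \<le> (2 / e * (C + \<bar>\<Lambda>\<bar> / e * C)) * h ^ 4"
      by (simp add: algebra_simps eval_nat_numeral)
    with 1 show "\<bar>arctan (A / B) - \<Lambda> / e * h\<^sup>2\<bar> \<le> C' * h ^ 4"
      unfolding C'_def distrib_right by linarith
  qed
qed

text \<open>The rate is the arctangent of a quotient with numerator \<open>h\<^sup>2 * (J T - J 0) + O(h\<^sup>4)\<close>, the cross product of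
\<open>E\<close> with the final vector, and denominator \<open>(norm E)\<^sup>2 + O(h\<^sup>2)\<close>. Existence of a rate only needs an exact solution of the truncated
equation, since it has defect zero.\<close>

lemma midpoint_precession_expansion:
  assumes sol: "kepler_solution x v" and T: "0 \<le> T" and K: "0 \<le> K"
    and E: "E = lrl (x 0) (v 0)" "E \<noteq> 0"
    and J: "\<And>t. t \<in> {0..T} \<Longrightarrow> (J has_real_derivative
      ang_mom E (lrl_kick (x t) (v t) (midpoint_term (x t) (v t)))) (at t within {0..T})"
  shows "\<exists>C. \<forall>\<^sub>F h in at_right 0.
    (\<exists>\<rho>. midpoint_precession_rate (x 0) (v 0) T K h \<rho>) \<and>
    (\<forall>\<rho>. midpoint_precession_rate (x 0) (v 0) T K h \<rho> \<longrightarrow>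
       \<bar>\<rho> - (J T - J 0) / (norm E)\<^sup>2 * h\<^sup>2\<bar> \<le> C * h ^ 4)"
proof -
  define e where "e = (norm E)\<^sup>2"
  have e: "0 < e" using E by (simp add: e_def)
  obtain C where C: "0 < C" and drift: "\<forall>\<^sub>F h in at_right 0. \<forall>y w.
      solves_within (K * h ^ 4) (truncated_rhs midpoint_term h) {0..T} y w \<and> y 0 = x 0 \<and> w 0 = v 0 \<longrightarrow>
      (\<forall>t\<in>{0..T}. norm (lrl (y t) (w t) - E) \<le> C * h\<^sup>2) \<and>
      \<bar>ang_mom E (lrl (y T) (w T)) - h\<^sup>2 * (J T - J 0)\<bar> \<le> C * h ^ 4"
    using lrl_drift[OF sol T K E(1) J] by blast
  define C1 where "C1 = C * max 1 (norm E)"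
  have C1: "0 < C1" using C by (simp add: C1_def less_max_iff_disj)
  have C1_ge: "C \<le> C1" "norm E * C \<le> C1" using C by (simp_all add: C1_def mult.commute)
  obtain C2 where angle: "\<forall>\<^sub>F h in at_right (0::real). \<forall>A B. \<bar>A - h\<^sup>2 * (J T - J 0)\<bar> \<le> C1 * h ^ 4 \<and> \<bar>B - e\<bar> \<le> C1 * h\<^sup>2 \<longrightarrow>
    \<bar>arctan (A / B) - (J T - J 0) / e * h\<^sup>2\<bar> \<le> C2 * h ^ 4"
    using angle_expansion[OF e C1] by blast
  have small: "\<forall>\<^sub>F h in at_right 0. 0 < h \<and> h \<le> 1 \<and> C * h\<^sup>2 \<le> norm E / 2"
    using E by (intro eventually_at_right_0_small) simp
  show ?thesis
  proof (rule exI[of _ C2], use drift angle small truncated_solution_exists[OF sol T] in eventually_elim)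
    fix h :: real
    assume drift: "\<forall>y w. solves_within (K * h ^ 4) (truncated_rhs midpoint_term h) {0..T} y w \<and> y 0 = x 0 \<and> w 0 = v 0 \<longrightarrow>
        (\<forall>t\<in>{0..T}. norm (lrl (y t) (w t) - E) \<le> C * h\<^sup>2) \<and>
        \<bar>ang_mom E (lrl (y T) (w T)) - h\<^sup>2 * (J T - J 0)\<bar> \<le> C * h ^ 4"
      and angle: "\<forall>A B. \<bar>A - h\<^sup>2 * (J T - J 0)\<bar> \<le> C1 * h ^ 4 \<and> \<bar>B - e\<bar> \<le> C1 * h\<^sup>2 \<longrightarrow>
        \<bar>arctan (A / B) - (J T - J 0) / e * h\<^sup>2\<bar> \<le> C2 * h ^ 4"
      and "0 < h \<and> h \<le> 1 \<and> C * h\<^sup>2 \<le> norm E / 2"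
      and ex: "\<exists>y w. solves (truncated_rhs midpoint_term h) {0..T} y w \<and> y 0 = x 0 \<and> w 0 = v 0"
    moreover have "0 < norm E" using E(2) by simp
    ultimately have h: "0 < h" "C * h\<^sup>2 < norm E" by linarith+
    have change: "lrl_angle_change T y w \<rho> \<longleftrightarrow> \<rho> = arctan (ang_mom E (lrl (y T) (w T)) / (E \<bullet> lrl (y T) (w T)))"
      if H: "solves_within (K * h ^ 4) (truncated_rhs midpoint_term h) {0..T} y w" "y 0 = x 0" "w 0 = v 0" for y w \<rho>
    proof (rule lrl_angle_change_iff[OF T])
      show "lrl (y 0) (w 0) = E" using H E by simp
      show "norm (lrl (y t) (w t) - E) < norm E" if "t \<in> {0..T}" for t
        using drift H that h(2) by (meson le_less_trans)
      have "continuous (at t within {0..T}) y" "continuous (at t within {0..T}) w" "y t \<noteq> 0" if "t \<in> {0..T}" for t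
        using H(1) that unfolding solves_within_def by (blast intro: has_vector_derivative_continuous)+
      then have "continuous_on {0..T} y" "continuous_on {0..T} w" "\<forall>t\<in>{0..T}. norm (y t) \<noteq> 0"
        by (auto simp: continuous_on_eq_continuous_within)
      then show "continuous_on {0..T} (\<lambda>t. lrl (y t) (w t))"
        unfolding lrl_def by (intro continuous_intros) auto
    qed
    have bound: "\<bar>arctan (ang_mom E (lrl (y T) (w T)) / (E \<bullet> lrl (y T) (w T))) - (J T - J 0) / e * h\<^sup>2\<bar> \<le> C2 * h ^ 4"
      if H: "solves_within (K * h ^ 4) (truncated_rhs midpoint_term h) {0..T} y w" "y 0 = x 0" "w 0 = v 0" for y w
    proof (rule angle[rule_format], rule conjI)
      have "\<bar>ang_mom E (lrl (y T) (w T)) - h\<^sup>2 * (J T - J 0)\<bar> \<le> C * h ^ 4" using drift H by blast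
      also have "\<dots> \<le> C1 * h ^ 4" using C1_ge h by (intro mult_right_mono) auto
      finally show "\<bar>ang_mom E (lrl (y T) (w T)) - h\<^sup>2 * (J T - J 0)\<bar> \<le> C1 * h ^ 4" .
      have "norm (lrl (y T) (w T) - E) \<le> C * h\<^sup>2" using drift H T by auto
      have "E \<bullet> lrl (y T) (w T) - e = E \<bullet> (lrl (y T) (w T) - E)"
        by (simp add: e_def power2_norm_eq_inner inner_diff_right)
      also have "\<bar>\<dots>\<bar> \<le> norm E * norm (lrl (y T) (w T) - E)" by (rule Cauchy_Schwarz_ineq2)
      also have "\<dots> \<le> norm E * (C * h\<^sup>2)" by (intro mult_left_mono) (fact, simp)
      also have "\<dots> \<le> C1 * h\<^sup>2" unfolding mult.assoc[symmetric] using C1_ge by (intro mult_right_mono) auto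
      finally show "\<bar>E \<bullet> lrl (y T) (w T) - e\<bar> \<le> C1 * h\<^sup>2" .
    qed
    show "(\<exists>\<rho>. midpoint_precession_rate (x 0) (v 0) T K h \<rho>) \<and>
      (\<forall>\<rho>. midpoint_precession_rate (x 0) (v 0) T K h \<rho> \<longrightarrow>
        \<bar>\<rho> - (J T - J 0) / (norm E)\<^sup>2 * h\<^sup>2\<bar> \<le> C2 * h ^ 4)"
    proof
      obtain y w where yw: "solves (truncated_rhs midpoint_term h) {0..T} y w" "y 0 = x 0" "w 0 = v 0"
        using ex by blast
      have "0 \<le> K * h ^ 4" using K h by simp
      then have "solves_within (K * h ^ 4) (truncated_rhs midpoint_term h) {0..T} y w"
        using yw(1) unfolding solves_within_def by (meson order_trans)
      then show "\<exists>\<rho>. midpoint_precession_rate (x 0) (v 0) T K h \<rho>"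
        unfolding midpoint_precession_rate_iff using change yw(2,3) by blast
      show "\<forall>\<rho>. midpoint_precession_rate (x 0) (v 0) T K h \<rho> \<longrightarrow>
        \<bar>\<rho> - (J T - J 0) / (norm E)\<^sup>2 * h\<^sup>2\<bar> \<le> C2 * h ^ 4"
        unfolding midpoint_precession_rate_iff e_def[symmetric] using change bound by auto
    qed
  qed
qed

theorem theorem7:
  fixes x v :: "real \<Rightarrow> real^2" and a b T :: real
  assumes "kepler_solution x v"
    and "energy (x 0) (v 0) < 0"
    and "ang_mom (x 0) (v 0) \<noteq> 0"
    and "norm (lrl (x 0) (v 0)) > 0"
    and "ellipse_focus_origin a b (range x)"
    and "minimal_period x T"
  shows "\<forall>K\<ge>0. \<exists>C. \<forall>\<^sub>F h in at_right 0.
           (\<exists>\<rho>. midpoint_precession_rate (x 0) (v 0) T K h \<rho>) \<and>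
           (\<forall>\<rho>. midpoint_precession_rate (x 0) (v 0) T K h \<rho> \<longrightarrow>
              \<bar>\<rho> - sgn (ang_mom (x 0) (v 0)) * (pi / 12) * (15 * (a^3 / b^6) - 3 * (a / b^4)) * h\<^sup>2\<bar>
                \<le> C * h ^ 4)"
proof (intro allI impI)
  fix K :: real assume K: "0 \<le> K"
  note sol = assms(1)
  define L where "L = ang_mom (x 0) (v 0)"
  define E where "E = lrl (x 0) (v 0)"
  have L: "L \<noteq> 0" and E: "E \<noteq> 0" using assms(3,4) by (auto simp: L_def E_def)
  have T: "0 \<le> T" using assms(6) by (simp add: minimal_period_def)
  have ab: "0 < b" "0 < a" using assms(5) by (auto simp: ellipse_focus_origin_def)
  have orbit: "E \<bullet> q = L\<^sup>2 - norm q" if "q \<in> range x" for q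
  proof -
    obtain t where "q = x t" using \<open>q \<in> range x\<close> by blast
    then show ?thesis
      using lrl_inner_position[OF kepler_solutionD(1)[OF sol], of t "v t"]
      unfolding E_def L_def kepler_lrl_constant[OF sol, of t] kepler_ang_mom_constant[OF sol, of t] by simp
  qed
  have axes: "L\<^sup>2 = b\<^sup>2 / a" "(norm E)\<^sup>2 = 1 - b\<^sup>2 / a\<^sup>2"
    using ellipse_lrl[OF assms(5), of E "L\<^sup>2"] orbit by blast+
  obtain J where J: "\<And>t. t \<in> {0..T} \<Longrightarrow> (J has_real_derivative
      ang_mom E (lrl_kick (x t) (v t) (midpoint_term (x t) (v t)))) (at t within {0..T})"
    and J_period: "J T - J 0 = sgn L * (pi * (norm E)\<^sup>2 * (1 + (norm E)\<^sup>2 / 4) / L ^ 6)"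
    using kepler_drift_primitive[OF sol assms(6) L_def L E_def E] by blast
  have "(J T - J 0) / (norm E)\<^sup>2 = sgn L * (pi * (1 + (norm E)\<^sup>2 / 4) / (L\<^sup>2) ^ 3)"
    unfolding J_period using E by (simp flip: power_mult)
  also have "\<dots> = sgn L * (pi / 12) * (15 * (a^3 / b^6) - 3 * (a / b^4))"
    unfolding axes using ab by (simp add: field_simps eval_nat_numeral)
  finally have rate: "(J T - J 0) / (norm E)\<^sup>2 = sgn L * (pi / 12) * (15 * (a^3 / b^6) - 3 * (a / b^4))" .
  show "\<exists>C. \<forall>\<^sub>F h in at_right 0.
      (\<exists>\<rho>. midpoint_precession_rate (x 0) (v 0) T K h \<rho>) \<and>
      (\<forall>\<rho>. midpoint_precession_rate (x 0) (v 0) T K h \<rho> \<longrightarrow>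
         \<bar>\<rho> - sgn (ang_mom (x 0) (v 0)) * (pi / 12) * (15 * (a^3 / b^6) - 3 * (a / b^4)) * h\<^sup>2\<bar>
           \<le> C * h ^ 4)"
    using midpoint_precession_expansion[OF sol T K E_def E J] unfolding rate L_def .
qed

end
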